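(* Let $m\geq 2$, let $\varphi:\mathbf R^d\to\mathbf R$ be a real polynomial $\varphi=\varphi_m+p$, where $p(x)=\sum_{0\leq|\alpha|<m}c_\alpha x^\alpha$ with $c_\alpha\in\mathbf R$, and $\varphi_m(x)=\sum_{|\alpha|=m}c_\alpha x^\alpha$ with $c_\alpha\in\mathbf R$ and $c_\alpha\neq 0$ for some $\alpha\in\mathbf N^d$ with $|\alpha|=m$. Let $u(x)=e^{i\varphi(x)}$, $x\in\mathbf R^d$. If $t>\frac1{m-1}$ then $$\mathrm{WF}^{t,t(m-1)}(u)\subseteq\{(x,\nabla\varphi_m(x))\in\mathbf R^{2d}:\ x\neq 0\}.$$ If $d=1$ and $\varphi$ is even or odd then $$\mathrm{WF}^{t,t(m-1)}(u)=\{(x,\varphi_m'(x))\in\mathbf R^2:\ x\neq 0\}.$$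
   Context: Gelfand--Shilov spaces. For $s,t,h>0$ let $\mathcal S_{t,h}^s(\mathbf R^d)$ be the Banach space of $f\in C^\infty(\mathbf R^d)$ with $\|f\|_{\mathcal S_{t,h}^s}=\sup_{x\in\mathbf R^d,\ \alpha,\beta\in\mathbf N^d}\frac{|x^\alpha D^\beta f(x)|}{h^{|\alpha+\beta|}\alpha!^t\beta!^s}<\infty$. Then $\Sigma_t^s(\mathbf R^d)=\bigcap_{h>0}\mathcal S_{t,h}^s(\mathbf R^d)$ with the Fréchet topology given by the seminorms $\|\cdot\|_{\mathcal S_{t,h}^s}$, $h>0$ (nontrivial iff $t+s>1$), and $(\Sigma_t^s)'(\mathbf R^d)$ is its topological dual; $\mathscr S'(\mathbf R^d)\subseteq(\Sigma_t^s)'(\mathbf R^d)$. The pairing $(u,f)$ is conjugate linear in $f$, consistent with the $L^2$ inner product (conjugate linear in the second argument). Short-time Fourier transform. For $\psi\in\Sigma_t^s(\mathbf R^d)\setminus 0$ and $u\in(\Sigma_t^s)'(\mathbf R^d)$, $V_\psi u(x,\xi)=(2\pi)^{-d/2}(u,M_\xi T_x\psi)$, where $T_x f(y)=f(y-x)$ and $M_\xi f(y)=e^{i\langle y,\xi\rangle}f(y)$. Wave front set. $T^*\mathbf R^d\setminus 0$ means $\mathbf R^{2d}\setminus\{0\}$. For $t,s>0$ with $t+s>1$, $u\in(\Sigma_t^s)'(\mathbf R^d)$ and $\psi\in\Sigma_t^s(\mathbf R^d)\setminus 0$, the set $\mathrm{WF}^{t,s}(u)\subseteq T^*\mathbf R^d\setminus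 0$ is defined by: $(x_0,\xi_0)\notin\mathrm{WF}^{t,s}(u)$ iff there is an open set $U\subseteq T^*\mathbf R^d\setminus 0$ containing $(x_0,\xi_0)$ such that $\sup_{\lambda>0,\,(x,\xi)\in U}e^{r\lambda}|V_\psi u(\lambda^t x,\lambda^s\xi)|<\infty$ for all $r>0$. It does not depend on $\psi$. *)

theory Defs
  imports "HOL-Analysis.Analysis" "HOL-Probability.Sinc_Integral"
begin

section \<open>Multi-indices, partial derivatives, smooth functions\<close>

text \<open>Multi-indices on \<open>R^d\<close> are functions \<open>'n \<Rightarrow> nat\<close>, where \<open>d = CARD('n)\<close>.\<close>

definition mi_abs :: "('n::finite \<Rightarrow> nat) \<Rightarrow> nat" where
  "mi_abs \<alpha> = (\<Sum>i\<in>UNIV. \<alpha> i)"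

text \<open>Sums over \<open>{\<alpha>. mi_abs \<alpha> < m}\<close> and \<open>{\<alpha>. mi_abs \<alpha> = m}\<close> are genuine finite sums.\<close>

lemma finite_mi_abs_le: "finite {\<alpha> :: 'n::finite \<Rightarrow> nat. mi_abs \<alpha> \<le> m}"
proof (rule finite_subset)
  show "{\<alpha> :: 'n \<Rightarrow> nat. mi_abs \<alpha> \<le> m} \<subseteq> PiE UNIV (\<lambda>_. {..m})"
  proof safe
    fix \<alpha> :: "'n \<Rightarrow> nat" and i assume "mi_abs \<alpha> \<le> m"
    moreover have "\<alpha> i \<le> mi_abs \<alpha>"
      unfolding mi_abs_def by (rule member_le_sum) simp_all
    ultimately show "\<alpha> i \<le> m" by linarith
  qed simp
  show "finite (PiE (UNIV :: 'n set) (\<lambda>_. {..m}))"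
    by (rule finite_PiE) auto
qed

definition mi_fact :: "('n::finite \<Rightarrow> nat) \<Rightarrow> real" where
  "mi_fact \<alpha> = (\<Prod>i\<in>UNIV. fact (\<alpha> i))"

definition mi_pow :: "real ^ 'n \<Rightarrow> ('n::finite \<Rightarrow> nat) \<Rightarrow> real" where
  "mi_pow x \<alpha> = (\<Prod>i\<in>UNIV. (x $ i) ^ \<alpha> i)"

definition partial ::
    "'n \<Rightarrow> (real ^ 'n \<Rightarrow> 'b) \<Rightarrow> real ^ 'n \<Rightarrow> 'b::real_normed_vector" where
  "partial i f x = frechet_derivative f (at x) (axis i 1)"

definition grad :: "(real ^ 'n \<Rightarrow> real) \<Rightarrow> real ^ 'n \<Rightarrow> real ^ 'n" where
  "grad f x = (\<chi> i. partial i f x)"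

text \<open>\<open>f \<in> C^\<infinity>\<close>: all iterated partial derivatives, in any order, are everywhere (Frechet)
  differentiable.\<close>

definition smooth :: "(real ^ 'n::finite \<Rightarrow> 'b::real_normed_vector) \<Rightarrow> bool" where
  "smooth f \<longleftrightarrow> (\<forall>is x. foldr partial is f differentiable (at x))"

text \<open>\<open>\<partial>^\<beta> f\<close>, the coordinates being taken in a fixed but unspecified order; on smooth functions
  the order is irrelevant. The convention \<open>D^\<beta> = (-i)^|\<beta>| \<partial>^\<beta>\<close> differs by a unimodular factor
  only, which plays no role below since only \<open>|D^\<beta> f|\<close> is used.\<close>

definition mi_deriv ::
    "('n::finite \<Rightarrow> nat) \<Rightarrow> (real ^ 'n \<Rightarrow> 'b::real_normed_vector) \<Rightarrow> real ^ 'n \<Rightarrow> 'b" where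
  "mi_deriv \<beta> f =
     foldr (\<lambda>i. partial i ^^ \<beta> i) (SOME is. distinct is \<and> set is = UNIV) f"

section \<open>Gelfand--Shilov spaces of Beurling type and their duals\<close>

text \<open>The norm is extended-valued, so that finiteness is part of membership in the space.\<close>

definition GS_norm ::
    "real \<Rightarrow> real \<Rightarrow> real \<Rightarrow> (real ^ 'n::finite \<Rightarrow> complex) \<Rightarrow> ennreal" where
  "GS_norm t s h f =
     (SUP (x, \<alpha>, \<beta>) \<in> UNIV.
        ennreal (norm (of_real (mi_pow x \<alpha>) * mi_deriv \<beta> f x)
          / (h ^ (mi_abs \<alpha> + mi_abs \<beta>) * mi_fact \<alpha> powr t * mi_fact \<beta> powr s)))"

definition GS_Banach :: "real \<Rightarrow> real \<Rightarrow> real \<Rightarrow> (real ^ 'n::finite \<Rightarrow> complex) set" where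
  "GS_Banach t s h = {f. smooth f \<and> GS_norm t s h f < \<infinity>}"

definition GS_Sigma :: "real \<Rightarrow> real \<Rightarrow> (real ^ 'n::finite \<Rightarrow> complex) set" where
  "GS_Sigma t s = (\<Inter>h\<in>{0<..}. GS_Banach t s h)"

definition GS_topology :: "real \<Rightarrow> real \<Rightarrow> (real ^ 'n::finite \<Rightarrow> complex) topology" where
  "GS_topology t s = topology_generated_by
     {{g \<in> GS_Sigma t s. GS_norm t s h (\<lambda>x. g x - f x) < ennreal e} | f h e.
        f \<in> GS_Sigma t s \<and> 0 < h \<and> 0 < e}"

text \<open>The ultradistributions: continuous conjugate linear functionals on \<open>GS_Sigma t s\<close>.
  They are represented by HOL functions whose values outside \<open>GS_Sigma t s\<close> are irrelevant.\<close>

definition GS_dual ::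
    "real \<Rightarrow> real \<Rightarrow> ((real ^ 'n::finite \<Rightarrow> complex) \<Rightarrow> complex) set" where
  "GS_dual t s = {u.
     (\<forall>f\<in>GS_Sigma t s. \<forall>g\<in>GS_Sigma t s. u (\<lambda>x. f x + g x) = u f + u g) \<and>
     (\<forall>c. \<forall>f\<in>GS_Sigma t s. u (\<lambda>x. c * f x) = cnj c * u f) \<and>
     continuous_map (GS_topology t s) euclidean u}"

text \<open>The embedding of functions into ultradistributions, by the \<open>L^2\<close> pairing.\<close>

definition distr_of :: "(real ^ 'n::finite \<Rightarrow> complex) \<Rightarrow> (real ^ 'n \<Rightarrow> complex) \<Rightarrow> complex" where
  "distr_of u f = (LINT x|lborel. u x * cnj (f x))"

section \<open>Short-time Fourier transform and anisotropic wave front set\<close>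

definition translation :: "real ^ 'n \<Rightarrow> (real ^ 'n \<Rightarrow> complex) \<Rightarrow> real ^ 'n \<Rightarrow> complex" where
  "translation x f = (\<lambda>y. f (y - x))"

definition modulation :: "real ^ 'n::finite \<Rightarrow> (real ^ 'n \<Rightarrow> complex) \<Rightarrow> real ^ 'n \<Rightarrow> complex" where
  "modulation \<xi> f = (\<lambda>y. exp (\<i> * of_real (y \<bullet> \<xi>)) * f y)"

definition STFT ::
    "(real ^ 'n::finite \<Rightarrow> complex) \<Rightarrow> ((real ^ 'n \<Rightarrow> complex) \<Rightarrow> complex)
      \<Rightarrow> real ^ 'n \<Rightarrow> real ^ 'n \<Rightarrow> complex" where
  "STFT \<psi> u x \<xi> =
     of_real ((2 * pi) powr (- real CARD('n) / 2)) * u (modulation \<xi> (translation x \<psi>))"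

text \<open>The window \<open>\<psi>\<close> is an explicit parameter: statements about \<open>WF^{t,s}(u)\<close> are to be made for
  every nonzero \<open>\<psi> \<in> GS_Sigma t s\<close>. In \<open>T^* R^d\<close> the origin is \<open>0 = (0, 0)\<close>.\<close>

definition WF ::
    "real \<Rightarrow> real \<Rightarrow> (real ^ 'n::finite \<Rightarrow> complex) \<Rightarrow> ((real ^ 'n \<Rightarrow> complex) \<Rightarrow> complex)
      \<Rightarrow> ((real ^ 'n) \<times> (real ^ 'n)) set" where
  "WF t s \<psi> u = {z. z \<noteq> 0 \<and>
     \<not> (\<exists>U. open U \<and> 0 \<notin> U \<and> z \<in> U \<and>
          (\<forall>r>0. bdd_above ((\<lambda>(l, x, \<xi>).
             exp (r * l) * norm (STFT \<psi> u ((l powr t) *\<^sub>R x) ((l powr s) *\<^sub>R \<xi>)))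
             ` ({0<..} \<times> U))))}"

section \<open>Bounded measurable functions are ultradistributions\<close>

lemma mi_deriv_0 [simp]: "mi_deriv (\<lambda>_. 0) f = f"
proof -
  have "foldr (\<lambda>i. partial i ^^ 0) is f = f" for "is"
    by (induction "is") auto
  then show ?thesis by (simp add: mi_deriv_def)
qed

lemma partial_zero: "partial i (\<lambda>_. 0) = (\<lambda>_. 0)"
  by (auto simp: partial_def fun_eq_iff)

lemma mi_deriv_zero: "mi_deriv \<beta> (\<lambda>_. 0) = (\<lambda>_. 0)"
proof -
  have p: "(partial i ^^ n) (\<lambda>_. 0) = (\<lambda>_. 0)" for i n
    by (induction n) (auto simp: partial_zero)
  have "foldr (\<lambda>i. partial i ^^ \<beta> i) is (\<lambda>_. 0) = (\<lambda>_. 0)" for "is"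
    by (induction "is") (auto simp: p)
  then show ?thesis by (simp add: mi_deriv_def)
qed

lemma GS_norm_zero: "GS_norm t s h (\<lambda>_. 0) = 0"
  by (simp add: GS_norm_def mi_deriv_zero case_prod_beta)

lemma topspace_GS_topology: "topspace (GS_topology t s) = GS_Sigma t s"
proof -
  have "f \<in> topspace (GS_topology t s)" if "f \<in> GS_Sigma t s" for f
    unfolding GS_topology_def topology_generated_by_topspace
  proof (rule UnionI)
    show "f \<in> {g \<in> GS_Sigma t s. GS_norm t s 1 (\<lambda>x. g x - f x) < ennreal 1}"
      using that by (simp add: GS_norm_zero)
  qed (use that zero_less_one in blast)
  then show ?thesis
    by (auto simp: GS_topology_def)
qed

definition weight :: "real ^ 'n::finite \<Rightarrow> real" where
  "weight x = (\<Prod>i\<in>UNIV. 1 + (x $ i)\<^sup>2)"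

lemma weight_pos: "weight x > 0"
  unfolding weight_def by (intro prod_pos) (auto intro: add_pos_nonneg)

lemma nn_integral_inverse_weight:
  "(\<integral>\<^sup>+x. ennreal (inverse (weight (x :: real ^ 'n::finite))) \<partial>lborel) < \<infinity>"
proof -
  let ?g = "\<lambda>x::real. ennreal (inverse (1 + x\<^sup>2))"
  have "integrable lborel (\<lambda>x::real. inverse (1 + x\<^sup>2))"
    using integrable_inverse_1_plus_square by (simp add: set_integrable_def)
  then have g: "(\<integral>\<^sup>+x. ?g x \<partial>lborel) < \<infinity>"
    by (subst nn_integral_eq_integral) auto
  have w: "ennreal (inverse (weight x)) = (\<Prod>b\<in>Basis. ?g (x \<bullet> b))" for x :: "real ^ 'n"
  proof -
    have B: "(Basis :: (real ^ 'n) set) = (\<lambda>i. axis i 1) ` UNIV"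
      by (auto simp: Basis_vec_def)
    have inj: "inj (\<lambda>i::'n. axis i (1::real))"
      by (auto simp: inj_on_def axis_eq_axis)
    show ?thesis
      unfolding B
      by (subst prod.reindex[OF inj])
         (simp add: weight_def inner_axis o_def prod_ennreal prod_inversef[symmetric])
  qed
  have "(\<integral>\<^sup>+x. ennreal (inverse (weight (x :: real ^ 'n))) \<partial>lborel)
      = (\<Prod>b\<in>(Basis :: (real ^ 'n) set). \<integral>\<^sup>+x. ?g x \<partial>lborel)"
    unfolding w by (rule nn_integral_lborel_prod) auto
  also have "\<dots> < \<infinity>"
    using g by (simp add: power_less_top_ennreal)
  finally show ?thesis .
qed

lemma integrable_inverse_weight:
  "integrable lborel (\<lambda>x :: real ^ 'n::finite. inverse (weight x))"
proof (rule integrableI_bounded)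
  show "(\<lambda>x :: real ^ 'n. inverse (weight x)) \<in> borel_measurable lborel"
    unfolding weight_def by measurable
  show "(\<integral>\<^sup>+x. ennreal (norm (inverse (weight (x :: real ^ 'n)))) \<partial>lborel) < \<infinity>"
    using nn_integral_inverse_weight[where 'n = 'n] by (simp add: weight_pos abs_of_pos)
qed

lemma GS_norm_decay:
  fixes f :: "real ^ 'n::finite \<Rightarrow> complex"
  assumes "GS_norm t s 1 f \<le> ennreal N" "N \<ge> 0"
  shows "norm (f x) \<le> 2 ^ CARD('n) * (2 ^ CARD('n)) powr \<bar>t\<bar> * N * inverse (weight x)"
proof -
  let ?K = "(2 ^ CARD('n)) powr \<bar>t\<bar> :: real"
  define \<alpha> :: "'n set \<Rightarrow> 'n \<Rightarrow> nat" where "\<alpha> S i = (if i \<in> S then 2 else 0)" for S i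
  have term_le: "mi_pow x (\<alpha> S) * norm (f x) \<le> ?K * N" for S
  proof -
    have pow: "mi_pow x (\<alpha> S) \<ge> 0"
      unfolding mi_pow_def \<alpha>_def by (intro prod_nonneg) auto
    have fa: "mi_fact (\<alpha> S) \<ge> 1"
      unfolding mi_fact_def \<alpha>_def by (intro prod_ge_1) auto
    have "mi_fact (\<alpha> S) \<le> (\<Prod>i\<in>(UNIV :: 'n set). 2)"
      unfolding mi_fact_def \<alpha>_def by (intro prod_mono) auto
    then have fb: "mi_fact (\<alpha> S) \<le> 2 ^ CARD('n)" by simp
    have "mi_fact (\<alpha> S) powr t \<le> mi_fact (\<alpha> S) powr \<bar>t\<bar>"
      using fa by (intro powr_mono) auto
    also have "\<dots> \<le> ?K"
      using fa fb by (intro powr_mono2) auto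
    finally have fK: "mi_fact (\<alpha> S) powr t \<le> ?K" .
    have "ennreal (norm (of_real (mi_pow x (\<alpha> S)) * f x) / mi_fact (\<alpha> S) powr t)
        \<le> GS_norm t s 1 f"
      unfolding GS_norm_def
      by (rule SUP_upper2[of "(x, \<alpha> S, \<lambda>_. 0)"]) (auto simp: mi_fact_def[of "\<lambda>_. 0"])
    also note assms(1)
    finally have "mi_pow x (\<alpha> S) * norm (f x) / mi_fact (\<alpha> S) powr t \<le> N"
      using assms(2) pow by (simp add: norm_mult)
    then have "mi_pow x (\<alpha> S) * norm (f x) \<le> N * mi_fact (\<alpha> S) powr t"
      using fa by (simp add: pos_divide_le_eq)
    also have "\<dots> \<le> N * ?K"
      using fK assms(2) by (rule mult_left_mono)
    finally show ?thesis by (simp add: mult.commute)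
  qed
  have "weight x = (\<Sum>S\<in>Pow UNIV. mi_pow x (\<alpha> S))"
  proof -
    have "weight x = (\<Prod>i\<in>UNIV. (x $ i)\<^sup>2 + 1)"
      by (simp add: weight_def add.commute)
    also have "\<dots> = (\<Sum>S\<in>Pow UNIV. (\<Prod>i\<in>S. (x $ i)\<^sup>2) * (\<Prod>i\<in>UNIV - S. 1))"
      by (rule prod_add) simp
    also have "\<dots> = (\<Sum>S\<in>Pow UNIV. mi_pow x (\<alpha> S))"
    proof (rule sum.cong[OF refl])
      fix S :: "'n set"
      have "mi_pow x (\<alpha> S) = (\<Prod>i\<in>UNIV. if i \<in> S then (x $ i)\<^sup>2 else 1)"
        unfolding mi_pow_def \<alpha>_def by (rule prod.cong) auto
      then show "(\<Prod>i\<in>S. (x $ i)\<^sup>2) * (\<Prod>i\<in>UNIV - S. 1) = mi_pow x (\<alpha> S)"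
        by (simp add: prod.If_cases)
    qed
    finally show ?thesis .
  qed
  then have "weight x * norm (f x) = (\<Sum>S\<in>Pow UNIV. mi_pow x (\<alpha> S) * norm (f x))"
    by (simp add: sum_distrib_right)
  also have "\<dots> \<le> (\<Sum>S\<in>(Pow UNIV :: 'n set set). ?K * N)"
    using term_le by (intro sum_mono)
  also have "\<dots> = 2 ^ CARD('n) * ?K * N"
    by (simp add: card_Pow del: Pow_UNIV)
  finally show ?thesis
    using weight_pos[of x] by (simp add: field_simps)
qed

lemma GS_Sigma_continuous:
  assumes "f \<in> GS_Sigma t s"
  shows "continuous_on UNIV f"
proof -
  have "f \<in> GS_Banach t s 1"
    using assms by (auto simp: GS_Sigma_def)
  then have "foldr partial [] f differentiable (at x)" for x
    unfolding GS_Banach_def smooth_def by blast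
  then show ?thesis
    by (auto intro!: continuous_at_imp_continuous_on differentiable_imp_continuous_within)
qed

proposition distr_of_in_GS_dual:
  fixes u :: "real ^ 'n::finite \<Rightarrow> complex"
  assumes meas: "u \<in> borel_measurable borel" and bound: "\<And>x. norm (u x) \<le> C"
  shows "distr_of u \<in> GS_dual t s"
proof -
  have [measurable]: "u \<in> borel_measurable borel" by fact
  have C: "C \<ge> 0" using bound[of 0] norm_ge_zero order_trans by blast
  define J where "J = (LINT x|lborel. inverse (weight (x :: real ^ 'n)))"
  define A :: real where "A = 2 ^ CARD('n) * (2 ^ CARD('n)) powr \<bar>t\<bar>"
  have A: "A \<ge> 0" by (simp add: A_def)
  have J: "J \<ge> 0"
    unfolding J_def by (intro integral_nonneg_AE) (auto intro: less_imp_le weight_pos)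
  have ptw: "norm (u x * cnj (f x)) \<le> C * (A * N) * inverse (weight x)"
    if "GS_norm t s 1 f \<le> ennreal N" "N \<ge> 0" for f N x
  proof -
    have "norm (u x) * norm (f x) \<le> C * (A * N * inverse (weight x))"
      using bound GS_norm_decay[OF that] C unfolding A_def by (intro mult_mono) auto
    then show ?thesis by (simp add: norm_mult mult.assoc)
  qed
  have int: "integrable lborel (\<lambda>x. u x * cnj (f x))"
    if "continuous_on UNIV f" "GS_norm t s 1 f \<le> ennreal N" "N \<ge> 0" for f N
  proof (rule Bochner_Integration.integrable_bound)
    show "integrable lborel (\<lambda>x :: real ^ 'n. C * (A * N) * inverse (weight x))"
      by (intro integrable_mult_right integrable_inverse_weight)
    have [measurable]: "f \<in> borel_measurable borel"
      using that(1) by (rule borel_measurable_continuous_onI)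
    have [measurable]: "(\<lambda>x. cnj (f x)) \<in> borel_measurable borel"
      by (intro borel_measurable_continuous_onI continuous_on_cnj that(1))
    show "(\<lambda>x. u x * cnj (f x)) \<in> borel_measurable lborel" by measurable
    show "AE x in lborel. norm (u x * cnj (f x)) \<le> norm (C * (A * N) * inverse (weight x))"
      using ptw[OF that(2,3)] by (intro AE_I2) (auto intro: order_trans abs_ge_self)
  qed
  have int': "integrable lborel (\<lambda>x. u x * cnj (f x))" if "f \<in> GS_Sigma t s" for f
  proof -
    have "GS_norm t s 1 f < \<infinity>"
      using that by (auto simp: GS_Sigma_def GS_Banach_def)
    then have "GS_norm t s 1 f \<le> ennreal (enn2real (GS_norm t s 1 f))"
      by simp
    then show ?thesis
      by (rule int[OF GS_Sigma_continuous[OF that]]) simp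
  qed
  have est: "norm (distr_of u f) \<le> C * (A * N) * J"
    if "GS_norm t s 1 f \<le> ennreal N" "N \<ge> 0" "continuous_on UNIV f" for f N
  proof -
    have "norm (distr_of u f) \<le> (LINT x|lborel. C * (A * N) * inverse (weight (x :: real ^ 'n)))"
      unfolding distr_of_def
      by (rule Bochner_Integration.integral_norm_bound_integral)
         (use int[OF that(3,1,2)] ptw[OF that(1,2)] in
           \<open>auto intro!: integrable_mult_right integrable_inverse_weight simp del: norm_mult\<close>)
    then show ?thesis by (simp add: J_def)
  qed
  have add: "distr_of u (\<lambda>x. f x + g x) = distr_of u f + distr_of u g"
    if "f \<in> GS_Sigma t s" "g \<in> GS_Sigma t s" for f g
    using int'[OF that(1)] int'[OF that(2)] by (simp add: distr_of_def distrib_left)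
  have diff: "distr_of u (\<lambda>x. f x - g x) = distr_of u f - distr_of u g"
    if "f \<in> GS_Sigma t s" "g \<in> GS_Sigma t s" for f g
    using int'[OF that(1)] int'[OF that(2)] by (simp add: distr_of_def right_diff_distrib)
  have scale: "distr_of u (\<lambda>x. c * f x) = cnj c * distr_of u f" for c f
    by (simp add: distr_of_def mult.left_commute)
  have "continuous_map (GS_topology t s) euclidean (distr_of u)"
    unfolding continuous_map_def topspace_GS_topology
  proof (intro conjI allI impI)
    fix S :: "complex set"
    assume "openin euclidean S"
    then have S: "open S" by simp
    show "openin (GS_topology t s) {f \<in> GS_Sigma t s. distr_of u f \<in> S}"
    proof (subst openin_subopen, safe)
      fix f assume f: "f \<in> GS_Sigma t s" "distr_of u f \<in> S"
      obtain e where e: "e > 0" "ball (distr_of u f) e \<subseteq> S"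
        using S f(2) open_contains_ball by blast
      define \<delta> where "\<delta> = e / (C * A * J + 1)"
      have D: "C * A * J + 1 > 0" using A C J by (simp add: add_nonneg_pos)
      have \<delta>: "\<delta> > 0" using e(1) D by (simp add: \<delta>_def)
      let ?B = "{g \<in> GS_Sigma t s. GS_norm t s 1 (\<lambda>x. g x - f x) < ennreal \<delta>}"
      have "openin (GS_topology t s) ?B"
        unfolding GS_topology_def
        by (rule topology_generated_by_Basis) (use f(1) \<delta> zero_less_one in blast)
      moreover have "f \<in> ?B" using f \<delta> by (simp add: GS_norm_zero)
      moreover have "?B \<subseteq> {g \<in> GS_Sigma t s. distr_of u g \<in> S}"
      proof safe
        fix g assume g: "g \<in> GS_Sigma t s" "GS_norm t s 1 (\<lambda>x. g x - f x) < ennreal \<delta>"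
        have "norm (distr_of u g - distr_of u f) \<le> C * (A * \<delta>) * J"
          unfolding diff[OF g(1) f(1), symmetric] using g \<delta>
          by (intro est) (auto intro!: less_imp_le continuous_on_diff
                GS_Sigma_continuous[OF g(1)] GS_Sigma_continuous[OF f(1)])
        also have "\<dots> = C * A * J * \<delta>" by simp
        also have "\<dots> < (C * A * J + 1) * \<delta>" using \<delta> by (simp add: distrib_right)
        also have "\<dots> = e" using D by (simp add: \<delta>_def)
        finally show "distr_of u g \<in> S"
          using e(2) by (auto simp: dist_norm norm_minus_commute)
      qed
      ultimately show "\<exists>T. openin (GS_topology t s) T \<and> f \<in> T \<and>
          T \<subseteq> {f \<in> GS_Sigma t s. distr_of u f \<in> S}"
        by blast
    qed
  qed auto
  then show ?thesis
    using add scale by (simp add: GS_dual_def)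
qed

end

theory Submission
  imports Defs "HOL-Probability.Characteristic_Functions" "HOL-Real_Asymp.Real_Asymp"
begin

text \<open>Near a point \<open>x\<close> the chirp \<open>u = exp (\<i> * \<phi>)\<close> oscillates with frequency \<open>\<nabla>\<phi> x\<close>, and on the scale
  \<open>\<lambda>\<^sup>t x\<close> this frequency is \<open>\<lambda>\<^sup>s \<nabla>\<phi>m x\<close> up to lower order, where \<open>s = t (m - 1)\<close>. So one expects the
  short-time Fourier transform at \<open>(\<lambda>\<^sup>t x, \<lambda>\<^sup>s \<xi>)\<close> to be negligible unless \<open>\<xi> = \<nabla>\<phi>m x\<close>, and not to be
  negligible there. Up to constants and a factor of modulus one, the transform is the Fourier transform
  at \<open>\<xi>\<close> of \<open>y \<mapsto> exp (\<i> * \<phi> (x + y)) * cnj (\<psi> y)\<close>, called \<open>oscillatory_integral\<close> below.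

  The quantitative core is \<open>oscillatory_integral_bound\<close>: for every \<open>h > 0\<close>, as long as \<open>N \<le> \<lambda>\<close> and
  \<open>|x| = O(\<lambda>\<^sup>t)\<close>, the integral times \<open>|\<xi>\<^sub>i - \<partial>\<^sub>i \<phi> x| ^ N\<close> is \<open>O((h \<lambda>\<^sup>s) ^ N)\<close>. It results from \<open>N\<close>
  integrations by parts in \<open>y\<^sub>i\<close> against the constant frequency \<open>\<xi>\<^sub>i - \<partial>\<^sub>i \<phi> x\<close>
  (\<open>fourier_integral_power\<close>). The remaining phase \<open>Q\<close> satisfies \<open>\<partial>\<^sub>i Q 0 = 0\<close>, and each
  derivative of \<open>exp (\<i> * Q)\<close> costs at most \<open>h \<lambda>\<^sup>s + A |y| ^ (m - 1)\<close> (\<open>norm_exp_derivs_le\<close> and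
  \<open>phase_derivs_bound\<close>; the assumption \<open>s > 1\<close> makes all derivatives of \<open>Q\<close> of order at least two
  harmless). The powers of \<open>|y|\<close> are absorbed by the window, and \<open>s = t (m - 1)\<close> is exactly the relation
  under which its decay of order \<open>t\<close> turns \<open>|y| ^ ((m - 1) j)\<close> into at most \<open>(const * \<lambda>\<^sup>s) ^ j\<close>
  (\<open>amplitude_bound\<close>).

  Taking \<open>N\<close> as the integer part of \<open>\<lambda>\<close> gives decay \<open>exp (- r \<lambda>)\<close> for every \<open>r\<close> wherever
  \<open>\<xi> \<noteq> \<nabla>\<phi>m x\<close> (\<open>STFT_decay\<close>). Conversely, the supremum of \<open>|\<psi>|\<close> is bounded by the \<open>L\<^sup>1\<close> norm of the
  transform in \<open>\<xi>\<close> (\<open>norm_le_integral_fourier\<close>), and the same estimate shows that frequencies away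
  from \<open>\<nabla>\<phi> (\<lambda>\<^sup>t x)\<close> contribute a negligible part of that norm. If the transform decayed near
  \<open>(x, \<nabla>\<phi>m x)\<close> as well, the whole norm would tend to \<open>0\<close> as \<open>\<lambda> \<rightarrow> \<infinity>\<close> and \<open>\<psi>\<close> would vanish
  (\<open>STFT_no_decay\<close>).\<close>

section \<open>Polynomials of bounded degree\<close>

text \<open>Generating polynomials by constants, sums and multiplication by a coordinate gives every estimate
  below by rule induction, with no reference to coefficients.\<close>

inductive poly_degree_le :: "nat \<Rightarrow> (real ^ 'n \<Rightarrow> real) \<Rightarrow> bool" where
  const: "poly_degree_le k (\<lambda>_. a)"
| add: "poly_degree_le k f \<Longrightarrow> poly_degree_le k g \<Longrightarrow> poly_degree_le k (\<lambda>x. f x + g x)"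
| coord: "poly_degree_le k f \<Longrightarrow> poly_degree_le (Suc k) (\<lambda>x. x $ j * f x)"

lemma poly_degree_le_mono:
  assumes "poly_degree_le k f" "k \<le> l"
  shows "poly_degree_le l f"
  using assms
proof (induction arbitrary: l rule: poly_degree_le.induct)
  case (coord k f j)
  then obtain l' where "l = Suc l'" "k \<le> l'" by (cases l) auto
  then show ?case using coord by (auto intro: poly_degree_le.coord)
qed (auto intro: poly_degree_le.intros)

lemma poly_degree_le_scale:
  assumes "poly_degree_le k f"
  shows "poly_degree_le k (\<lambda>x. b * f x)"
  using assms
proof induction
  case (coord k f j)
  from poly_degree_le.coord[OF coord.IH, of j] show ?case by (simp add: mult.left_commute)
qed (auto intro: poly_degree_le.intros simp: distrib_left)

lemma poly_degree_le_sum: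
  assumes "finite A" "\<And>a. a \<in> A \<Longrightarrow> poly_degree_le k (f a)"
  shows "poly_degree_le k (\<lambda>x. \<Sum>a\<in>A. f a x)"
  using assms by (induction rule: finite_induct) (auto intro: poly_degree_le.intros)

lemma poly_degree_le_coord_power:
  assumes "poly_degree_le k f"
  shows "poly_degree_le (n + k) (\<lambda>x. (x $ i) ^ n * f x)"
proof (induction n)
  case (Suc n)
  from poly_degree_le.coord[OF this, of i] show ?case by (simp add: mult.assoc)
qed (use assms in simp)

lemma poly_degree_le_mi_pow:
  assumes "mi_abs \<alpha> \<le> k"
  shows "poly_degree_le k (\<lambda>x. mi_pow x \<alpha>)"
proof -
  have "poly_degree_le (\<Sum>i\<in>S. \<alpha> i) (\<lambda>x. \<Prod>i\<in>S. (x $ i) ^ \<alpha> i)" for S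
  proof (induction S rule: infinite_finite_induct)
    case (insert i S)
    from poly_degree_le_coord_power[OF this(3), of "\<alpha> i" i] insert(1,2) show ?case by simp
  qed (auto intro: poly_degree_le.const)
  then show ?thesis
    using assms unfolding mi_pow_def mi_abs_def by (blast intro: poly_degree_le_mono)
qed

lemma poly_degree_le_differentiable:
  assumes "poly_degree_le k f"
  shows "f differentiable (at x)"
  using assms
proof induction
  case (coord k f j)
  have "(\<lambda>x :: real ^ 'a. x $ j) differentiable (at x)"
    by (intro bounded_linear_imp_differentiable bounded_linear_vec_nth)
  then show ?case using coord.IH by (rule differentiable_mult)
qed auto

lemma poly_degree_le_continuous:
  assumes "poly_degree_le k f"
  shows "continuous_on S f"
  using poly_degree_le_differentiable[OF assms]
  by (auto intro!: continuous_at_imp_continuous_on differentiable_imp_continuous_within)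

lemma partial_eqI:
  assumes "(f has_derivative f') (at x)"
  shows "partial i f x = f' (axis i 1)"
  using frechet_derivative_at[OF assms] by (simp add: partial_def)

lemma partial_add:
  assumes "f differentiable (at x)" "g differentiable (at x)"
  shows "partial i (\<lambda>x. f x + g x) x = partial i f x + partial i g x"
  using has_derivative_add[OF assms[unfolded frechet_derivative_works]]
  by (subst partial_eqI) (auto simp: partial_def)

lemma partial_coord_mult:
  fixes f :: "real ^ 'n \<Rightarrow> real"
  assumes "f differentiable (at x)"
  shows "partial i (\<lambda>x. x $ j * f x) x = (if i = j then f x else 0) + x $ j * partial i f x"
proof -
  have "((\<lambda>x. x $ j * f x) has_derivative
      (\<lambda>h. x $ j * frechet_derivative f (at x) h + h $ j * f x)) (at x)"
    by (intro has_derivative_mult bounded_linear_imp_has_derivative bounded_linear_vec_nth)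
       (use assms in \<open>simp add: frechet_derivative_works\<close>)
  from partial_eqI[OF this, of i] show ?thesis by (simp add: partial_def axis_def)
qed

lemma partial_const: "partial i (\<lambda>_. a) = (\<lambda>_. 0)"
  by (auto simp: partial_def fun_eq_iff frechet_derivative_const)

lemma poly_degree_le_0_const: "poly_degree_le 0 f \<Longrightarrow> \<exists>a. f = (\<lambda>_. a)"
  by (induction "0::nat" f rule: poly_degree_le.induct) auto

lemma poly_degree_le_partial:
  assumes "poly_degree_le k f"
  shows "poly_degree_le (k - 1) (partial i f)"
  using assms
proof induction
  case (const k a)
  show ?case by (simp add: partial_const poly_degree_le.const)
next
  case (add k f g)
  have "partial i (\<lambda>x. f x + g x) = (\<lambda>x. partial i f x + partial i g x)"
    using add.hyps by (auto simp: fun_eq_iff intro!: partial_add poly_degree_le_differentiable)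
  then show ?case using add.IH by (simp add: poly_degree_le.add)
next
  case (coord k f j)
  have eq: "partial i (\<lambda>x. x $ j * f x) = (\<lambda>x. (if i = j then f x else 0) + x $ j * partial i f x)"
    using partial_coord_mult[OF poly_degree_le_differentiable[OF coord.hyps]] by blast
  have 1: "poly_degree_le k (\<lambda>x. if i = j then f x else 0)"
    using coord.hyps by (cases "i = j") (auto intro: poly_degree_le.const)
  have 2: "poly_degree_le k (\<lambda>x. x $ j * partial i f x)"
  proof (cases k)
    case 0
    then obtain a where "f = (\<lambda>_. a)" using coord.hyps poly_degree_le_0_const by blast
    then have "partial i f = (\<lambda>_. 0)" by (simp add: partial_const)
    then show ?thesis by (simp add: poly_degree_le.const)
  next
    case (Suc k')
    then show ?thesis using poly_degree_le.coord[OF coord.IH] by simp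
  qed
  show ?case unfolding eq using poly_degree_le.add[OF 1 2] by simp
qed

lemma poly_degree_le_partial_power:
  assumes "poly_degree_le k f"
  shows "poly_degree_le (k - n) ((partial i ^^ n) f)"
proof (induction n)
  case (Suc n)
  from poly_degree_le_partial[OF this, of i] show ?case by simp
qed (use assms in simp)

lemma partial_power_eq_0:
  assumes "poly_degree_le k f" "n > k"
  shows "(partial i ^^ n) f = (\<lambda>_. 0)"
proof -
  obtain a where "(partial i ^^ k) f = (\<lambda>_. a)"
    using poly_degree_le_partial_power[OF assms(1), of k i] poly_degree_le_0_const by auto
  then have *: "(partial i ^^ Suc k) f = (\<lambda>_. 0)"
    by (simp add: partial_const)
  have "(partial i ^^ (j + Suc k)) f = (\<lambda>_. 0)" for j
    by (induction j) (use * in \<open>auto simp: partial_zero\<close>)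
  from this[of "n - Suc k"] assms(2) show ?thesis by simp
qed

lemma poly_degree_le_growth:
  assumes "poly_degree_le k f"
  obtains C where "C > 0" "\<And>x. \<bar>f x\<bar> \<le> C * (1 + norm x) ^ k"
proof -
  have "\<exists>C>0. \<forall>x. \<bar>f x\<bar> \<le> C * (1 + norm x) ^ k"
    using assms
  proof induction
    case (const k a)
    have "\<bar>a\<bar> * 1 \<le> (\<bar>a\<bar> + 1) * (1 + norm x) ^ k" for x :: "real ^ 'a"
      by (intro mult_mono) auto
    then show ?case by (intro exI[of _ "\<bar>a\<bar> + 1"]) auto
  next
    case (add k f g)
    then obtain C D where C: "C > 0" "\<And>x. \<bar>f x\<bar> \<le> C * (1 + norm x) ^ k"
      and D: "D > 0" "\<And>x. \<bar>g x\<bar> \<le> D * (1 + norm x) ^ k" by auto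
    have "\<bar>f x + g x\<bar> \<le> (C + D) * (1 + norm x) ^ k" for x
      using C(2)[of x] D(2)[of x] by (simp add: distrib_right)
    then show ?case using C(1) D(1) by (intro exI[of _ "C + D"]) auto
  next
    case (coord k f j)
    then obtain C where C: "C > 0" "\<And>x. \<bar>f x\<bar> \<le> C * (1 + norm x) ^ k" by auto
    have "\<bar>x $ j * f x\<bar> \<le> (1 + norm x) * (C * (1 + norm x) ^ k)" for x
      using C(2)[of x] component_le_norm_cart[of x j] unfolding abs_mult
      by (intro mult_mono) auto
    then show ?case using C(1) by (intro exI[of _ C]) (auto simp: mult.left_commute)
  qed
  then show ?thesis using that by blast
qed

text \<open>The factor \<open>1 + norm x + norm y\<close> on the left expresses that an increment has one degree less in
  \<open>x\<close>; dividing by it instead would need the exponent \<open>k - 1\<close> and a separate case \<open>k = 0\<close>.\<close>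

lemma poly_degree_le_increment:
  assumes "poly_degree_le k f"
  obtains C where "C > 0"
    "\<And>x y. \<bar>f (x + y) - f x\<bar> * (1 + norm x + norm y) \<le> C * norm y * (1 + norm x + norm y) ^ k"
proof -
  have "\<exists>C>0. \<forall>x y. \<bar>f (x + y) - f x\<bar> * (1 + norm x + norm y) \<le> C * norm y * (1 + norm x + norm y) ^ k"
    using assms
  proof induction
    case (const k a)
    show ?case by (intro exI[of _ 1]) auto
  next
    case (add k f g)
    then obtain C D where C: "C > 0" "\<And>x y. \<bar>f (x + y) - f x\<bar> * (1 + norm x + norm y) \<le> C * norm y * (1 + norm x + norm y) ^ k"
      and D: "D > 0" "\<And>x y. \<bar>g (x + y) - g x\<bar> * (1 + norm x + norm y) \<le> D * norm y * (1 + norm x + norm y) ^ k" by auto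
    have "\<bar>f (x + y) + g (x + y) - (f x + g x)\<bar> * (1 + norm x + norm y)
        \<le> (C + D) * norm y * (1 + norm x + norm y) ^ k" for x y
    proof -
      have "\<bar>f (x + y) + g (x + y) - (f x + g x)\<bar> * (1 + norm x + norm y)
          \<le> (\<bar>f (x + y) - f x\<bar> + \<bar>g (x + y) - g x\<bar>) * (1 + norm x + norm y)"
        by (intro mult_right_mono) auto
      then show ?thesis using C(2)[of x y] D(2)[of x y] by (simp add: distrib_right)
    qed
    then show ?case using C(1) D(1) by (intro exI[of _ "C + D"]) auto
  next
    case (coord k f j)
    then obtain C where C: "C > 0"
      "\<And>x y. \<bar>f (x + y) - f x\<bar> * (1 + norm x + norm y) \<le> C * norm y * (1 + norm x + norm y) ^ k" by auto
    obtain D where D: "D > 0" "\<And>x. \<bar>f x\<bar> \<le> D * (1 + norm x) ^ k"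
      using poly_degree_le_growth[OF coord.hyps] by blast
    have "\<bar>(x + y) $ j * f (x + y) - x $ j * f x\<bar> * (1 + norm x + norm y)
        \<le> (C + D) * norm y * (1 + norm x + norm y) ^ Suc k" for x y
    proof -
      let ?R = "1 + norm x + norm y"
      have R: "?R > 0" by (simp add: add_pos_nonneg)
      have "\<bar>f (x + y)\<bar> \<le> D * (1 + norm (x + y)) ^ k" by (rule D)
      also have "\<dots> \<le> D * ?R ^ k"
        using D(1) norm_triangle_ineq[of x y] by (intro mult_left_mono power_mono) auto
      finally have f: "\<bar>f (x + y)\<bar> \<le> D * ?R ^ k" .
      have "\<bar>(x + y) $ j * f (x + y) - x $ j * f x\<bar> = \<bar>y $ j * f (x + y) + x $ j * (f (x + y) - f x)\<bar>"
        by (simp add: algebra_simps)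
      also have "\<dots> \<le> \<bar>y $ j\<bar> * \<bar>f (x + y)\<bar> + \<bar>x $ j\<bar> * \<bar>f (x + y) - f x\<bar>"
        by (metis abs_mult abs_triangle_ineq)
      also have "\<dots> \<le> norm y * (D * ?R ^ k) + ?R * \<bar>f (x + y) - f x\<bar>"
        using f component_le_norm_cart[of x j] component_le_norm_cart[of y j] norm_ge_zero[of y]
        by (intro add_mono mult_mono) (linarith | simp)+
      finally have "\<bar>(x + y) $ j * f (x + y) - x $ j * f x\<bar> * ?R
          \<le> (norm y * (D * ?R ^ k) + ?R * \<bar>f (x + y) - f x\<bar>) * ?R"
        using R by (intro mult_right_mono) auto
      also have "\<dots> = norm y * D * ?R ^ Suc k + ?R * (\<bar>f (x + y) - f x\<bar> * ?R)"
        by (simp add: algebra_simps)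
      also have "\<dots> \<le> norm y * D * ?R ^ Suc k + ?R * (C * norm y * ?R ^ k)"
        using C(2)[of x y] R by (intro add_left_mono mult_left_mono) auto
      finally show ?thesis by (simp add: algebra_simps)
    qed
    then show ?case using C(1) D(1) by (intro exI[of _ "C + D"]) auto
  qed
  then show ?thesis using that by blast
qed

section \<open>Derivatives along a coordinate axis\<close>

text \<open>Only derivatives along one coordinate axis occur in the integrations by parts. As a relation
  between functions they obey product, sum and chain rules without total differentiability of
  the factors.\<close>

definition has_partial ::
    "'n \<Rightarrow> (real ^ 'n \<Rightarrow> 'b::real_normed_vector) \<Rightarrow> (real ^ 'n \<Rightarrow> 'b) \<Rightarrow> bool" where
  "has_partial i f f' \<longleftrightarrow>
     (\<forall>y. ((\<lambda>r. f (y + r *\<^sub>R axis i 1)) has_vector_derivative f' y) (at 0))"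

lemma has_partial_vector_derivative:
  assumes "has_partial i f f'"
  shows "((\<lambda>r. f (y + r *\<^sub>R axis i 1)) has_vector_derivative f' (y + r *\<^sub>R axis i 1)) (at r)"
proof -
  have "((\<lambda>h. f ((y + r *\<^sub>R axis i 1) + h *\<^sub>R axis i 1)) has_vector_derivative
      f' (y + r *\<^sub>R axis i 1)) (at (r - r))"
    using assms by (simp add: has_partial_def)
  moreover have "((\<lambda>h. h - r) has_vector_derivative 1) (at r)"
    by (auto intro!: derivative_eq_intros)
  ultimately have "((\<lambda>h. f ((y + r *\<^sub>R axis i 1) + h *\<^sub>R axis i 1)) \<circ> (\<lambda>h. h - r) has_vector_derivative
      1 *\<^sub>R f' (y + r *\<^sub>R axis i 1)) (at r)"
    using vector_diff_chain_at by blast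
  then show ?thesis by (simp add: o_def algebra_simps)
qed

lemma has_partial_differentiable:
  assumes "\<And>x. f differentiable (at x)"
  shows "has_partial i f (partial i f)"
  unfolding has_partial_def
proof
  fix y
  let ?D = "frechet_derivative f (at y)"
  have D: "(f has_derivative ?D) (at (y + 0 *\<^sub>R axis i 1))"
    using assms by (simp add: frechet_derivative_works)
  interpret bounded_linear ?D using D by (rule has_derivative_bounded_linear)
  have "((\<lambda>r. y + r *\<^sub>R axis i 1) has_derivative (\<lambda>r. r *\<^sub>R axis i 1)) (at 0)"
    by (auto intro!: derivative_eq_intros)
  from has_derivative_compose[OF this D]
  show "((\<lambda>r. f (y + r *\<^sub>R axis i 1)) has_vector_derivative partial i f y) (at 0)"
    by (simp add: has_vector_derivative_def partial_def scaleR)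
qed

lemma has_partial_of_real:
  assumes "has_partial i f f'"
  shows "has_partial i (\<lambda>y. complex_of_real (f y)) (\<lambda>y. of_real (f' y))"
  using assms unfolding has_partial_def by (auto intro!: has_vector_derivative_of_real
    simp: has_real_derivative_iff_has_vector_derivative)

lemma has_partial_cnj:
  assumes "has_partial i f f'"
  shows "has_partial i (\<lambda>y. cnj (f y)) (\<lambda>y. cnj (f' y))"
  using assms unfolding has_partial_def by (auto intro: has_vector_derivative_cnj)

lemma has_partial_add:
  assumes "has_partial i f f'" "has_partial i g g'"
  shows "has_partial i (\<lambda>y. f y + g y) (\<lambda>y. f' y + g' y)"
  using assms unfolding has_partial_def by (auto intro: has_vector_derivative_add)

lemma has_partial_const: "has_partial i (\<lambda>y. a) (\<lambda>y. 0)"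
  unfolding has_partial_def by auto

lemma has_partial_mult:
  fixes f g :: "real ^ 'n \<Rightarrow> complex"
  assumes "has_partial i f f'" "has_partial i g g'"
  shows "has_partial i (\<lambda>y. f y * g y) (\<lambda>y. f y * g' y + f' y * g y)"
  using assms has_vector_derivative_mult unfolding has_partial_def by fastforce

lemma has_partial_sum:
  assumes "finite A" "\<And>a. a \<in> A \<Longrightarrow> has_partial i (f a) (f' a)"
  shows "has_partial i (\<lambda>y. \<Sum>a\<in>A. f a y) (\<lambda>y. \<Sum>a\<in>A. f' a y)"
  using assms unfolding has_partial_def by (auto intro: has_vector_derivative_sum)

lemma has_partial_exp:
  fixes f :: "real ^ 'n \<Rightarrow> complex"
  assumes "has_partial i f f'"
  shows "has_partial i (\<lambda>y. exp (f y)) (\<lambda>y. f' y * exp (f y))"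
  unfolding has_partial_def
proof
  fix y
  have "((\<lambda>r. f (y + r *\<^sub>R axis i 1)) has_vector_derivative f' y) (at 0)"
    using assms by (simp add: has_partial_def)
  from field_vector_diff_chain_at[OF this, of exp "exp (f y)"]
  show "((\<lambda>r. exp (f (y + r *\<^sub>R axis i 1))) has_vector_derivative f' y * exp (f y)) (at 0)"
    by (simp add: o_def DERIV_exp)
qed

lemma has_partial_coord:
  "has_partial i (\<lambda>y. y $ i) (\<lambda>_. 1)"
  unfolding has_partial_def by (auto intro!: derivative_eq_intros
    simp: has_real_derivative_iff_has_vector_derivative[symmetric])

lemma has_partial_inner:
  "has_partial i (\<lambda>y. y \<bullet> \<xi>) (\<lambda>_. \<xi> $ i)"
  unfolding has_partial_def by (auto intro!: derivative_eq_intros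
    simp: has_real_derivative_iff_has_vector_derivative[symmetric] inner_axis' inner_add_left)

text \<open>If \<open>f\<close> and \<open>g\<close> list the successive derivatives of two functions, then \<open>leibniz f g\<close> lists those of
  their product.\<close>

definition leibniz :: "(nat \<Rightarrow> 'a \<Rightarrow> complex) \<Rightarrow> (nat \<Rightarrow> 'a \<Rightarrow> complex) \<Rightarrow> nat \<Rightarrow> 'a \<Rightarrow> complex" where
  "leibniz f g k y = (\<Sum>j\<le>k. of_nat (k choose j) * f j y * g (k - j) y)"

lemma leibniz_Suc:
  "leibniz f g (Suc k) y =
     leibniz f (\<lambda>j. g (Suc j)) k y + leibniz (\<lambda>j. f (Suc j)) g k y"
proof -
  have a: "leibniz f g (Suc k) y = f 0 y * g (Suc k) y
      + (\<Sum>j\<le>k. of_nat (k choose j) * f (Suc j) y * g (k - j) y)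
      + (\<Sum>j\<le>k. of_nat (k choose Suc j) * f (Suc j) y * g (k - j) y)"
    unfolding leibniz_def
    by (subst sum.atMost_Suc_shift) (simp add: distrib_right sum.distrib)
  have "leibniz f (\<lambda>j. g (Suc j)) k y
      = (\<Sum>j\<le>Suc k. of_nat (k choose j) * f j y * g (Suc k - j) y)"
    by (simp add: leibniz_def Suc_diff_le)
  also have "\<dots> = f 0 y * g (Suc k) y
      + (\<Sum>j\<le>k. of_nat (k choose Suc j) * f (Suc j) y * g (k - j) y)"
    by (subst sum.atMost_Suc_shift) simp
  finally show ?thesis unfolding a by (simp add: leibniz_def)
qed

lemma has_partial_leibniz:
  assumes "\<And>j. j \<le> k \<Longrightarrow> has_partial i (f j) (f (Suc j))"
    and "\<And>j. j \<le> k \<Longrightarrow> has_partial i (g j) (g (Suc j))"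
  shows "has_partial i (leibniz f g k) (leibniz f g (Suc k))"
proof -
  have "has_partial i (\<lambda>y. \<Sum>j\<le>k. of_nat (k choose j) * (f j y * g (k - j) y))
      (\<lambda>y. \<Sum>j\<le>k. of_nat (k choose j) * (f j y * g (Suc (k - j)) y + f (Suc j) y * g (k - j) y)
         + 0 * (f j y * g (k - j) y))"
    by (intro has_partial_sum has_partial_mult has_partial_const assms) auto
  moreover have "(\<lambda>y. \<Sum>j\<le>k. of_nat (k choose j) * (f j y * g (Suc (k - j)) y + f (Suc j) y * g (k - j) y)
         + 0 * (f j y * g (k - j) y)) = leibniz f g (Suc k)"
    unfolding leibniz_Suc fun_eq_iff
    by (simp add: leibniz_def sum.distrib[symmetric] algebra_simps)
  moreover have "leibniz f g k = (\<lambda>y. \<Sum>j\<le>k. of_nat (k choose j) * (f j y * g (k - j) y))"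
    by (auto simp: leibniz_def fun_eq_iff mult.assoc)
  ultimately show ?thesis by simp
qed

text \<open>The successive derivatives of \<open>e = exp Q\<close> in terms of the derivatives \<open>q l\<close> of order \<open>l + 1\<close> of \<open>Q\<close>:
  since \<open>e' = q 0 * e\<close>, the next derivative of order \<open>k\<close> comes from Leibniz' rule for \<open>q 0 * e\<close>.\<close>

fun exp_derivs :: "(nat \<Rightarrow> 'a \<Rightarrow> complex) \<Rightarrow> ('a \<Rightarrow> complex) \<Rightarrow> nat \<Rightarrow> 'a \<Rightarrow> complex" where
  "exp_derivs q e 0 y = e y"
| "exp_derivs q e (Suc k) y =
     (\<Sum>l\<le>k. of_nat (k choose l) * q l y * exp_derivs q e (k - l) y)"

lemma exp_derivs_Suc: "exp_derivs q e (Suc k) = leibniz q (exp_derivs q e) k"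
  by (auto simp: leibniz_def fun_eq_iff)

lemma has_partial_exp_derivs:
  assumes q: "\<And>k. has_partial i (q k) (q (Suc k))"
    and e: "has_partial i e (\<lambda>y. q 0 y * e y)"
  shows "has_partial i (exp_derivs q e k) (exp_derivs q e (Suc k))"
proof (induction k rule: less_induct)
  case (less k)
  show ?case
  proof (cases k)
    case 0
    have "exp_derivs q e 0 = e" "exp_derivs q e (Suc 0) = (\<lambda>y. q 0 y * e y)"
      by (auto simp: fun_eq_iff)
    then show ?thesis using e 0 by metis
  next
    case (Suc k')
    show ?thesis unfolding Suc exp_derivs_Suc
      by (rule has_partial_leibniz) (use less Suc q in \<open>auto simp del: exp_derivs.simps\<close>)
  qed
qed

lemma continuous_on_exp_derivs:
  assumes "\<And>k. continuous_on S (q k)" "continuous_on S e"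
  shows "continuous_on S (exp_derivs q e k)"
proof (induction k rule: less_induct)
  case (less k)
  show ?case
  proof (cases k)
    case 0
    have "exp_derivs q e 0 = e" by (auto simp: fun_eq_iff)
    then show ?thesis using 0 assms by metis
  next
    case (Suc k')
    show ?thesis unfolding Suc exp_derivs_Suc leibniz_def
      by (intro continuous_intros assms less) (use Suc in auto)
  qed
qed

text \<open>In the recursion for the derivative of order \<open>k + 1 \<le> N\<close> each binomial coefficient \<open>k choose l\<close> is at
  most \<open>N ^ l\<close>, and only \<open>m\<close> summands survive because \<open>Q\<close> is a polynomial of degree \<open>m\<close>. If each of
  them contributes at most the fraction \<open>1 / m\<close> of \<open>K ^ (k + 1)\<close>, then \<open>K\<close> bounds the growth per
  derivative. This replaces the formula of Faa di Bruno.\<close>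

lemma norm_exp_derivs_le:
  assumes "norm (e y) \<le> 1" "K > 0"
    and q0: "\<And>l. l \<ge> m \<Longrightarrow> q l y = 0"
    and sm: "\<And>l. l < m \<Longrightarrow> real m * (real N ^ l * norm (q l y)) \<le> K ^ Suc l"
    and "k \<le> N"
  shows "norm (exp_derivs q e k y) \<le> K ^ k"
  using \<open>k \<le> N\<close>
proof (induction k rule: less_induct)
  case (less k)
  show ?case
  proof (cases k)
    case 0
    then show ?thesis using assms by simp
  next
    case (Suc k')
    have bound: "real m * norm (of_nat (k' choose l) * q l y * exp_derivs q e (k' - l) y)
        \<le> (if l < m then K ^ k else 0)" if "l \<le> k'" for l
    proof (cases "l < m")
      case True
      have c: "real (k' choose l) \<le> real N ^ l"
      proof -
        have "k' choose l \<le> k' ^ l" by (rule binomial_le_pow) (use that in auto)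
        also have "\<dots> \<le> N ^ l" using less.prems Suc by (intro power_mono) auto
        finally show ?thesis by (metis of_nat_le_iff of_nat_power)
      qed
      have ih: "norm (exp_derivs q e (k' - l) y) \<le> K ^ (k' - l)"
        using less.IH[of "k' - l"] less.prems Suc by simp
      have "real m * norm (of_nat (k' choose l) * q l y * exp_derivs q e (k' - l) y)
          = (real m * (real (k' choose l) * norm (q l y))) * norm (exp_derivs q e (k' - l) y)"
        by (simp add: norm_mult)
      also have "\<dots> \<le> (real m * (real N ^ l * norm (q l y))) * K ^ (k' - l)"
        using ih c by (intro mult_mono mult_nonneg_nonneg order_refl) auto
      also have "\<dots> \<le> K ^ Suc l * K ^ (k' - l)"
        using sm[OF True] \<open>K > 0\<close> by (intro mult_right_mono) auto
      also have "\<dots> = K ^ k" using that Suc by (simp add: power_add[symmetric])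
      finally show ?thesis using True by simp
    qed (use q0 in auto)
    have "real m * norm (exp_derivs q e k y)
        \<le> (\<Sum>l\<le>k'. real m * norm (of_nat (k' choose l) * q l y * exp_derivs q e (k' - l) y))"
      unfolding Suc exp_derivs.simps sum_distrib_left[symmetric]
      by (intro mult_left_mono norm_sum) auto
    also have "\<dots> \<le> (\<Sum>l\<le>k'. if l < m then K ^ k else 0)"
      using bound by (intro sum_mono) auto
    also have "\<dots> = real (card ({..k'} \<inter> {l. l < m})) * K ^ k"
      by (simp add: sum.If_cases)
    also have "\<dots> \<le> real m * K ^ k"
    proof (intro mult_right_mono)
      have "card ({..k'} \<inter> {l. l < m}) \<le> card {..<m}" by (intro card_mono) auto
      then show "real (card ({..k'} \<inter> {l. l < m})) \<le> real m" by simp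
    qed (use \<open>K > 0\<close> in auto)
    finally have le: "real m * norm (exp_derivs q e k y) \<le> real m * K ^ k" .
    show ?thesis
    proof (cases "m = 0")
      case True
      then have "exp_derivs q e k y = 0" unfolding Suc by (simp add: q0)
      then show ?thesis using \<open>K > 0\<close> by simp
    qed (use le in simp)
  qed
qed

section \<open>Integration by parts on Euclidean space\<close>

lemma lborel_integral_affine:
  fixes f :: "'a::euclidean_space \<Rightarrow> 'b::{banach, second_countable_topology}"
  assumes [measurable]: "f \<in> borel_measurable borel" and c: "c \<noteq> 0"
  shows "(\<integral>x. f (a + c *\<^sub>R x) \<partial>lborel) = (1 / \<bar>c\<bar> ^ DIM('a)) *\<^sub>R (\<integral>x. f x \<partial>lborel)"
    and "integrable lborel f \<Longrightarrow> integrable lborel (\<lambda>x. f (a + c *\<^sub>R x))"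
proof -
  have L: "lborel = density (distr lborel borel (\<lambda>x. a + c *\<^sub>R x)) (\<lambda>_. ennreal (\<bar>c\<bar> ^ DIM('a)))"
    using lborel_affine[OF c, of a] by (simp add: ennreal_power)
  have "(\<integral>x. f x \<partial>lborel)
      = (\<integral>x. f x \<partial>density (distr lborel borel (\<lambda>x. a + c *\<^sub>R x)) (\<lambda>_. ennreal (\<bar>c\<bar> ^ DIM('a))))"
    using L by simp
  also have "\<dots> = \<bar>c\<bar> ^ DIM('a) *\<^sub>R (\<integral>x. f (a + c *\<^sub>R x) \<partial>lborel)"
    by (subst integral_density) (auto simp: integral_distr)
  finally show "(\<integral>x. f (a + c *\<^sub>R x) \<partial>lborel) = (1 / \<bar>c\<bar> ^ DIM('a)) *\<^sub>R (\<integral>x. f x \<partial>lborel)"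
    using c by simp
  assume "integrable lborel f"
  then have "integrable (density (distr lborel borel (\<lambda>x. a + c *\<^sub>R x)) (\<lambda>_. ennreal (\<bar>c\<bar> ^ DIM('a)))) f"
    using L by simp
  then have "integrable lborel (\<lambda>x. \<bar>c\<bar> ^ DIM('a) *\<^sub>R f (a + c *\<^sub>R x))"
    by (simp add: integrable_density integrable_distr_eq)
  then have "integrable lborel (\<lambda>x. (1 / \<bar>c\<bar> ^ DIM('a)) *\<^sub>R (\<bar>c\<bar> ^ DIM('a) *\<^sub>R f (a + c *\<^sub>R x)))"
    by (rule integrable_scaleR_right)
  then show "integrable lborel (\<lambda>x. f (a + c *\<^sub>R x))"
    using c by simp
qed

lemma lborel_integral_shift:
  fixes f :: "'a::euclidean_space \<Rightarrow> 'b::{banach, second_countable_topology}"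
  assumes "f \<in> borel_measurable borel"
  shows "(\<integral>x. f (a + x) \<partial>lborel) = (\<integral>x. f x \<partial>lborel)"
    and "integrable lborel f \<Longrightarrow> integrable lborel (\<lambda>x. f (a + x))"
  using lborel_integral_affine[OF assms, of 1 a] by simp_all

text \<open>Integrating \<open>f' (y + r e\<^sub>i)\<close> over \<open>r \<in> [0, 1]\<close> gives \<open>f (y + e\<^sub>i) - f y\<close>, whose integral over \<open>y\<close> vanishes by
  translation invariance; integrating over \<open>y\<close> first gives the integral of \<open>f'\<close>.\<close>

lemma integral_partial_eq_0:
  fixes f f' :: "real ^ 'n \<Rightarrow> complex"
  assumes p: "has_partial i f f'"
    and cont: "continuous_on UNIV f" "continuous_on UNIV f'"
    and int: "integrable lborel f" "integrable lborel f'"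
  shows "(\<integral>y. f' y \<partial>lborel) = 0"
proof -
  let ?e = "axis i 1 :: real ^ 'n"
  have [measurable]: "f \<in> borel_measurable borel" "f' \<in> borel_measurable borel"
    using cont by (auto intro: borel_measurable_continuous_onI)
  have [measurable]: "(\<lambda>(r, y). f' (y + r *\<^sub>R ?e)) \<in> borel_measurable (lborel \<Otimes>\<^sub>M lborel)"
  proof -
    have "continuous_on UNIV (\<lambda>z. f' (snd z + fst z *\<^sub>R ?e))"
      by (intro continuous_on_compose2[OF cont(2)] continuous_intros) auto
    then have "(\<lambda>z. f' (snd z + fst z *\<^sub>R ?e)) \<in> borel_measurable borel"
      by (rule borel_measurable_continuous_onI)
    then show ?thesis by (simp add: lborel_prod case_prod_unfold)
  qed
  define G where "G r y = indicator {0..1} r *\<^sub>R f' (y + r *\<^sub>R ?e)" for r :: real and y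
  have shift: "(\<integral>y. f' (y + r *\<^sub>R ?e) \<partial>lborel) = (\<integral>y. f' y \<partial>lborel)"
    "(\<integral>y. norm (f' (y + r *\<^sub>R ?e)) \<partial>lborel) = (\<integral>y. norm (f' y) \<partial>lborel)"
    "integrable lborel (\<lambda>y. f' (y + r *\<^sub>R ?e))" for r
    using lborel_integral_shift[of f' "r *\<^sub>R ?e"] lborel_integral_shift[of "\<lambda>y. norm (f' y)" "r *\<^sub>R ?e"] int
    by (simp_all add: add.commute)
  have meas: "case_prod G \<in> borel_measurable (lborel \<Otimes>\<^sub>M lborel)"
    unfolding G_def by measurable
  have intG: "integrable (lborel \<Otimes>\<^sub>M lborel) (case_prod G)"
  proof (rule lborel_pair.Fubini_integrable[OF meas])
    have "integrable lborel (\<lambda>r. indicator {0..1::real} r *\<^sub>R (\<integral>y. norm (f' y) \<partial>lborel))"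
      by (rule integrable_scaleR_left) auto
    moreover have "(\<lambda>r. \<integral>y. norm (case_prod G (r, y)) \<partial>lborel)
        = (\<lambda>r. indicator {0..1::real} r *\<^sub>R (\<integral>y. norm (f' y) \<partial>lborel))"
      by (auto simp: G_def shift fun_eq_iff split: split_indicator)
    ultimately show "integrable lborel (\<lambda>r. \<integral>y. norm (case_prod G (r, y)) \<partial>lborel)"
      by simp
    show "AE r in lborel. integrable lborel (\<lambda>y. case_prod G (r, y))"
      by (auto simp: G_def shift(3) intro!: AE_I2 split: split_indicator)
  qed
  \<comment> \<open>The fundamental theorem of calculus along the segment from \<open>y\<close> to \<open>y + e\<^sub>i\<close>.\<close>
  have inner: "(\<integral>r. G r y \<partial>lborel) = f (y + ?e) - f y" for y
  proof -
    have "(\<integral>r. indicator {0..1} r *\<^sub>R f' (y + r *\<^sub>R ?e) \<partial>lborel)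
        = f (y + 1 *\<^sub>R ?e) - f (y + 0 *\<^sub>R ?e)"
      by (intro integral_FTC_Icc continuous_on_compose2[OF cont(2)] continuous_intros
          has_vector_derivative_at_within[OF has_partial_vector_derivative[OF p]]) auto
    then show ?thesis by (simp add: G_def)
  qed
  have "(\<integral>y. f' y \<partial>lborel) = (\<integral>r. indicator {0..1::real} r *\<^sub>R (\<integral>y. f' y \<partial>lborel) \<partial>lborel)"
    by (subst integral_scaleR_left) auto
  also have "\<dots> = (\<integral>r. (\<integral>y. G r y \<partial>lborel) \<partial>lborel)"
    by (intro Bochner_Integration.integral_cong) (auto simp: G_def shift(1))
  also have "\<dots> = (\<integral>y. (\<integral>r. G r y \<partial>lborel) \<partial>lborel)"
    by (rule lborel_pair.Fubini_integral[OF intG, symmetric])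
  also have "\<dots> = (\<integral>y. f (?e + y) - f y \<partial>lborel)"
    by (simp add: inner add.commute)
  also have "\<dots> = 0"
    using lborel_integral_shift[of f ?e] int(1) by simp
  finally show ?thesis .
qed

text \<open>Each integration by parts trades a factor \<open>a\<close> for one derivative of the amplitude.\<close>

lemma fourier_integral_power:
  fixes F :: "nat \<Rightarrow> real ^ 'n \<Rightarrow> complex"
  assumes p: "\<And>k. k < N \<Longrightarrow> has_partial i (F k) (F (Suc k))"
    and cont: "\<And>k. k \<le> N \<Longrightarrow> continuous_on UNIV (F k)"
    and int: "\<And>k. k \<le> N \<Longrightarrow> integrable lborel (F k)"
  shows "norm (\<integral>y. exp (\<i> * of_real (a * y $ i)) * F N y \<partial>lborel)
       = \<bar>a\<bar> ^ N * norm (\<integral>y. exp (\<i> * of_real (a * y $ i)) * F 0 y \<partial>lborel)"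
proof -
  let ?E = "\<lambda>y :: real ^ 'n. exp (\<i> * of_real (a * y $ i))"
  have contE: "continuous_on UNIV ?E" by (intro continuous_intros)
  have intE: "integrable lborel (\<lambda>y. ?E y * F k y)" if "k \<le> N" for k
  proof (rule Bochner_Integration.integrable_bound[OF int[OF that]])
    have "continuous_on UNIV (\<lambda>y. ?E y * F k y)"
      using contE cont[OF that] by (rule continuous_on_mult)
    then show "(\<lambda>y. ?E y * F k y) \<in> borel_measurable lborel"
      by (simp add: borel_measurable_continuous_onI)
  qed (simp add: norm_mult)
  have E': "has_partial i ?E (\<lambda>y. \<i> * of_real a * ?E y)"
  proof -
    have "has_partial i (\<lambda>y. \<i> * of_real a * of_real (y $ i))
        (\<lambda>y. \<i> * of_real a * of_real 1 + 0 * complex_of_real (y $ i))"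
      by (intro has_partial_mult has_partial_const has_partial_of_real has_partial_coord)
    from has_partial_exp[OF this] show ?thesis by (simp add: mult.assoc)
  qed
  have step: "(\<integral>y. ?E y * F (Suc k) y \<partial>lborel) = - (\<i> * of_real a * (\<integral>y. ?E y * F k y \<partial>lborel))"
    if k: "k < N" for k
  proof -
    let ?G = "\<lambda>y. ?E y * F (Suc k) y + (\<i> * of_real a) * (?E y * F k y)"
    have "has_partial i (\<lambda>y. ?E y * F k y) ?G"
      using has_partial_mult[OF E' p[OF k]] by (simp add: mult.assoc)
    moreover have "continuous_on UNIV (\<lambda>y. ?E y * F k y)" "continuous_on UNIV ?G"
      using k by (intro continuous_on_add continuous_on_mult continuous_on_const contE cont; simp)+
    moreover have "integrable lborel (\<lambda>y. ?E y * F k y)"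
      using k by (intro intE) simp
    moreover have "integrable lborel ?G"
      using k by (intro Bochner_Integration.integrable_add integrable_mult_right intE) simp_all
    ultimately have "(\<integral>y. ?G y \<partial>lborel) = 0"
      by (rule integral_partial_eq_0)
    moreover have "(\<integral>y. ?G y \<partial>lborel)
        = (\<integral>y. ?E y * F (Suc k) y \<partial>lborel) + \<i> * of_real a * (\<integral>y. ?E y * F k y \<partial>lborel)"
    proof -
      have "integrable lborel (\<lambda>y. ?E y * F (Suc k) y)" using k by (intro intE) simp
      moreover have "integrable lborel (\<lambda>y. (\<i> * of_real a) * (?E y * F k y))"
        using k by (intro integrable_mult_right intE) simp
      ultimately have "(\<integral>y. ?G y \<partial>lborel) = (\<integral>y. ?E y * F (Suc k) y \<partial>lborel)
          + (\<integral>y. (\<i> * of_real a) * (?E y * F k y) \<partial>lborel)"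
        by (rule Bochner_Integration.integral_add)
      then show ?thesis by (simp only: integral_mult_right_zero)
    qed
    ultimately show ?thesis by (simp only: eq_neg_iff_add_eq_0)
  qed
  have "norm (\<integral>y. ?E y * F k y \<partial>lborel) = \<bar>a\<bar> ^ k * norm (\<integral>y. ?E y * F 0 y \<partial>lborel)"
    if "k \<le> N" for k
    using that
  proof (induction k)
    case (Suc k)
    then have "k < N" by simp
    from step[OF this] Suc show ?case by (simp only: norm_minus_cancel norm_mult) simp
  qed simp
  from this[OF order_refl] show ?thesis .
qed

section \<open>Estimates for Gelfand--Shilov windows\<close>

text \<open>For a multi-index supported on one coordinate, the unspecified order of differentiation in
  \<open>mi_deriv\<close> is immaterial.\<close>

lemma mi_deriv_single:
  fixes f :: "real ^ 'n::finite \<Rightarrow> 'b::real_normed_vector"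
  shows "mi_deriv (\<lambda>j. if j = i then n else 0) f = (partial i ^^ n) f"
proof -
  let ?L = "SOME is. distinct is \<and> set is = (UNIV :: 'n set)"
  have "\<exists>is. distinct is \<and> set is = (UNIV :: 'n set)"
    using finite_distinct_list[of "UNIV :: 'n set"] by auto
  then have L: "distinct ?L \<and> set ?L = (UNIV :: 'n set)"
    by (rule someI_ex)
  have "foldr (\<lambda>j. partial j ^^ (if j = i then n else 0)) js f
      = (if i \<in> set js then (partial i ^^ n) f else f)" if "distinct js" for js
    using that by (induction js) auto
  then show ?thesis using L by (simp add: mi_deriv_def)
qed

lemma smooth_partial_power_differentiable:
  assumes "smooth f"
  shows "(partial i ^^ n) f differentiable (at x)"
proof -
  have "foldr partial (replicate n i) f differentiable (at x)"
    using assms unfolding smooth_def by blast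
  then show ?thesis by (simp add: foldr_replicate)
qed

lemma GS_Sigma_coord_bound:
  fixes \<psi> :: "real ^ 'n::finite \<Rightarrow> complex"
  assumes "\<psi> \<in> GS_Sigma t s" "h > 0"
  obtains C where "C > 0"
    "\<And>i j k n y. \<bar>y $ j\<bar> ^ k * norm ((partial i ^^ n) \<psi> y) \<le> C * h ^ (k + n) * fact k powr t * fact n powr s"
proof -
  have "GS_norm t s h \<psi> < \<infinity>"
    using assms by (auto simp: GS_Sigma_def GS_Banach_def)
  then obtain C where C: "C \<ge> 0" "GS_norm t s h \<psi> = ennreal C"
    by (cases "GS_norm t s h \<psi>") auto
  have "\<bar>y $ j\<bar> ^ k * norm ((partial i ^^ n) \<psi> y) \<le> (C + 1) * h ^ (k + n) * fact k powr t * fact n powr s"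
    for i j k n y
  proof -
    define \<alpha> :: "'n \<Rightarrow> nat" where "\<alpha> = (\<lambda>l. if l = j then k else 0)"
    define \<beta> :: "'n \<Rightarrow> nat" where "\<beta> = (\<lambda>l. if l = i then n else 0)"
    have ab: "mi_abs \<alpha> = k" "mi_abs \<beta> = n"
      by (simp_all add: \<alpha>_def \<beta>_def mi_abs_def)
    have fct: "mi_fact (\<lambda>l. if l = q then r else 0) = fact r" for q :: 'n and r
    proof -
      have "mi_fact (\<lambda>l. if l = q then r else 0) = (\<Prod>l\<in>UNIV. if l = q then fact r else 1)"
        unfolding mi_fact_def by (rule prod.cong) auto
      then show ?thesis by simp
    qed
    have pw: "mi_pow y \<alpha> = (y $ j) ^ k"
    proof -
      have "mi_pow y \<alpha> = (\<Prod>l\<in>UNIV. if l = j then (y $ j) ^ k else 1)"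
        unfolding mi_pow_def \<alpha>_def by (rule prod.cong) auto
      then show ?thesis by simp
    qed
    let ?D = "h ^ (k + n) * fact k powr t * fact n powr s :: real"
    have D: "?D > 0" using assms(2) by simp
    have "ennreal (norm (of_real (mi_pow y \<alpha>) * mi_deriv \<beta> \<psi> y)
          / (h ^ (mi_abs \<alpha> + mi_abs \<beta>) * mi_fact \<alpha> powr t * mi_fact \<beta> powr s)) \<le> GS_norm t s h \<psi>"
      unfolding GS_norm_def by (rule SUP_upper2[of "(y, \<alpha>, \<beta>)"]) auto
    then have "ennreal (\<bar>y $ j\<bar> ^ k * norm ((partial i ^^ n) \<psi> y) / ?D) \<le> ennreal C"
      unfolding ab pw C(2) unfolding \<alpha>_def \<beta>_def fct mi_deriv_single
      by (simp add: norm_mult power_abs norm_power)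
    then have "\<bar>y $ j\<bar> ^ k * norm ((partial i ^^ n) \<psi> y) / ?D \<le> C"
      using C(1) by (simp del: times_divide_eq_right)
    then have "\<bar>y $ j\<bar> ^ k * norm ((partial i ^^ n) \<psi> y) \<le> C * ?D"
      using D by (simp only: pos_divide_le_eq)
    also have "\<dots> \<le> (C + 1) * ?D" using D by (intro mult_right_mono) auto
    finally show ?thesis by (simp add: mult.assoc)
  qed
  then show ?thesis using C(1) by (intro that[of "C + 1"]) auto
qed

text \<open>Some coordinate of \<open>y\<close> has modulus at least \<open>norm y / d\<close>; the resulting factor \<open>d ^ k\<close> is absorbed by
  applying the coordinate estimate with \<open>h / d\<close> in place of \<open>h\<close>.\<close>

lemma GS_Sigma_norm_bound:
  fixes \<psi> :: "real ^ 'n::finite \<Rightarrow> complex"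
  assumes "\<psi> \<in> GS_Sigma t s" "h > 0"
  obtains C where "C > 0"
    "\<And>i k n y. norm y ^ k * norm ((partial i ^^ n) \<psi> y) \<le> C * h ^ (k + n) * fact k powr t * fact n powr s"
proof -
  let ?d = "real CARD('n)"
  have d: "?d \<ge> 1"
  proof -
    have "CARD('n) \<ge> 1" using zero_less_card_finite[where 'a = 'n] by linarith
    then show ?thesis by linarith
  qed
  define h' where "h' = h / ?d"
  have h': "h' > 0" "h' * ?d = h" "h' \<le> h"
    using d assms(2) by (auto simp: h'_def field_simps)
  obtain C where C: "C > 0"
    "\<And>i j k n y. \<bar>y $ j\<bar> ^ k * norm ((partial i ^^ n) \<psi> y) \<le> C * h' ^ (k + n) * fact k powr t * fact n powr s"
    using GS_Sigma_coord_bound[OF assms(1) h'(1)] by metis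
  have "norm y ^ k * norm ((partial i ^^ n) \<psi> y) \<le> C * h ^ (k + n) * fact k powr t * fact n powr s"
    for i k n y
  proof -
    have "Max (range (\<lambda>j. \<bar>y $ j\<bar>)) \<in> range (\<lambda>j. \<bar>y $ j\<bar>)"
      by (rule Max_in) auto
    then obtain j where j: "\<bar>y $ j\<bar> = Max (range (\<lambda>j. \<bar>y $ j\<bar>))" by force
    have "norm y \<le> (\<Sum>l\<in>UNIV. \<bar>y $ l\<bar>)" by (rule norm_le_l1_cart)
    also have "\<dots> \<le> (\<Sum>l\<in>(UNIV :: 'n set). \<bar>y $ j\<bar>)"
      unfolding j by (intro sum_mono Max_ge) auto
    finally have "norm y \<le> ?d * \<bar>y $ j\<bar>" by simp
    then have "norm y ^ k \<le> (?d * \<bar>y $ j\<bar>) ^ k" by (intro power_mono) auto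
    then have "norm y ^ k * norm ((partial i ^^ n) \<psi> y)
        \<le> (?d * \<bar>y $ j\<bar>) ^ k * norm ((partial i ^^ n) \<psi> y)"
      by (intro mult_right_mono) auto
    also have "\<dots> = ?d ^ k * (\<bar>y $ j\<bar> ^ k * norm ((partial i ^^ n) \<psi> y))"
      by (simp add: power_mult_distrib)
    also have "\<dots> \<le> ?d ^ k * (C * h' ^ (k + n) * fact k powr t * fact n powr s)"
      by (intro mult_left_mono C) auto
    also have "\<dots> = (?d * h') ^ k * h' ^ n * (C * fact k powr t * fact n powr s)"
      by (simp add: power_add power_mult_distrib)
    also have "\<dots> \<le> h ^ k * h ^ n * (C * fact k powr t * fact n powr s)"
      using h' C(1) assms(2) by (intro mult_mono power_mono mult_nonneg_nonneg) (auto simp: mult.commute)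
    finally show ?thesis by (simp add: power_add mult_ac)
  qed
  then show ?thesis using C(1) that by blast
qed

lemma weight_le: "weight (y :: real ^ 'n::finite) \<le> 4 ^ CARD('n) * (1 + norm y ^ (2 * CARD('n)))"
proof -
  have "weight y \<le> (\<Prod>i\<in>(UNIV :: 'n set). 1 + (norm y)\<^sup>2)"
    unfolding weight_def
  proof (rule prod_mono, safe)
    fix i
    have "(y $ i)\<^sup>2 \<le> (norm y)\<^sup>2"
      using component_le_norm_cart[of y i] by (metis abs_le_square_iff abs_norm_cancel)
    then show "1 + (y $ i)\<^sup>2 \<le> 1 + (norm y)\<^sup>2" by simp
  qed (auto intro: add_nonneg_nonneg)
  also have "\<dots> = (1 + (norm y)\<^sup>2) ^ CARD('n)" by simp
  also have "\<dots> \<le> (2 * max 1 ((norm y)\<^sup>2)) ^ CARD('n)" by (intro power_mono) auto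
  also have "\<dots> = 2 ^ CARD('n) * max 1 ((norm y)\<^sup>2) ^ CARD('n)" by (rule power_mult_distrib)
  also have "\<dots> \<le> 4 ^ CARD('n) * (1 + norm y ^ (2 * CARD('n)))"
  proof (intro mult_mono power_mono)
    show "max 1 ((norm y)\<^sup>2) ^ CARD('n) \<le> 1 + norm y ^ (2 * CARD('n))"
      by (cases "(norm y)\<^sup>2 \<le> 1") (auto simp: max_def power_mult)
  qed auto
  finally show ?thesis .
qed

lemma weight_ge_1: "weight y \<ge> 1"
  unfolding weight_def by (intro prod_ge_1) auto

text \<open>The weight makes the estimate integrable in \<open>y\<close>. It costs \<open>2 d\<close> further powers of \<open>norm y\<close>, and the
  growth from \<open>k!\<close> to \<open>(k + 2 d)!\<close> is geometric in \<open>k\<close>, so that a smaller \<open>h\<close> pays for it.\<close>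

lemma GS_Sigma_weighted_bound:
  fixes \<psi> :: "real ^ 'n::finite \<Rightarrow> complex"
  assumes "\<psi> \<in> GS_Sigma t s" "h > 0" "t > 0"
  obtains C where "C > 0"
    "\<And>i k n y. norm y ^ k * norm ((partial i ^^ n) \<psi> y) * weight y
       \<le> C * h ^ (k + n) * fact k powr t * fact n powr s"
proof -
  define D where "D = 2 * CARD('n)"
  define b where "b = 2 powr t"
  have b: "b \<ge> 1" using assms(3) by (simp add: b_def ge_one_powr_ge_zero)
  define h' where "h' = h / b"
  have h': "h' > 0" "h' * b = h" "h' \<le> h"
    using b assms(2) by (auto simp: h'_def field_simps)
  obtain C where C: "C > 0"
    "\<And>i k n y. norm y ^ k * norm ((partial i ^^ n) \<psi> y) \<le> C * h' ^ (k + n) * fact k powr t * fact n powr s"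
    using GS_Sigma_norm_bound[OF assms(1) h'(1)] by metis
  let ?M = "4 ^ CARD('n) * C * (1 + h ^ D * fact D powr t) :: real"
  have "norm y ^ k * norm ((partial i ^^ n) \<psi> y) * weight y
      \<le> ?M * h ^ (k + n) * fact k powr t * fact n powr s" for i k n y
  proof -
    let ?f = "norm ((partial i ^^ n) \<psi> y)"
    let ?P = "fact k powr t * fact n powr s :: real"
    have P: "?P > 0" by simp
    have 1: "norm y ^ k * ?f \<le> C * h ^ (k + n) * ?P"
    proof -
      have "C * h' ^ (k + n) * ?P \<le> C * h ^ (k + n) * ?P"
        using h' C(1) by (intro mult_right_mono mult_left_mono power_mono) auto
      then show ?thesis using C(2)[where y = y and k = k and i = i and n = n] by (simp add: mult.assoc)
    qed
    have 2: "norm y ^ (k + D) * ?f \<le> C * (h ^ D * fact D powr t) * h ^ (k + n) * ?P"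
    proof -
      have "fact (k + D) = fact k * fact D * real ((k + D) choose k)"
        using binomial_fact_lemma[of k "k + D"]
        by (metis add_diff_cancel_left' le_add1 of_nat_fact of_nat_mult)
      also have "real ((k + D) choose k) \<le> 2 ^ (k + D)"
        by (metis binomial_le_pow2 of_nat_le_iff of_nat_numeral of_nat_power)
      finally have "(fact (k + D) :: real) \<le> fact k * fact D * 2 ^ (k + D)"
        by (simp add: mult_left_mono)
      then have "(fact (k + D) :: real) powr t \<le> (fact k * fact D * 2 ^ (k + D)) powr t"
        using assms(3) by (intro powr_mono2) auto
      also have "\<dots> = fact k powr t * fact D powr t * b ^ (k + D)"
      proof -
        have "(2 ^ (k + D)) powr t = b ^ (k + D)"
          unfolding b_def by (simp flip: powr_realpow add: powr_powr mult.commute)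
        then show ?thesis by (simp add: powr_mult)
      qed
      finally have f: "(fact (k + D) :: real) powr t \<le> fact k powr t * fact D powr t * b ^ (k + D)" .
      have "norm y ^ (k + D) * ?f \<le> C * h' ^ (k + D + n) * fact (k + D) powr t * fact n powr s"
        by (rule C)
      also have "\<dots> \<le> C * h' ^ (k + D + n) * (fact k powr t * fact D powr t * b ^ (k + D)) * fact n powr s"
        using C(1) h'(1) f by (intro mult_right_mono mult_left_mono) auto
      also have "\<dots> = C * ((h' * b) ^ (k + D) * h' ^ n) * fact D powr t * ?P"
        by (simp add: power_add power_mult_distrib mult_ac)
      also have "\<dots> \<le> C * (h ^ (k + D) * h ^ n) * fact D powr t * ?P"
        using h' C(1) assms(2)
        by (intro mult_right_mono mult_left_mono mult_mono power_mono) auto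
      finally show ?thesis by (simp add: power_add mult_ac)
    qed
    have "norm y ^ k * ?f * weight y \<le> norm y ^ k * ?f * (4 ^ CARD('n) * (1 + norm y ^ D))"
      unfolding D_def by (intro mult_left_mono weight_le) auto
    also have "\<dots> = 4 ^ CARD('n) * (norm y ^ k * ?f + norm y ^ (k + D) * ?f)"
      by (simp add: algebra_simps power_add)
    also have "\<dots> \<le> 4 ^ CARD('n) * (C * h ^ (k + n) * ?P + C * (h ^ D * fact D powr t) * h ^ (k + n) * ?P)"
      using 1 2 by (intro mult_left_mono add_mono) auto
    also have "\<dots> = ?M * h ^ (k + n) * fact k powr t * fact n powr s"
      by (simp add: algebra_simps)
    finally show ?thesis .
  qed
  moreover have "?M > 0" using C(1) assms(2) by (intro mult_pos_pos add_pos_nonneg) auto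
  ultimately show ?thesis using that by blast
qed

section \<open>Derivatives of the phase\<close>

text \<open>The derivatives of order \<open>l + 1\<close> in \<open>y\<^sub>i\<close> of \<open>\<i> * Q\<close>, where \<open>Q y = \<phi> (x + y) - y\<^sub>i * \<partial>\<^sub>i \<phi> x\<close> is the phase
  seen from \<open>x\<close> after removal of its frequency there.\<close>

definition phase_derivs ::
    "'n \<Rightarrow> (real ^ 'n \<Rightarrow> real) \<Rightarrow> real ^ 'n \<Rightarrow> nat \<Rightarrow> real ^ 'n \<Rightarrow> complex" where
  "phase_derivs i \<phi> x l y =
     \<i> * of_real ((partial i ^^ Suc l) \<phi> (x + y) - (if l = 0 then partial i \<phi> x else 0))"

lemma phase_derivs_eq_0:
  assumes "poly_degree_le m \<phi>" "l \<ge> m" "m \<ge> 1"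
  shows "phase_derivs i \<phi> x l y = 0"
  using partial_power_eq_0[OF assms(1), of "Suc l" i] assms(2,3)
  by (simp add: phase_derivs_def del: funpow.simps)

text \<open>Here \<open>m = k + 2\<close> and \<open>T = \<lambda>\<^sup>t\<close>, so \<open>T\<^sup>m\<^sup>-\<^sup>1 = \<lambda>\<^sup>s\<close>; the hypothesis on \<open>N\<close> is where
  \<open>N \<le> \<lambda> \<le> \<lambda>\<^sup>s\<close> enters. Put \<open>M = max T (norm y)\<close>.

  For \<open>l = 0\<close> the increment of \<open>\<partial>\<^sub>i \<phi>\<close> is \<open>O(norm y * M ^ k)\<close>. This is a small multiple of
  \<open>T ^ (k + 1)\<close> if \<open>norm y \<le> \<delta> T\<close>, and a large multiple of \<open>norm y ^ (k + 1)\<close> otherwise.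

  For \<open>l > 0\<close> the derivative is \<open>O(M ^ (m - 1 - l))\<close>, whereas the right-hand side is at least
  \<open>(h * M ^ (m - 1)) ^ (l + 1)\<close>. The quotient leaves \<open>M ^ (l m)\<close> to absorb \<open>N ^ l \<le> M ^ (l (m - 1))\<close>,
  and the surplus \<open>M ^ l\<close> beats all constants once \<open>T\<close> is large.\<close>

lemma phase_derivs_bound:
  fixes \<phi> :: "real ^ 'n::finite \<Rightarrow> real"
  assumes \<phi>: "poly_degree_le (Suc (Suc k)) \<phi>" and h: "h > 0" and B: "B \<ge> 0"
  obtains A T0 where "A > 0" "T0 \<ge> 1"
    "\<And>T x y N l. \<lbrakk>T \<ge> T0; norm x \<le> B * T; real N \<le> T ^ Suc k; l < Suc (Suc k)\<rbrakk> \<Longrightarrow>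
       real (Suc (Suc k)) * (real N ^ l * norm (phase_derivs i \<phi> x l y))
         \<le> (h * T ^ Suc k + A * norm y ^ Suc k) ^ Suc l"
proof -
  let ?m = "real (Suc (Suc k))"
  define R where "R = 2 + B"
  have R: "R \<ge> 1" using B by (simp add: R_def)
  have p1: "poly_degree_le (Suc k) (partial i \<phi>)"
    using poly_degree_le_partial[OF \<phi>, of i] by simp
  obtain C0 where C0: "C0 > 0" "\<And>x y. \<bar>partial i \<phi> (x + y) - partial i \<phi> x\<bar> * (1 + norm x + norm y)
      \<le> C0 * norm y * (1 + norm x + norm y) ^ Suc k"
    using poly_degree_le_increment[OF p1] by blast
  have "\<exists>C>0. \<forall>z. \<bar>(partial i ^^ Suc l) \<phi> z\<bar> \<le> C * (1 + norm z) ^ (Suc k - l)" for l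
  proof -
    have "poly_degree_le (Suc k - l) ((partial i ^^ Suc l) \<phi>)"
      using poly_degree_le_partial_power[OF \<phi>, of "Suc l" i] by (simp del: funpow.simps)
    from poly_degree_le_growth[OF this] show ?thesis by metis
  qed
  then obtain Cf where Cf: "\<And>l. Cf l > 0"
    "\<And>l z. \<bar>(partial i ^^ Suc l) \<phi> z\<bar> \<le> Cf l * (1 + norm z) ^ (Suc k - l)"
    by metis
  define C where "C = (\<Sum>l\<le>Suc k. Cf l)"
  have CfC: "Cf l \<le> C" if "l \<le> Suc k" for l
    unfolding C_def using that Cf(1) by (intro member_le_sum) (auto intro: less_imp_le)
  have C: "C > 0" using CfC[of 0] Cf(1)[of 0] by linarith
  \<comment> \<open>The threshold below which the increment of the first derivative is dominated by \<open>h * T ^ (k + 1)\<close>.\<close>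
  define \<delta> where "\<delta> = min 1 (h / (?m * C0 * R ^ k))"
  have den: "?m * C0 * R ^ k > 0" using C0 R by simp
  have \<delta>: "\<delta> > 0" "\<delta> \<le> 1" "?m * C0 * R ^ k * \<delta> \<le> h"
  proof -
    show "\<delta> > 0" "\<delta> \<le> 1" using h den by (auto simp: \<delta>_def)
    have "\<delta> \<le> h / (?m * C0 * R ^ k)" by (simp add: \<delta>_def)
    then show "?m * C0 * R ^ k * \<delta> \<le> h" using den by (simp only: pos_le_divide_eq mult.commute)
  qed
  \<comment> \<open>\<open>A \<ge> h\<close> serves all \<open>l > 0\<close>, the second bound serves \<open>l = 0\<close> and \<open>norm y > \<delta> * T\<close>.\<close>
  define A where "A = max h (?m * C0 * (R / \<delta>) ^ k)"
  have A: "A \<ge> h" "A \<ge> ?m * C0 * (R / \<delta>) ^ k" by (auto simp: A_def)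
  \<comment> \<open>Chosen such that \<open>h * T \<ge> 1\<close> and \<open>h * (h * T)\<close> exceeds the constants for \<open>l > 0\<close>.\<close>
  define T0 where "T0 = max 1 (max (1 / h) (?m * C * R ^ Suc k / h\<^sup>2))"
  have "?m * (real N ^ l * norm (phase_derivs i \<phi> x l y)) \<le> (h * T ^ Suc k + A * norm y ^ Suc k) ^ Suc l"
    if T: "T \<ge> T0" and x: "norm x \<le> B * T" and N: "real N \<le> T ^ Suc k" and l: "l < Suc (Suc k)"
    for T x y N l
  proof -
    have T1: "T \<ge> 1" using T by (auto simp: T0_def)
    have hT: "h * T \<ge> 1"
    proof -
      have "T \<ge> 1 / h" using T by (auto simp: T0_def)
      then show ?thesis using h by (simp add: field_simps)
    qed
    have h2T: "h * (h * T) \<ge> ?m * C * R ^ Suc k"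
    proof -
      have "T \<ge> ?m * C * R ^ Suc k / h\<^sup>2" using T by (auto simp: T0_def)
      then have "?m * C * R ^ Suc k \<le> T * h\<^sup>2" using h by (simp only: pos_divide_le_eq zero_less_power)
      then show ?thesis by (simp add: power2_eq_square mult_ac)
    qed
    define M where "M = max T (norm y)"
    have M: "M \<ge> 1" "M \<ge> T" "M \<ge> norm y" using T1 by (auto simp: M_def)
    have RM: "1 + norm x + norm y \<le> R * M"
    proof -
      have "B * T \<le> B * M" using B M by (intro mult_left_mono) auto
      then have "1 + norm x + norm y \<le> M + B * M + M" using x M by linarith
      then show ?thesis by (simp add: R_def algebra_simps)
    qed
    have KM: "h * T ^ Suc k + A * norm y ^ Suc k \<ge> h * M ^ Suc k"
    proof (cases "norm y \<le> T")
      case True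
      then have "M = T" by (simp add: M_def)
      moreover have "0 \<le> A * norm y ^ Suc k" using A h by (intro mult_nonneg_nonneg) auto
      ultimately show ?thesis by simp
    next
      case False
      then have "M = norm y" by (simp add: M_def)
      have "0 \<le> h * T ^ Suc k" using h T1 by (intro mult_nonneg_nonneg) auto
      moreover have "h * norm y ^ Suc k \<le> A * norm y ^ Suc k" using A by (intro mult_right_mono) auto
      ultimately show ?thesis unfolding \<open>M = norm y\<close> by linarith
    qed
    show ?thesis
    proof (cases l)
      case 0
      have D: "\<bar>partial i \<phi> (x + y) - partial i \<phi> x\<bar> \<le> C0 * norm y * (R * M) ^ k"
      proof -
        let ?S = "1 + norm x + norm y"
        have S: "?S > 0" by (simp add: add_pos_nonneg)
        have "\<bar>partial i \<phi> (x + y) - partial i \<phi> x\<bar> * ?S \<le> (C0 * norm y * ?S ^ k) * ?S"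
          using C0(2)[of x y] by (simp add: mult_ac)
        then have "\<bar>partial i \<phi> (x + y) - partial i \<phi> x\<bar> \<le> C0 * norm y * ?S ^ k"
          using S by (simp only: mult_le_cancel_right_pos)
        also have "\<dots> \<le> C0 * norm y * (R * M) ^ k"
          using C0(1) S RM by (intro mult_left_mono power_mono) auto
        finally show ?thesis .
      qed
      have "?m * \<bar>partial i \<phi> (x + y) - partial i \<phi> x\<bar> \<le> h * T ^ Suc k + A * norm y ^ Suc k"
      proof (cases "norm y \<le> \<delta> * T")
        case True
        have "\<delta> * T \<le> 1 * T" using \<delta> T1 by (intro mult_right_mono) auto
        then have "M = T" using True by (simp add: M_def)
        then have "?m * \<bar>partial i \<phi> (x + y) - partial i \<phi> x\<bar> \<le> ?m * (C0 * norm y * (R * T) ^ k)"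
          using D by (intro mult_left_mono) auto
        also have "\<dots> \<le> ?m * (C0 * (\<delta> * T) * (R * T) ^ k)"
          using True C0(1) R T1 by (intro mult_left_mono mult_right_mono) auto
        also have "\<dots> = (?m * C0 * R ^ k * \<delta>) * T ^ Suc k" by (simp add: power_mult_distrib mult_ac)
        also have "\<dots> \<le> h * T ^ Suc k" using \<delta>(3) T1 by (intro mult_right_mono) auto
        also have "\<dots> \<le> h * T ^ Suc k + A * norm y ^ Suc k"
          using A h by (simp add: mult_nonneg_nonneg)
        finally show ?thesis .
      next
        case False
        have "norm y \<le> norm y / \<delta>"
          using \<delta> by (simp add: pos_le_divide_eq mult_left_le)
        moreover have "T \<le> norm y / \<delta>" using False \<delta> by (simp add: pos_le_divide_eq mult.commute)
        ultimately have M': "M \<le> norm y / \<delta>" by (simp add: M_def)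
        have "?m * \<bar>partial i \<phi> (x + y) - partial i \<phi> x\<bar> \<le> ?m * (C0 * norm y * (R * M) ^ k)"
          using D by (intro mult_left_mono) auto
        also have "\<dots> \<le> ?m * (C0 * norm y * (R * (norm y / \<delta>)) ^ k)"
          using M' M R C0(1) by (intro mult_left_mono power_mono) auto
        also have "\<dots> = (?m * C0 * (R / \<delta>) ^ k) * norm y ^ Suc k"
          by (simp add: power_mult_distrib power_divide mult_ac)
        also have "\<dots> \<le> A * norm y ^ Suc k" using A(2) by (intro mult_right_mono) auto
        also have "\<dots> \<le> h * T ^ Suc k + A * norm y ^ Suc k" using h T1 by simp
        finally show ?thesis .
      qed
      moreover have "norm (phase_derivs i \<phi> x 0 y) = \<bar>partial i \<phi> (x + y) - partial i \<phi> x\<bar>"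
        by (simp add: phase_derivs_def norm_mult del: of_real_diff)
      ultimately show ?thesis using 0 by simp
    next
      case (Suc l')
      have q: "norm (phase_derivs i \<phi> x l y) \<le> C * R ^ Suc k * M ^ (Suc k - l)"
      proof -
        have "norm (phase_derivs i \<phi> x l y) = \<bar>(partial i ^^ Suc l) \<phi> (x + y)\<bar>"
          using Suc by (simp add: phase_derivs_def norm_mult del: of_real_diff funpow.simps)
        also have "\<dots> \<le> Cf l * (1 + norm (x + y)) ^ (Suc k - l)" by (rule Cf)
        also have "\<dots> \<le> C * (R * M) ^ (Suc k - l)"
        proof (intro mult_mono power_mono)
          show "Cf l \<le> C" using l by (intro CfC) simp
          show "1 + norm (x + y) \<le> R * M" using RM norm_triangle_ineq[of x y] by linarith
        qed (use C in auto)
        also have "\<dots> = C * (R ^ (Suc k - l) * M ^ (Suc k - l))" by (simp add: power_mult_distrib)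
        also have "\<dots> \<le> C * (R ^ Suc k * M ^ (Suc k - l))"
          using C R M by (intro mult_left_mono mult_right_mono power_increasing) auto
        finally show ?thesis by (simp add: mult.assoc)
      qed
      have "?m * (real N ^ l * norm (phase_derivs i \<phi> x l y))
          \<le> ?m * ((M ^ Suc k) ^ l * (C * R ^ Suc k * M ^ (Suc k - l)))"
      proof (intro mult_left_mono mult_mono power_mono q)
        have "T ^ Suc k \<le> M ^ Suc k" using M T1 by (intro power_mono) auto
        then show "real N \<le> M ^ Suc k" using N by linarith
      qed (use M in auto)
      also have "\<dots> = (?m * C * R ^ Suc k) * ((M ^ Suc k) ^ l * M ^ (Suc k - l))" by simp
      also have "\<dots> \<le> (h * (h * T)) * ((M ^ Suc k) ^ l * M ^ (Suc k - l))"
        using h2T M by (intro mult_right_mono) auto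
      also have "\<dots> \<le> (h * (h * M) ^ l) * ((M ^ Suc k) ^ l * M ^ (Suc k - l))"
      proof (intro mult_right_mono mult_left_mono)
        have hM: "h * T \<le> h * M" using h M by (intro mult_left_mono) auto
        have "h * M \<le> (h * M) ^ l" using hT hM Suc by (intro self_le_power) auto
        then show "h * T \<le> (h * M) ^ l" using hM by linarith
      qed (use h M in auto)
      also have "\<dots> = h ^ Suc l * (M ^ l * (M ^ Suc k) ^ l * M ^ (Suc k - l))"
        by (simp add: power_mult_distrib mult_ac)
      also have "M ^ l * (M ^ Suc k) ^ l * M ^ (Suc k - l) = (M ^ Suc k) ^ Suc l"
      proof -
        have "M ^ l * (M ^ Suc k) ^ l * M ^ (Suc k - l) = M ^ (l + (Suc k - l)) * (M ^ Suc k) ^ l"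
          by (simp only: power_add mult_ac)
        also have "l + (Suc k - l) = Suc k" using l by simp
        finally show ?thesis by simp
      qed
      also have "h ^ Suc l * (M ^ Suc k) ^ Suc l = (h * M ^ Suc k) ^ Suc l" by (rule power_mult_distrib[symmetric])
      also have "\<dots> \<le> (h * T ^ Suc k + A * norm y ^ Suc k) ^ Suc l"
        using KM h M by (intro power_mono) auto
      finally show ?thesis .
    qed
  qed
  moreover have "A > 0" using A h by linarith
  moreover have "T0 \<ge> 1" by (simp add: T0_def)
  ultimately show ?thesis using that by blast
qed

section \<open>Estimate of the oscillatory integral\<close>

lemma fact_powr_le:
  assumes "real n \<le> \<mu>" "t > 0" "\<mu> > 0"
  shows "(fact n :: real) powr t \<le> (\<mu> powr t) ^ n"
proof -
  have "(fact n :: real) \<le> real n ^ n"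
    by (metis fact_le_power le_refl of_nat_fact of_nat_le_iff of_nat_power)
  also have "\<dots> \<le> \<mu> ^ n" using assms by (intro power_mono) auto
  finally have "(fact n :: real) powr t \<le> (\<mu> ^ n) powr t"
    using assms by (intro powr_mono2) auto
  also have "\<dots> = (\<mu> powr t) ^ n"
    using assms by (simp flip: powr_realpow add: powr_powr mult.commute)
  finally show ?thesis .
qed

lemma add_power_le: "(a + b) ^ n \<le> 2 ^ n * (a ^ n + b ^ n)" if "a \<ge> 0" "b \<ge> 0" for a b :: real
proof -
  have "(a + b) ^ n \<le> (2 * max a b) ^ n" using that by (intro power_mono) auto
  also have "\<dots> = 2 ^ n * max a b ^ n" by (rule power_mult_distrib)
  also have "\<dots> \<le> 2 ^ n * (a ^ n + b ^ n)"
    using that by (intro mult_left_mono) (auto simp: max_def)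
  finally show ?thesis .
qed

text \<open>The amplitude is \<open>exp (\<i> * Q) * cnj \<psi>\<close>, of which at most \<open>\<lambda>\<close> derivatives are taken. By
  \<open>norm_exp_derivs_le\<close> and \<open>phase_derivs_bound\<close> each derivative of the exponential costs
  \<open>K = g * \<lambda>\<^sup>s + A * norm y ^ (m - 1)\<close>, and
  \<open>K ^ j\<close> splits into the \<open>j\<close>-th powers of both summands up to a factor \<open>2 ^ j\<close>. The polynomial growth
  in \<open>y\<close> is paid for by the decay of \<open>\<psi>\<close>: the factor \<open>norm y ^ ((m - 1) j)\<close> becomes
  \<open>((m - 1) j)!\<^sup>t\<close>, which for \<open>j \<le> \<lambda>\<close> is at most a constant to the power \<open>j\<close> times \<open>\<lambda>\<close> to the power
  \<open>t (m - 1) j = s j\<close>. Likewise \<open>n!\<^sup>s \<le> (\<lambda>\<^sup>s)\<^sup>n\<close>. Thus everything scales like \<open>\<lambda>\<^sup>s\<close> per derivative, with a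
  constant that is arbitrarily small because \<open>\<psi>\<close> satisfies its estimates for every \<open>h\<close>.\<close>

lemma amplitude_bound:
  fixes \<phi> :: "real ^ 'n::finite \<Rightarrow> real" and \<psi> :: "real ^ 'n \<Rightarrow> complex"
  assumes \<phi>: "poly_degree_le (Suc (Suc k)) \<phi>"
    and s: "s = t * real (Suc k)" "s > 1"
    and \<psi>: "\<psi> \<in> GS_Sigma t s" and h: "h > 0" and B: "B \<ge> 0"
  obtains C L where "C > 0" "L \<ge> 1"
    "\<And>l x N y e. \<lbrakk>l \<ge> L; norm x \<le> B * l powr t; real N \<le> l; norm (e y) \<le> 1\<rbrakk> \<Longrightarrow>
       norm (leibniz (exp_derivs (phase_derivs i \<phi> x) e) (\<lambda>j y. cnj ((partial i ^^ j) \<psi> y)) N y) * weight y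
         \<le> C * (h * l powr s) ^ N"
proof -
  have t: "t > 0" using s(2) unfolding s(1)
    by (metis less_trans of_nat_0_le_iff less_le_not_le mult_nonpos_nonneg not_less zero_less_one)
  define g where "g = h / 3"
  have g: "g > 0" using h by (simp add: g_def)
  obtain A T0 where A: "A > 0" and T0: "T0 \<ge> 1" and
    PB: "\<And>T x y N l. \<lbrakk>T \<ge> T0; norm x \<le> B * T; real N \<le> T ^ Suc k; l < Suc (Suc k)\<rbrakk> \<Longrightarrow>
       real (Suc (Suc k)) * (real N ^ l * norm (phase_derivs i \<phi> x l y))
         \<le> (g * T ^ Suc k + A * norm y ^ Suc k) ^ Suc l"
    using phase_derivs_bound[OF \<phi> g B, of i thesis] by blast
  define G where "G = real (Suc k) powr s"
  \<comment> \<open>The constant \<open>h1\<close> for the window has to compensate \<open>A\<close>, which in turn depends on \<open>g\<close>.\<close>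
  define h1 where "h1 = min 1 (g / (2 * A * G + 1))"
  have G: "G > 0" by (simp add: G_def)
  have h1: "h1 > 0" "h1 \<le> 1" "h1 \<le> g" "2 * (A * (h1 * G)) + h1 \<le> 3 * g"
  proof -
    have d: "2 * A * G + 1 \<ge> 1" using A G by simp
    show "h1 > 0" "h1 \<le> 1" using g d by (auto simp: h1_def)
    have "h1 \<le> g / (2 * A * G + 1)" by (simp add: h1_def)
    then have a: "h1 * (2 * A * G + 1) \<le> g" using d by (simp add: pos_le_divide_eq)
    moreover have "h1 * 1 \<le> h1 * (2 * A * G + 1)" using \<open>h1 > 0\<close> d by (intro mult_left_mono) auto
    ultimately show "h1 \<le> g" by linarith
    show "2 * (A * (h1 * G)) + h1 \<le> 3 * g" using a g by (simp add: algebra_simps)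
  qed
  obtain C where C: "C > 0" and
    WB: "\<And>j k n y. norm y ^ k * norm ((partial j ^^ n) \<psi> y) * weight y
       \<le> C * h1 ^ (k + n) * fact k powr t * fact n powr s"
    using GS_Sigma_weighted_bound[OF \<psi> h1(1) t] by metis
  define L where "L = T0 powr (1 / t)"
  have L: "L \<ge> 1" using T0 t by (simp add: L_def ge_one_powr_ge_zero)
  have main: "norm (leibniz (exp_derivs (phase_derivs i \<phi> x) e) (\<lambda>j y. cnj ((partial i ^^ j) \<psi> y)) N y) * weight y
         \<le> (2 * C) * (h * l powr s) ^ N"
    if l: "l \<ge> L" and x: "norm x \<le> B * l powr t" and N: "real N \<le> l" and e: "norm (e y) \<le> 1"
    for l x N y e
  proof -
    have l1: "l \<ge> 1" using l L by simp
    define T where "T = l powr t"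
    have T: "T \<ge> T0"
    proof -
      have "T0 = L powr t" using T0 t by (simp add: L_def powr_powr)
      also have "\<dots> \<le> T" unfolding T_def using l L t by (intro powr_mono2) auto
      finally show ?thesis .
    qed
    define \<Lambda> where "\<Lambda> = l powr s"
    have \<Lambda>: "\<Lambda> = T ^ Suc k" "\<Lambda> \<ge> l" "\<Lambda> > 0"
    proof -
      show "\<Lambda> = T ^ Suc k" unfolding \<Lambda>_def T_def s(1) powr_powr[symmetric]
        using l1 by (intro powr_realpow) simp
      have "l powr 1 \<le> \<Lambda>" unfolding \<Lambda>_def using l1 s(2) by (intro powr_mono) auto
      then show "\<Lambda> \<ge> l" using l1 by simp
      show "\<Lambda> > 0" unfolding \<Lambda>_def using l1 by simp
    qed
    \<comment> \<open>The two summands of the cost \<open>K\<close> of one derivative of the exponential.\<close>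
    define a b where "a = g * \<Lambda>" and "b = A * norm y ^ Suc k"
    have ab: "a > 0" "b \<ge> 0" using g A \<Lambda> by (auto simp: a_def b_def)
    have Ej: "norm (exp_derivs (phase_derivs i \<phi> x) e j y) \<le> 2 ^ j * (a ^ j + b ^ j)" if "j \<le> N" for j
    proof -
      have "norm (exp_derivs (phase_derivs i \<phi> x) e j y) \<le> (a + b) ^ j"
      proof (rule norm_exp_derivs_le[where m = "Suc (Suc k)" and N = N])
        show "norm (e y) \<le> 1" "j \<le> N" by fact+
        show "a + b > 0" using ab by simp
        show "phase_derivs i \<phi> x l y = 0" if "l \<ge> Suc (Suc k)" for l
          using phase_derivs_eq_0[OF \<phi> that] by simp
        show "real (Suc (Suc k)) * (real N ^ l * norm (phase_derivs i \<phi> x l y)) \<le> (a + b) ^ Suc l"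
          if "l < Suc (Suc k)" for l
          unfolding a_def b_def \<Lambda>(1)
        proof (rule PB[OF T _ _ that])
          show "norm x \<le> B * T" using x by (simp add: T_def)
          show "real N \<le> T ^ Suc k" using N \<Lambda> by simp
        qed
      qed
      also have "\<dots> \<le> 2 ^ j * (a ^ j + b ^ j)" using ab by (intro add_power_le) auto
      finally show ?thesis .
    qed
    let ?\<psi> = "\<lambda>j. norm ((partial i ^^ j) \<psi> y)"
    have fN: "(fact (N - j) :: real) powr s \<le> \<Lambda> ^ (N - j)" for j
      unfolding \<Lambda>_def using N l1 s(2) by (intro fact_powr_le) auto
    have one: "?\<psi> (N - j) * weight y \<le> C * (h1 * \<Lambda>) ^ (N - j)" for j
    proof -
      have "?\<psi> (N - j) * weight y \<le> C * h1 ^ (N - j) * fact (N - j) powr s"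
        using WB[where k = 0 and j = i and n = "N - j" and y = y] by simp
      also have "\<dots> \<le> C * h1 ^ (N - j) * \<Lambda> ^ (N - j)"
        using fN C h1 by (intro mult_left_mono) auto
      finally show ?thesis by (simp add: power_mult_distrib mult.assoc)
    qed
    have two: "b ^ j * (?\<psi> (N - j) * weight y) \<le> C * (A * (h1 * G) * \<Lambda>) ^ j * (h1 * \<Lambda>) ^ (N - j)"
      if "j \<le> N" for j
    proof -
      have f: "(fact (Suc k * j) :: real) powr t \<le> (G * \<Lambda>) ^ j"
      proof (cases "j = 0")
        case False
        have "(fact (Suc k * j) :: real) powr t \<le> ((real (Suc k) * l) powr t) ^ (Suc k * j)"
        proof (intro fact_powr_le t)
          have "real j \<le> l" using that N by linarith
          then show "real (Suc k * j) \<le> real (Suc k) * l"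
            unfolding of_nat_mult by (intro mult_left_mono) auto
        qed (use l1 in simp)
        also have "\<dots> = (G * \<Lambda>) ^ j"
        proof -
          have "((real (Suc k) * l) powr t) ^ Suc k = (real (Suc k) * l) powr s"
            unfolding s(1) powr_powr[symmetric] using l1 by (intro powr_realpow[symmetric]) simp
          also have "\<dots> = G * \<Lambda>" unfolding G_def \<Lambda>_def using l1 by (intro powr_mult) 
          finally show ?thesis by (simp only: power_mult)
        qed
        finally show ?thesis .
      qed simp
      have "b ^ j * (?\<psi> (N - j) * weight y) = A ^ j * (norm y ^ (Suc k * j) * ?\<psi> (N - j) * weight y)"
        unfolding b_def power_mult_distrib power_mult by (simp only: mult_ac)
      also have "\<dots> \<le> A ^ j * (C * h1 ^ (Suc k * j + (N - j)) * fact (Suc k * j) powr t * fact (N - j) powr s)"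
        using A by (intro mult_left_mono WB) auto
      also have "\<dots> \<le> A ^ j * (C * (h1 ^ j * h1 ^ (N - j)) * (G * \<Lambda>) ^ j * \<Lambda> ^ (N - j))"
      proof (intro mult_left_mono mult_mono f fN)
        have "h1 ^ (Suc k * j) \<le> h1 ^ j" using h1 by (intro power_decreasing) auto
        then show "h1 ^ (Suc k * j + (N - j)) \<le> h1 ^ j * h1 ^ (N - j)"
          unfolding power_add using h1 by (intro mult_right_mono) auto
      qed (use A C h1 G \<Lambda> in auto)
      also have "\<dots> = C * (A * (h1 * G) * \<Lambda>) ^ j * (h1 * \<Lambda>) ^ (N - j)"
        by (simp add: power_mult_distrib mult_ac)
      finally show ?thesis .
    qed
    have "norm (leibniz (exp_derivs (phase_derivs i \<phi> x) e) (\<lambda>j y. cnj ((partial i ^^ j) \<psi> y)) N y)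
        \<le> (\<Sum>j\<le>N. real (N choose j) * norm (exp_derivs (phase_derivs i \<phi> x) e j y) * ?\<psi> (N - j))"
      unfolding leibniz_def by (rule order_trans[OF norm_sum]) (simp add: norm_mult)
    then have "norm (leibniz (exp_derivs (phase_derivs i \<phi> x) e) (\<lambda>j y. cnj ((partial i ^^ j) \<psi> y)) N y) * weight y
        \<le> (\<Sum>j\<le>N. real (N choose j) * norm (exp_derivs (phase_derivs i \<phi> x) e j y) * ?\<psi> (N - j)) * weight y"
      using weight_pos[of y] by (intro mult_right_mono) auto
    also have "\<dots> = (\<Sum>j\<le>N. real (N choose j) * norm (exp_derivs (phase_derivs i \<phi> x) e j y) * (?\<psi> (N - j) * weight y))"
      by (simp add: sum_distrib_right mult.assoc)
    also have "\<dots> \<le> (\<Sum>j\<le>N. C * (real (N choose j) * (2 * (g * \<Lambda>)) ^ j * (h1 * \<Lambda>) ^ (N - j))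
        + C * (real (N choose j) * (2 * (A * (h1 * G) * \<Lambda>)) ^ j * (h1 * \<Lambda>) ^ (N - j)))"
    proof (rule sum_mono)
      fix j assume "j \<in> {..N}"
      then have j: "j \<le> N" by simp
      let ?w = "?\<psi> (N - j) * weight y"
      have w: "?w \<ge> 0" using weight_pos[of y] by (intro mult_nonneg_nonneg) auto
      have "real (N choose j) * norm (exp_derivs (phase_derivs i \<phi> x) e j y) * ?w
          \<le> real (N choose j) * (2 ^ j * (a ^ j + b ^ j)) * ?w"
        using Ej[OF j] w by (intro mult_right_mono mult_left_mono) auto
      also have "\<dots> = real (N choose j) * (2 ^ j * (a ^ j * ?w + b ^ j * ?w))"
        by (simp add: algebra_simps)
      also have "\<dots> \<le> real (N choose j) * (2 ^ j * (a ^ j * (C * (h1 * \<Lambda>) ^ (N - j))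
          + C * (A * (h1 * G) * \<Lambda>) ^ j * (h1 * \<Lambda>) ^ (N - j)))"
        using ab by (intro mult_left_mono add_mono one two j) auto
      also have "\<dots> = C * (real (N choose j) * (2 * (g * \<Lambda>)) ^ j * (h1 * \<Lambda>) ^ (N - j))
        + C * (real (N choose j) * (2 * (A * (h1 * G) * \<Lambda>)) ^ j * (h1 * \<Lambda>) ^ (N - j))"
        unfolding a_def power_mult_distrib[of 2] by (simp only: algebra_simps)
      finally show "real (N choose j) * norm (exp_derivs (phase_derivs i \<phi> x) e j y) * ?w \<le> \<dots>" .
    qed
    also have "\<dots> = C * (2 * (g * \<Lambda>) + h1 * \<Lambda>) ^ N + C * (2 * (A * (h1 * G) * \<Lambda>) + h1 * \<Lambda>) ^ N"
      by (simp only: sum.distrib sum_distrib_left[symmetric] binomial_ring)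
    also have "\<dots> \<le> C * (h * \<Lambda>) ^ N + C * (h * \<Lambda>) ^ N"
    proof (intro add_mono mult_left_mono power_mono)
      have "(2 * g + h1) * \<Lambda> \<le> h * \<Lambda>" using h1 \<Lambda> g_def by (intro mult_right_mono) auto
      then show "2 * (g * \<Lambda>) + h1 * \<Lambda> \<le> h * \<Lambda>" by (simp add: algebra_simps)
      have "(2 * (A * (h1 * G)) + h1) * \<Lambda> \<le> h * \<Lambda>" using h1 \<Lambda> g_def by (intro mult_right_mono) auto
      then show "2 * (A * (h1 * G) * \<Lambda>) + h1 * \<Lambda> \<le> h * \<Lambda>" by (simp add: algebra_simps)
    qed (use C h1 g A G \<Lambda> in auto)
    finally show ?thesis by (simp add: \<Lambda>_def)
  qed
  show ?thesis
    by (rule that[of "2 * C" L]) (use main C L in auto)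
qed

text \<open>Up to a factor of constant modulus this is the short-time Fourier transform of \<open>exp (\<i> * \<phi>)\<close>; on the
  other hand it is the Fourier transform at \<open>\<xi>\<close> of the localised chirp
  \<open>y \<mapsto> exp (\<i> * \<phi> (x + y)) * cnj (\<psi> y)\<close>. Both points of view are used.\<close>

definition oscillatory_integral ::
    "(real ^ 'n::finite \<Rightarrow> real) \<Rightarrow> (real ^ 'n \<Rightarrow> complex) \<Rightarrow> real ^ 'n \<Rightarrow> real ^ 'n \<Rightarrow> complex" where
  "oscillatory_integral \<phi> \<psi> x \<xi> =
     (LINT y|lborel. exp (\<i> * of_real (\<phi> (x + y) - y \<bullet> \<xi>)) * cnj (\<psi> y))"

lemma integrable_of_weight_bound:
  fixes f :: "real ^ 'n::finite \<Rightarrow> complex"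
  assumes "continuous_on UNIV f" "\<And>y. norm (f y) * weight y \<le> C"
  shows "integrable lborel f"
    and "norm (\<integral>y. f y \<partial>lborel) \<le> C * (\<integral>y. inverse (weight (y :: real ^ 'n)) \<partial>lborel)"
proof -
  have b: "norm (f y) \<le> C * inverse (weight y)" for y
    using assms(2)[of y] weight_pos[of y] by (simp add: field_simps)
  have i: "integrable lborel (\<lambda>y :: real ^ 'n. C * inverse (weight y))"
    by (intro integrable_mult_right integrable_inverse_weight)
  show f: "integrable lborel f"
  proof (rule Bochner_Integration.integrable_bound[OF i])
    show "f \<in> borel_measurable lborel" using assms(1) by (simp add: borel_measurable_continuous_onI)
    show "AE y in lborel. norm (f y) \<le> norm (C * inverse (weight y))"
      using b by (intro AE_I2) (metis abs_ge_self order_trans real_norm_def)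
  qed
  have "norm (\<integral>y. f y \<partial>lborel) \<le> (\<integral>y. C * inverse (weight (y :: real ^ 'n)) \<partial>lborel)"
    by (rule Bochner_Integration.integral_norm_bound_integral[OF f i b])
  then show "norm (\<integral>y. f y \<partial>lborel) \<le> C * (\<integral>y. inverse (weight (y :: real ^ 'n)) \<partial>lborel)"
    by simp
qed

lemma has_partial_shift:
  "has_partial i f f' \<Longrightarrow> has_partial i (\<lambda>y. f (x + y)) (\<lambda>y. f' (x + y))"
  by (simp add: has_partial_def flip: add.assoc)

lemma has_partial_phase_derivs:
  assumes "poly_degree_le m \<phi>"
  shows "has_partial i (phase_derivs i \<phi> x l) (phase_derivs i \<phi> x (Suc l))"
proof -
  have "has_partial i ((partial i ^^ Suc l) \<phi>) ((partial i ^^ Suc (Suc l)) \<phi>)"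
    using has_partial_differentiable[OF poly_degree_le_differentiable[OF
        poly_degree_le_partial_power[OF assms, of "Suc l" i]], of i]
    by simp
  then have "has_partial i
      (\<lambda>y. \<i> * of_real ((partial i ^^ Suc l) \<phi> (x + y) + (if l = 0 then - partial i \<phi> x else 0)))
      (\<lambda>y. \<i> * of_real ((partial i ^^ Suc (Suc l)) \<phi> (x + y) + 0)
        + 0 * of_real ((partial i ^^ Suc l) \<phi> (x + y) + (if l = 0 then - partial i \<phi> x else 0)))"
    by (intro has_partial_mult has_partial_const has_partial_of_real has_partial_add has_partial_shift)
  then show ?thesis by (cases "l = 0") (auto simp: phase_derivs_def[abs_def])
qed

lemma continuous_phase_derivs:
  assumes "poly_degree_le m \<phi>"
  shows "continuous_on UNIV (phase_derivs i \<phi> x l)"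
  unfolding phase_derivs_def[abs_def]
  by (intro continuous_intros continuous_on_compose2[OF poly_degree_le_continuous[OF
        poly_degree_le_partial_power[OF assms, of "Suc l" i]]]) auto

text \<open>Integration by parts is carried out against the exponential with the constant frequency
  \<open>a = \<xi>\<^sub>i - \<partial>\<^sub>i \<phi> x\<close>, all the rest of the phase being treated as amplitude. In contrast to division by the
  gradient of the full phase, this needs neither a cutoff near stationary points nor derivatives of
  quotients.\<close>

proposition oscillatory_integral_bound:
  fixes \<phi> :: "real ^ 'n::finite \<Rightarrow> real" and \<psi> :: "real ^ 'n \<Rightarrow> complex"
  assumes \<phi>: "poly_degree_le (Suc (Suc k)) \<phi>"
    and s: "s = t * real (Suc k)" "s > 1"
    and \<psi>: "\<psi> \<in> GS_Sigma t s" and h: "h > 0" and B: "B \<ge> 0"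
  obtains C L where "C > 0" "L \<ge> 1"
    "\<And>l x N \<xi>. \<lbrakk>l \<ge> L; norm x \<le> B * l powr t; real N \<le> l\<rbrakk> \<Longrightarrow>
       \<bar>\<xi> $ i - partial i \<phi> x\<bar> ^ N * norm (oscillatory_integral \<phi> \<psi> x \<xi>) \<le> C * (h * l powr s) ^ N"
proof -
  let ?J = "\<integral>y. inverse (weight (y :: real ^ 'n)) \<partial>lborel"
  have J: "?J \<ge> 0" by (intro integral_nonneg_AE AE_I2) (simp add: less_imp_le weight_pos)
  obtain C L where C: "C > 0" "L \<ge> 1" and
    AB: "\<And>l x N y e. \<lbrakk>l \<ge> L; norm x \<le> B * l powr t; real N \<le> l; norm (e y) \<le> 1\<rbrakk> \<Longrightarrow>
       norm (leibniz (exp_derivs (phase_derivs i \<phi> x) e) (\<lambda>j y. cnj ((partial i ^^ j) \<psi> y)) N y) * weight y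
         \<le> C * (h * l powr s) ^ N"
    using amplitude_bound[OF \<phi> s \<psi> h B, of i thesis] by blast
  have sm: "smooth \<psi>"
  proof -
    have "\<psi> \<in> GS_Banach t s 1" using \<psi> by (auto simp: GS_Sigma_def)
    then show ?thesis by (simp add: GS_Banach_def)
  qed
  have "\<bar>\<xi> $ i - partial i \<phi> x\<bar> ^ N * norm (oscillatory_integral \<phi> \<psi> x \<xi>) \<le> (C * (?J + 1)) * (h * l powr s) ^ N"
    if l: "l \<ge> L" and x: "norm x \<le> B * l powr t" and N: "real N \<le> l" for l x N \<xi>
  proof -
    define a where "a = \<xi> $ i - partial i \<phi> x"
    \<comment> \<open>The sum \<open>a * y\<^sub>i\<close> removes the frequency \<open>a\<close>, so that \<open>\<partial>\<^sub>i e = phase_derivs i \<phi> x 0 * e\<close>.\<close>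
    define e where "e y = exp (\<i> * of_real (\<phi> (x + y) + y \<bullet> (- \<xi>) + a * y $ i))" for y
    define F where "F = leibniz (exp_derivs (phase_derivs i \<phi> x) e) (\<lambda>j y. cnj ((partial i ^^ j) \<psi> y))"
    have e1: "norm (e y) \<le> 1" for y by (simp add: e_def)
    have e': "has_partial i e (\<lambda>y. phase_derivs i \<phi> x 0 y * e y)"
    proof -
      have "has_partial i \<phi> (partial i \<phi>)"
        by (intro has_partial_differentiable poly_degree_le_differentiable[OF \<phi>])
      moreover have "has_partial i (\<lambda>y. a * y $ i) (\<lambda>_. a)"
        unfolding has_partial_def
        by (auto intro!: derivative_eq_intros simp: has_real_derivative_iff_has_vector_derivative[symmetric])
      ultimately have "has_partial i (\<lambda>y. \<i> * of_real (\<phi> (x + y) + y \<bullet> (- \<xi>) + a * y $ i))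
          (\<lambda>y. \<i> * of_real (partial i \<phi> (x + y) + (- \<xi>) $ i + a)
            + 0 * of_real (\<phi> (x + y) + y \<bullet> (- \<xi>) + a * y $ i))"
        by (intro has_partial_mult has_partial_const has_partial_of_real has_partial_add
            has_partial_shift has_partial_inner)
      from has_partial_exp[OF this]
      show ?thesis by (simp add: e_def[abs_def] phase_derivs_def a_def)
    qed
    have \<psi>': "has_partial i (\<lambda>y. cnj ((partial i ^^ j) \<psi> y)) (\<lambda>y. cnj ((partial i ^^ Suc j) \<psi> y))" for j
      using has_partial_differentiable[OF smooth_partial_power_differentiable[OF sm, of j i], of i]
      by (intro has_partial_cnj) simp
    have F': "has_partial i (F j) (F (Suc j))" for j
      unfolding F_def
      by (intro has_partial_leibniz has_partial_exp_derivs has_partial_phase_derivs[OF \<phi>] e' \<psi>')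
    have contF: "continuous_on UNIV (F j)" for j
    proof -
      have "continuous_on UNIV e" unfolding e_def[abs_def]
        by (intro continuous_intros continuous_on_compose2[OF poly_degree_le_continuous[OF \<phi>]]) auto
      moreover have "continuous_on UNIV ((partial i ^^ n) \<psi>)" for n
        using smooth_partial_power_differentiable[OF sm, of n i]
        by (auto intro!: continuous_at_imp_continuous_on differentiable_imp_continuous_within)
      ultimately show ?thesis unfolding F_def leibniz_def
        by (intro continuous_intros continuous_on_exp_derivs continuous_phase_derivs[OF \<phi>]) auto
    qed
    have bound: "norm (F j y) * weight y \<le> C * (h * l powr s) ^ j" if "j \<le> N" for j y
      unfolding F_def using that N by (intro AB l x e1) auto
    have intF: "integrable lborel (F j)" if "j \<le> N" for j
      by (rule integrable_of_weight_bound(1)[OF contF bound[OF that]])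
    have "\<bar>a\<bar> ^ N * norm (oscillatory_integral \<phi> \<psi> x \<xi>)
        = \<bar>- a\<bar> ^ N * norm (\<integral>y. exp (\<i> * of_real (- a * y $ i)) * F 0 y \<partial>lborel)"
    proof -
      have "exp (\<i> * of_real (- a * y $ i)) * F 0 y = exp (\<i> * of_real (\<phi> (x + y) - y \<bullet> \<xi>)) * cnj (\<psi> y)" for y
      proof -
        have "exp (\<i> * of_real (- a * y $ i)) * e y = exp (\<i> * of_real (\<phi> (x + y) - y \<bullet> \<xi>))"
          unfolding e_def exp_add[symmetric] by (simp add: algebra_simps)
        moreover have "F 0 y = e y * cnj (\<psi> y)" by (simp add: F_def leibniz_def)
        ultimately show ?thesis by (metis mult.assoc)
      qed
      then show ?thesis by (simp only: oscillatory_integral_def abs_minus_cancel)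
    qed
    also have "\<dots> = norm (\<integral>y. exp (\<i> * of_real (- a * y $ i)) * F N y \<partial>lborel)"
      by (rule fourier_integral_power[symmetric]) (use F' contF intF in auto)
    also have "\<dots> \<le> C * (h * l powr s) ^ N * ?J"
    proof (rule integrable_of_weight_bound(2))
      show "continuous_on UNIV (\<lambda>y. exp (\<i> * of_real (- a * y $ i)) * F N y)"
        by (intro continuous_intros contF)
      show "norm (exp (\<i> * of_real (- a * y $ i)) * F N y) * weight y \<le> C * (h * l powr s) ^ N" for y
        using bound[OF order_refl, of y] by (simp add: norm_mult)
    qed
    also have "\<dots> \<le> C * (h * l powr s) ^ N * (?J + 1)"
      using C(1) h by (intro mult_left_mono) auto
    finally show ?thesis by (simp add: a_def mult_ac)
  qed
  moreover have "C * (?J + 1) > 0" using C(1) J by simp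
  ultimately show ?thesis using that C(2) by blast
qed

section \<open>Bounding a function by its Fourier transform\<close>

text \<open>Lebesgue measure on \<open>real ^ 'n\<close> is the image of a product measure indexed by \<open>Basis\<close>; the work is
  the passage from basis vectors to coordinates.\<close>

lemma lborel_vec_integral_prod:
  fixes f :: "'n::finite \<Rightarrow> real \<Rightarrow> complex"
  assumes "\<And>i. integrable lborel (f i)"
  shows "integrable lborel (\<lambda>x :: real ^ 'n. \<Prod>i\<in>UNIV. f i (x $ i))"
    and "(\<integral>x. (\<Prod>i\<in>UNIV. f i ((x :: real ^ 'n) $ i)) \<partial>lborel) = (\<Prod>i\<in>UNIV. \<integral>r. f i r \<partial>lborel)"
proof -
  interpret product_sigma_finite "\<lambda>_ :: real ^ 'n. lborel :: real measure" ..
  let ?B = "Basis :: (real ^ 'n) set"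
  have B: "?B = (\<lambda>i. axis i 1) ` UNIV" by (auto simp: Basis_vec_def)
  have inj: "inj (\<lambda>i :: 'n. axis i (1 :: real))" by (auto simp: inj_on_def axis_eq_axis)
  define g where "g b = f (THE i. b = axis i (1 :: real))" for b :: "real ^ 'n"
  have g: "g (axis i 1) = f i" for i
  proof -
    have "(THE j. axis i (1 :: real) = axis j 1) = i"
      by (rule the_equality) (auto simp: axis_eq_axis)
    then show ?thesis by (simp add: g_def)
  qed
  have gi: "integrable lborel (g b)" if "b \<in> ?B" for b
    using that assms by (auto simp: B g)
  have [measurable]: "f i \<in> borel_measurable borel" for i
    using borel_measurable_integrable[OF assms] by simp
  let ?P = "\<lambda>x :: real ^ 'n. \<Prod>i\<in>UNIV. f i (x $ i)"
  let ?T = "\<lambda>z. \<Sum>b\<in>?B. z b *\<^sub>R b"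
  have eq: "?P (?T z) = (\<Prod>b\<in>?B. g b (z b))" for z
  proof -
    have "?T z $ i = z (axis i 1)" for i
      unfolding B sum.reindex[OF inj] by (simp add: axis_def if_distrib cong: if_cong)
    then show ?thesis unfolding B prod.reindex[OF inj] by (simp add: g)
  qed
  have T[measurable]: "?T \<in> (\<Pi>\<^sub>M b\<in>?B. lborel) \<rightarrow>\<^sub>M borel" by measurable
  have P[measurable]: "?P \<in> borel_measurable borel" by measurable
  have L: "(lborel :: (real ^ 'n) measure) = distr (\<Pi>\<^sub>M b\<in>?B. lborel) borel ?T" by (rule lborel_eq)
  show "integrable lborel ?P"
    by (subst L, subst integrable_distr_eq[OF T P], unfold eq)
       (intro product_integrable_prod gi; simp)
  have "(\<integral>x. ?P x \<partial>lborel) = (\<integral>z. (\<Prod>b\<in>?B. g b (z b)) \<partial>(\<Pi>\<^sub>M b\<in>?B. lborel))"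
    by (subst L, subst integral_distr[OF T P], unfold eq) simp
  also have "\<dots> = (\<Prod>b\<in>?B. \<integral>r. g b r \<partial>lborel)"
    by (intro product_integral_prod gi) auto
  also have "\<dots> = (\<Prod>i\<in>UNIV. \<integral>r. f i r \<partial>lborel)"
    unfolding B prod.reindex[OF inj] by (simp add: g)
  finally show "(\<integral>x. ?P x \<partial>lborel) = (\<Prod>i\<in>UNIV. \<integral>r. f i r \<partial>lborel)" .
qed

definition gauss :: "real ^ 'n::finite \<Rightarrow> real" where
  "gauss x = (\<Prod>i\<in>UNIV. std_normal_density (x $ i))"

lemma gauss_nonneg: "gauss x \<ge> 0"
  unfolding gauss_def by (intro prod_nonneg) auto

lemma gauss_le_1: "gauss x \<le> 1"
proof -
  have "std_normal_density r \<le> 1" for r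
  proof -
    have "1 \<le> 2 * pi" using pi_ge_two by linarith
    then have "1 / sqrt (2 * pi) * exp (- r\<^sup>2 / 2) \<le> 1 * 1"
      by (intro mult_mono) (auto simp: real_sqrt_ge_1_iff)
    then show ?thesis by (simp add: std_normal_density_def)
  qed
  then show ?thesis unfolding gauss_def by (intro prod_le_1) auto
qed

lemma gauss_continuous: "continuous_on UNIV (gauss :: real ^ 'n::finite \<Rightarrow> real)"
  unfolding gauss_def[abs_def] std_normal_density_def by (intro continuous_intros) auto

lemma exp_eq_gauss:
  "exp (- (norm z)\<^sup>2 / 2) = sqrt (2 * pi) ^ CARD('n) * gauss (z :: real ^ 'n::finite)"
proof -
  have "gauss z = (1 / sqrt (2 * pi)) ^ CARD('n) * exp (\<Sum>i\<in>UNIV. - (z $ i)\<^sup>2 / 2)"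
    unfolding gauss_def std_normal_density_def by (simp add: prod_dividef exp_sum power_divide)
  also have "(\<Sum>i\<in>UNIV. - (z $ i)\<^sup>2 / 2) = - (norm z)\<^sup>2 / 2"
    by (simp add: norm_vec_def L2_set_def sum_nonneg sum_negf sum_divide_distrib)
  finally show ?thesis by (simp add: power_divide)
qed

lemma fourier_gauss:
  fixes z :: "real ^ 'n::finite"
  shows "integrable lborel (gauss :: real ^ 'n \<Rightarrow> real)"
    and "(\<integral>\<eta>. exp (\<i> * of_real (z \<bullet> \<eta>)) * of_real (gauss \<eta>) \<partial>lborel) = of_real (exp (- (norm z)\<^sup>2 / 2))"
proof -
  have int: "integrable lborel (\<lambda>x. exp (\<i> * of_real (r * x)) * of_real (std_normal_density x))" for r :: real
  proof (rule Bochner_Integration.integrable_bound)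
    show "integrable lborel std_normal_density"
      using integrable_normal_moment[of 1 0 0] by simp
    have "continuous_on UNIV (\<lambda>x. exp (\<i> * of_real (r * x)) * of_real (std_normal_density x))"
      unfolding std_normal_density_def by (intro continuous_intros) auto
    then show "(\<lambda>x. exp (\<i> * of_real (r * x)) * of_real (std_normal_density x)) \<in> borel_measurable lborel"
      by (simp add: borel_measurable_continuous_onI)
  qed (simp add: norm_mult)
  have one: "(\<integral>x. exp (\<i> * of_real (r * x)) * of_real (std_normal_density x) \<partial>lborel) = of_real (exp (- r\<^sup>2 / 2))"
    for r :: real
  proof -
    have "char std_normal_distribution r = (\<integral>x. std_normal_density x *\<^sub>R exp (\<i> * of_real (r * x)) \<partial>lborel)"
      unfolding char_def by (subst integral_density) auto
    then show ?thesis
      by (simp add: char_std_normal_distribution scaleR_conv_of_real mult.commute)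
  qed
  have eq: "exp (\<i> * of_real (z \<bullet> \<eta>)) * of_real (gauss \<eta>)
      = (\<Prod>i\<in>UNIV. exp (\<i> * of_real (z $ i * \<eta> $ i)) * of_real (std_normal_density (\<eta> $ i)))" for z \<eta> :: "real ^ 'n"
    by (simp add: inner_vec_def exp_sum[symmetric] prod.distrib gauss_def sum_distrib_left)
  have "integrable lborel (\<lambda>\<eta> :: real ^ 'n. exp (\<i> * of_real (0 \<bullet> \<eta>)) * complex_of_real (gauss \<eta>))"
    unfolding eq by (rule lborel_vec_integral_prod(1)[OF int])
  then show "integrable lborel (gauss :: real ^ 'n \<Rightarrow> real)"
    by (simp add: complex_of_real_integrable_eq)
  have "(\<integral>\<eta>. exp (\<i> * of_real (z \<bullet> \<eta>)) * of_real (gauss \<eta>) \<partial>lborel)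
      = (\<Prod>i\<in>UNIV. complex_of_real (exp (- (z $ i)\<^sup>2 / 2)))"
    unfolding eq by (subst lborel_vec_integral_prod(2)[OF int]) (simp only: one)
  also have "\<dots> = of_real (exp (- (norm z)\<^sup>2 / 2))"
    by (simp add: norm_vec_def L2_set_def sum_nonneg exp_sum[symmetric] sum_negf sum_divide_distrib
        flip: of_real_prod)
  finally show "(\<integral>\<eta>. exp (\<i> * of_real (z \<bullet> \<eta>)) * of_real (gauss \<eta>) \<partial>lborel) = of_real (exp (- (norm z)\<^sup>2 / 2))" .
qed

text \<open>The inequality contained in Fourier inversion, up to its constant. Put \<open>F\<^sub>e z = F (y0 + e z)\<close> and \<open>\<theta> z = exp (- |z|\<^sup>2 / 2)\<close>, the
  Fourier transform of \<open>gauss\<close>. By Fubini the integral of \<open>F\<^sub>e * \<theta>\<close> equals that of the Fourier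
  transform of \<open>F\<^sub>e\<close> times \<open>gauss \<le> 1\<close>, and by scaling the latter is at most the integral of \<open>H\<close>, for
  every \<open>e\<close>. As \<open>e\<close> tends to \<open>0\<close>, the former tends to \<open>F y0\<close> times the integral of \<open>\<theta>\<close>, which is
  \<open>(2 \<pi>)\<^sup>d\<^sup>/\<^sup>2 \<ge> 1\<close>.\<close>

proposition norm_le_integral_fourier:
  fixes F :: "real ^ 'n::finite \<Rightarrow> complex"
  assumes cont: "continuous_on UNIV F" and int: "integrable lborel F"
    and bdd: "\<And>y. norm (F y) \<le> M"
    and H: "integrable lborel H"
    and le: "\<And>\<xi>. norm (\<integral>y. exp (\<i> * of_real (- (y \<bullet> \<xi>))) * F y \<partial>lborel) \<le> H \<xi>"
  shows "norm (F y0) \<le> (\<integral>\<xi>. H \<xi> \<partial>lborel)"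
proof -
  let ?c = "sqrt (2 * pi) ^ CARD('n)"
  have c: "?c \<ge> 1" using pi_ge_two by (intro one_le_power) (simp add: real_sqrt_ge_1_iff)
  define \<theta> where "\<theta> z = exp (- (norm z)\<^sup>2 / 2)" for z :: "real ^ 'n"
  have \<theta>: "\<theta> z = ?c * gauss z" for z unfolding \<theta>_def by (rule exp_eq_gauss)
  have \<theta>i: "integrable lborel \<theta>" unfolding \<theta>[abs_def]
    by (intro integrable_mult_right fourier_gauss)
  have [measurable]: "F \<in> borel_measurable borel" "\<theta> \<in> borel_measurable borel"
    "gauss \<in> borel_measurable (borel :: (real ^ 'n) measure)" "H \<in> borel_measurable borel"
    using cont H gauss_continuous \<theta>i by (auto intro: borel_measurable_continuous_onI
      dest: borel_measurable_integrable)
  have est: "norm (\<integral>z. F (y0 + e *\<^sub>R z) * of_real (\<theta> z) \<partial>lborel) \<le> (\<integral>\<xi>. H \<xi> \<partial>lborel)" if e: "e > 0" for e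
  proof -
    define K where "K z \<eta> = exp (\<i> * of_real (- (z \<bullet> \<eta>))) * (F (y0 + e *\<^sub>R z) * of_real (gauss \<eta>))" for z \<eta>
    have Fe: "integrable lborel (\<lambda>z. F (y0 + e *\<^sub>R z))"
      using lborel_integral_affine(2)[of F e y0] int e by simp
    have contK: "continuous_on UNIV (\<lambda>p. K (fst p) (snd p))"
      unfolding K_def by (intro continuous_intros continuous_on_compose2[OF cont]
          continuous_on_compose2[OF gauss_continuous]) auto
    have measK: "case_prod K \<in> borel_measurable (lborel \<Otimes>\<^sub>M lborel)"
      using borel_measurable_continuous_onI[OF contK] by (simp add: lborel_prod case_prod_unfold)
    have normK: "norm (K z \<eta>) = norm (F (y0 + e *\<^sub>R z)) * gauss \<eta>" for z \<eta>
      by (simp add: K_def norm_mult gauss_nonneg)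
    have measKz: "K z \<in> borel_measurable borel" for z
    proof (intro borel_measurable_continuous_onI)
      show "continuous_on UNIV (K z)"
        unfolding K_def by (intro continuous_intros continuous_on_compose2[OF gauss_continuous]) auto
    qed
    have intK: "integrable (lborel \<Otimes>\<^sub>M lborel) (case_prod K)"
    proof (rule lborel_pair.Fubini_integrable[OF measK])
      show "integrable lborel (\<lambda>z. \<integral>\<eta>. norm (case_prod K (z, \<eta>)) \<partial>lborel)"
        using Fe by (simp add: normK)
      show "AE z in lborel. integrable lborel (\<lambda>\<eta>. case_prod K (z, \<eta>))"
      proof (rule AE_I2)
        fix z
        have "integrable lborel (K z)"
        proof (rule Bochner_Integration.integrable_bound)
          show "integrable lborel (\<lambda>\<eta> :: real ^ 'n. norm (F (y0 + e *\<^sub>R z)) * gauss \<eta>)"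
            by (intro integrable_mult_right fourier_gauss)
        qed (use measKz in \<open>auto simp: normK gauss_nonneg abs_mult\<close>)
        then show "integrable lborel (\<lambda>\<eta>. case_prod K (z, \<eta>))" by simp
      qed
    qed
    have inner1: "(\<integral>\<eta>. K z \<eta> \<partial>lborel) = F (y0 + e *\<^sub>R z) * of_real (\<theta> z)" for z
    proof -
      have "(\<integral>\<eta>. K z \<eta> \<partial>lborel)
          = (\<integral>\<eta>. F (y0 + e *\<^sub>R z) * (exp (\<i> * of_real ((- z) \<bullet> \<eta>)) * of_real (gauss \<eta>)) \<partial>lborel)"
        by (simp add: K_def mult.left_commute)
      also have "\<dots> = F (y0 + e *\<^sub>R z) * (\<integral>\<eta>. exp (\<i> * of_real ((- z) \<bullet> \<eta>)) * of_real (gauss \<eta>) \<partial>lborel)"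
        by (rule integral_mult_right_zero)
      also have "\<dots> = F (y0 + e *\<^sub>R z) * of_real (\<theta> z)"
        unfolding fourier_gauss(2) by (simp add: \<theta>_def)
      finally show ?thesis .
    qed
    have inner2: "norm (\<integral>z. K z \<eta> \<partial>lborel) \<le> (1 / e ^ CARD('n)) * H (0 + (1 / e) *\<^sub>R \<eta>)" for \<eta>
    proof -
      define G where "G y = exp (\<i> * of_real (y0 \<bullet> ((1 / e) *\<^sub>R \<eta>)))
          * (exp (\<i> * of_real (- (y \<bullet> ((1 / e) *\<^sub>R \<eta>)))) * F y)" for y
      have [measurable]: "G \<in> borel_measurable borel"
        unfolding G_def by (intro borel_measurable_continuous_onI continuous_intros cont)
      have "K z \<eta> = of_real (gauss \<eta>) * G (y0 + e *\<^sub>R z)" for z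
      proof -
        have "exp (\<i> * of_real (- (z \<bullet> \<eta>))) = exp (\<i> * of_real (y0 \<bullet> ((1 / e) *\<^sub>R \<eta>)))
          * exp (\<i> * of_real (- ((y0 + e *\<^sub>R z) \<bullet> ((1 / e) *\<^sub>R \<eta>))))"
          unfolding exp_add[symmetric] using e by (simp add: inner_add_left algebra_simps)
        then show ?thesis unfolding K_def G_def by (simp add: mult_ac)
      qed
      then have "(\<integral>z. K z \<eta> \<partial>lborel) = of_real (gauss \<eta>) * (\<integral>z. G (y0 + e *\<^sub>R z) \<partial>lborel)"
        by simp
      also have "(\<integral>z. G (y0 + e *\<^sub>R z) \<partial>lborel) = (1 / e ^ CARD('n)) *\<^sub>R (\<integral>y. G y \<partial>lborel)"
        using lborel_integral_affine(1)[of G e y0] e by simp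
      finally have "norm (\<integral>z. K z \<eta> \<partial>lborel) = gauss \<eta> * ((1 / e ^ CARD('n)) * norm (\<integral>y. G y \<partial>lborel))"
        using e by (simp add: norm_mult gauss_nonneg)
      also have "norm (\<integral>y. G y \<partial>lborel)
          = norm (\<integral>y. exp (\<i> * of_real (- (y \<bullet> ((1 / e) *\<^sub>R \<eta>)))) * F y \<partial>lborel)"
        unfolding G_def integral_mult_right_zero by (simp only: norm_mult norm_exp_i_times mult_1)
      also have "gauss \<eta> * ((1 / e ^ CARD('n)) * \<dots>) \<le> 1 * ((1 / e ^ CARD('n)) * H ((1 / e) *\<^sub>R \<eta>))"
        using e by (intro mult_mono gauss_le_1 mult_left_mono le) auto
      finally show ?thesis by simp
    qed
    have "(\<integral>z. F (y0 + e *\<^sub>R z) * of_real (\<theta> z) \<partial>lborel) = (\<integral>z. (\<integral>\<eta>. K z \<eta> \<partial>lborel) \<partial>lborel)"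
      by (simp add: inner1)
    also have "\<dots> = (\<integral>\<eta>. (\<integral>z. K z \<eta> \<partial>lborel) \<partial>lborel)"
      by (rule lborel_pair.Fubini_integral[OF intK, symmetric])
    also have "norm \<dots> \<le> (\<integral>\<eta>. (1 / e ^ CARD('n)) * H (0 + (1 / e) *\<^sub>R \<eta>) \<partial>lborel)"
    proof (rule Bochner_Integration.integral_norm_bound_integral)
      show "integrable lborel (\<lambda>\<eta>. \<integral>z. K z \<eta> \<partial>lborel)"
        using lborel_pair.integrable_snd[OF intK] .
      show "integrable lborel (\<lambda>\<eta>. (1 / e ^ CARD('n)) * H (0 + (1 / e) *\<^sub>R \<eta>))"
        using e H by (intro integrable_mult_right lborel_integral_affine(2)) auto
    qed (rule inner2)
    also have "\<dots> = (\<integral>\<xi>. H \<xi> \<partial>lborel)"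
      using e lborel_integral_affine(1)[of H "1 / e" 0] by (simp add: power_one_over field_simps)
    finally show ?thesis .
  qed
  have lim: "(\<lambda>n. \<integral>z. F (y0 + inverse (real (Suc n)) *\<^sub>R z) * of_real (\<theta> z) \<partial>lborel)
      \<longlonglongrightarrow> (\<integral>z. F y0 * of_real (\<theta> z) \<partial>lborel)"
  proof (rule integral_dominated_convergence)
    show "integrable lborel (\<lambda>z. M * \<theta> z)" using \<theta>i by (rule integrable_mult_right)
    show "AE z in lborel. (\<lambda>n. F (y0 + inverse (real (Suc n)) *\<^sub>R z) * of_real (\<theta> z)) \<longlonglongrightarrow> F y0 * of_real (\<theta> z)"
    proof (intro AE_I2 tendsto_mult tendsto_const)
      fix z :: "real ^ 'n"
      have "(\<lambda>n. y0 + inverse (real (Suc n)) *\<^sub>R z) \<longlonglongrightarrow> y0 + 0 *\<^sub>R z"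
        by (intro tendsto_intros LIMSEQ_inverse_real_of_nat)
      moreover have "isCont F (y0 + 0 *\<^sub>R z)"
        using cont by (auto simp: continuous_on_eq_continuous_at)
      ultimately have "(\<lambda>n. F (y0 + inverse (real (Suc n)) *\<^sub>R z)) \<longlonglongrightarrow> F (y0 + 0 *\<^sub>R z)"
        by (rule isCont_tendsto_compose[rotated])
      then show "(\<lambda>n. F (y0 + inverse (real (Suc n)) *\<^sub>R z)) \<longlonglongrightarrow> F y0" by simp
    qed
    show "AE z in lborel. norm (F (y0 + inverse (real (Suc n)) *\<^sub>R z) * of_real (\<theta> z)) \<le> M * \<theta> z" for n
    proof (rule AE_I2)
      fix z :: "real ^ 'n"
      have "\<theta> z \<ge> 0" by (simp add: \<theta>_def)
      then show "norm (F (y0 + inverse (real (Suc n)) *\<^sub>R z) * of_real (\<theta> z)) \<le> M * \<theta> z"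
        using bdd by (simp add: norm_mult mult_right_mono)
    qed
  qed measurable
  have "norm (\<integral>z. F y0 * complex_of_real (\<theta> z) \<partial>lborel) \<le> (\<integral>\<xi>. H \<xi> \<partial>lborel)"
    by (rule Lim_bounded[OF tendsto_norm[OF lim], of 0]) (auto intro!: est)
  also have "(\<integral>z. F y0 * complex_of_real (\<theta> z) \<partial>lborel) = F y0 * of_real ?c"
  proof -
    have "(\<integral>\<eta>. gauss (\<eta> :: real ^ 'n) \<partial>lborel) = 1"
      using fourier_gauss(2)[of "0 :: real ^ 'n"] by (simp add: of_real_eq_1_iff[where 'a = complex])
    then show ?thesis by (simp add: \<theta>)
  qed
  finally have "norm (F y0) * ?c \<le> (\<integral>\<xi>. H \<xi> \<partial>lborel)" by (simp add: norm_mult norm_power)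
  moreover have "norm (F y0) * 1 \<le> norm (F y0) * ?c" using c by (intro mult_left_mono) auto
  ultimately show ?thesis by simp
qed

section \<open>The wave front set of a chirp\<close>

lemma norm_STFT_eq:
  fixes \<phi> :: "real ^ 'n::finite \<Rightarrow> real"
  assumes \<phi>: "continuous_on UNIV \<phi>" and \<psi>: "continuous_on UNIV \<psi>"
  shows "norm (STFT \<psi> (distr_of (\<lambda>x. exp (\<i> * of_real (\<phi> x)))) x \<xi>)
    = (2 * pi) powr (- real CARD('n) / 2) * norm (oscillatory_integral \<phi> \<psi> x \<xi>)"
proof -
  define g where "g y = exp (\<i> * of_real (\<phi> y)) * cnj (exp (\<i> * of_real (y \<bullet> \<xi>)) * \<psi> (y - x))" for y
  have [measurable]: "g \<in> borel_measurable borel"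
    unfolding g_def by (intro borel_measurable_continuous_onI continuous_intros \<phi>
      continuous_on_compose2[OF \<psi>]) auto
  have g: "g (x + y) = exp (- (\<i> * of_real (x \<bullet> \<xi>))) * (exp (\<i> * of_real (\<phi> (x + y) - y \<bullet> \<xi>)) * cnj (\<psi> y))" for y
  proof -
    have "exp (\<i> * of_real (\<phi> (x + y))) * cnj (exp (\<i> * of_real ((x + y) \<bullet> \<xi>)))
        = exp (- (\<i> * of_real (x \<bullet> \<xi>))) * exp (\<i> * of_real (\<phi> (x + y) - y \<bullet> \<xi>))"
      unfolding exp_cnj exp_add[symmetric] by (simp add: inner_add_left algebra_simps)
    then show ?thesis by (simp add: g_def)
  qed
  have "distr_of (\<lambda>x. exp (\<i> * of_real (\<phi> x))) (modulation \<xi> (translation x \<psi>)) = (\<integral>y. g y \<partial>lborel)"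
    by (simp add: distr_of_def modulation_def translation_def g_def)
  also have "\<dots> = (\<integral>y. g (x + y) \<partial>lborel)"
    by (rule lborel_integral_shift(1)[symmetric]) measurable
  also have "\<dots> = exp (- (\<i> * of_real (x \<bullet> \<xi>))) * oscillatory_integral \<phi> \<psi> x \<xi>"
    unfolding g oscillatory_integral_def by (rule integral_mult_right_zero)
  finally show ?thesis by (simp add: STFT_def norm_mult)
qed

lemma norm_oscillatory_integral_le:
  "norm (oscillatory_integral \<phi> \<psi> x \<xi>) \<le> (\<integral>y. norm (\<psi> y) \<partial>lborel)"
  unfolding oscillatory_integral_def
  by (rule order_trans[OF integral_norm_bound]) (simp add: norm_mult)

lemma mi_pow_scaleR: "mi_pow (r *\<^sub>R x) \<alpha> = r ^ mi_abs \<alpha> * mi_pow x \<alpha>"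
  by (simp add: mi_pow_def mi_abs_def power_mult_distrib prod.distrib power_sum)

lemma partial_homogeneous:
  fixes f :: "real ^ 'n::finite \<Rightarrow> real"
  assumes hom: "\<And>r x. f (r *\<^sub>R x) = r ^ Suc k * f x" and diff: "\<And>x. f differentiable (at x)"
    and r: "r > 0"
  shows "partial i f (r *\<^sub>R x) = r ^ k * partial i f x"
proof -
  have "((\<lambda>x. f (r *\<^sub>R x)) has_derivative (\<lambda>v. frechet_derivative f (at (r *\<^sub>R x)) (r *\<^sub>R v))) (at x)"
    by (rule has_derivative_compose[where f = "\<lambda>x. r *\<^sub>R x"])
       (use diff in \<open>auto intro!: derivative_eq_intros simp: frechet_derivative_works\<close>)
  moreover have "((\<lambda>x. r ^ Suc k * f x) has_derivative (\<lambda>v. r ^ Suc k * frechet_derivative f (at x) v)) (at x)"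
    using diff by (intro has_derivative_mult_right) (simp add: frechet_derivative_works)
  ultimately have "(\<lambda>v. frechet_derivative f (at (r *\<^sub>R x)) (r *\<^sub>R v)) = (\<lambda>v. r ^ Suc k * frechet_derivative f (at x) v)"
    unfolding hom by (rule has_derivative_unique)
  then have "frechet_derivative f (at (r *\<^sub>R x)) (r *\<^sub>R axis i 1) = r ^ Suc k * frechet_derivative f (at x) (axis i 1)"
    by metis
  moreover have "linear (frechet_derivative f (at (r *\<^sub>R x)))"
    using diff by (rule linear_frechet_derivative)
  ultimately show ?thesis
    using r by (simp add: partial_def linear_scale)
qed

text \<open>On the scale \<open>T = \<lambda>\<^sup>t\<close> the frequency \<open>\<partial>\<^sub>i \<phi> (T x)\<close> is \<open>\<lambda>\<^sup>s \<partial>\<^sub>i \<phi>m x\<close>, and the lower order terms of \<open>\<phi>\<close>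
  perturb it by a factor \<open>1 / T\<close> less.\<close>

lemma partial_asymptotics:
  fixes \<phi>m p :: "real ^ 'n::finite \<Rightarrow> real"
  assumes \<phi>m: "poly_degree_le (Suc (Suc k)) \<phi>m" and p: "poly_degree_le (Suc k) p"
    and hom: "\<And>r x. \<phi>m (r *\<^sub>R x) = r ^ Suc (Suc k) * \<phi>m x" and B: "B \<ge> 0"
  obtains C where "C > 0"
    "\<And>x T. \<lbrakk>norm x \<le> B; T \<ge> 1\<rbrakk> \<Longrightarrow>
      \<bar>partial i (\<lambda>x. \<phi>m x + p x) (T *\<^sub>R x) - T ^ Suc k * partial i \<phi>m x\<bar> \<le> C * T ^ k"
proof -
  have p': "poly_degree_le k (partial i p)" using poly_degree_le_partial[OF p, of i] by simp
  obtain C where C: "C > 0" "\<And>x. \<bar>partial i p x\<bar> \<le> C * (1 + norm x) ^ k"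
    using poly_degree_le_growth[OF p'] by blast
  have "\<bar>partial i (\<lambda>x. \<phi>m x + p x) (T *\<^sub>R x) - T ^ Suc k * partial i \<phi>m x\<bar> \<le> (C * (1 + B) ^ k) * T ^ k"
    if "norm x \<le> B" "T \<ge> 1" for x T
  proof -
    have "partial i (\<lambda>x. \<phi>m x + p x) (T *\<^sub>R x) = T ^ Suc k * partial i \<phi>m x + partial i p (T *\<^sub>R x)"
      using that by (simp add: partial_add poly_degree_le_differentiable[OF \<phi>m]
          poly_degree_le_differentiable[OF p] partial_homogeneous[OF hom poly_degree_le_differentiable[OF \<phi>m]]
          del: power_Suc)
    then have "\<bar>partial i (\<lambda>x. \<phi>m x + p x) (T *\<^sub>R x) - T ^ Suc k * partial i \<phi>m x\<bar> \<le> C * (1 + norm (T *\<^sub>R x)) ^ k"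
      using C(2)[of "T *\<^sub>R x"] by simp
    also have "\<dots> \<le> C * ((1 + B) * T) ^ k"
    proof (intro mult_left_mono power_mono)
      have "T * norm x \<le> T * B" using that by (intro mult_left_mono) auto
      moreover have "norm (T *\<^sub>R x) = T * norm x" "(1 + B) * T = T + T * B"
        using that by (simp_all add: algebra_simps)
      ultimately show "1 + norm (T *\<^sub>R x) \<le> (1 + B) * T" using that by linarith
    qed (use C in auto)
    finally show ?thesis by (simp add: power_mult_distrib mult.assoc)
  qed
  moreover have "C * (1 + B) ^ k > 0" using C B by simp
  ultimately show ?thesis using that by blast
qed

text \<open>If \<open>\<xi>0\<^sub>i \<noteq> \<partial>\<^sub>i \<phi>m x0\<close>, then near \<open>(x0, \<xi>0)\<close> and for large \<open>\<lambda>\<close> the frequencies \<open>\<lambda>\<^sup>s \<xi>\<^sub>i\<close> and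
  \<open>\<partial>\<^sub>i \<phi> (\<lambda>\<^sup>t x)\<close> differ by at least \<open>c \<lambda>\<^sup>s\<close>. With \<open>N = \<lfloor>\<lambda>\<rfloor>\<close> integrations by parts the transform is
  \<open>O((h / c) ^ N)\<close>, and \<open>h = c * exp (- r)\<close> gives the rate \<open>r\<close>.\<close>

lemma STFT_decay:
  fixes \<phi>m p :: "real ^ 'n::finite \<Rightarrow> real" and \<psi> :: "real ^ 'n \<Rightarrow> complex"
  assumes \<phi>m: "poly_degree_le (Suc (Suc k)) \<phi>m" and p: "poly_degree_le (Suc k) p"
    and hom: "\<And>r x. \<phi>m (r *\<^sub>R x) = r ^ Suc (Suc k) * \<phi>m x"
    and s: "s = t * real (Suc k)" "s > 1" and t: "t > 0"
    and \<psi>: "\<psi> \<in> GS_Sigma t s"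
    and z0: "(x0, \<xi>0) \<noteq> 0" and noncrit: "\<xi>0 \<noteq> grad \<phi>m x0"
  shows "\<exists>U. open U \<and> 0 \<notin> U \<and> (x0, \<xi>0) \<in> U \<and>
          (\<forall>r>0. bdd_above ((\<lambda>(l, x, \<xi>).
             exp (r * l) * norm (STFT \<psi> (distr_of (\<lambda>x. exp (\<i> * of_real (\<phi>m x + p x))))
               ((l powr t) *\<^sub>R x) ((l powr s) *\<^sub>R \<xi>))) ` ({0<..} \<times> U)))"
proof -
  let ?\<phi> = "\<lambda>x. \<phi>m x + p x"
  have \<phi>: "poly_degree_le (Suc (Suc k)) ?\<phi>"
    by (intro poly_degree_le.add \<phi>m poly_degree_le_mono[OF p]) simp
  obtain i where i: "\<xi>0 $ i \<noteq> partial i \<phi>m x0"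
    using noncrit by (auto simp: grad_def vec_eq_iff)
  define c where "c = \<bar>\<xi>0 $ i - partial i \<phi>m x0\<bar> / 3"
  have c: "c > 0" using i by (simp add: c_def)
  define B where "B = norm (x0, \<xi>0) + 1"
  have B: "B \<ge> 0" by (simp add: B_def)
  define U where "U = {z. 2 * c < \<bar>snd z $ i - partial i \<phi>m (fst z)\<bar>} \<inter> ball 0 B \<inter> - {0}"
  have "open {z :: (real ^ 'n) \<times> (real ^ 'n). 2 * c < \<bar>snd z $ i - partial i \<phi>m (fst z)\<bar>}"
    by (intro open_Collect_less continuous_intros
        continuous_on_compose2[OF poly_degree_le_continuous[OF poly_degree_le_partial[OF \<phi>m]]]) auto
  then have "open U" unfolding U_def by (intro open_Int open_ball open_Compl closed_singleton) auto
  moreover have "0 \<notin> U" by (simp add: U_def)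
  moreover have "(x0, \<xi>0) \<in> U" using c z0 by (simp add: U_def B_def c_def)
  moreover have "bdd_above ((\<lambda>(l, x, \<xi>). exp (r * l) * norm (STFT \<psi> (distr_of (\<lambda>x. exp (\<i> * of_real (?\<phi> x))))
               ((l powr t) *\<^sub>R x) ((l powr s) *\<^sub>R \<xi>))) ` ({0<..} \<times> U))"
    if r: "r > 0" for r
  proof -
    let ?I = "\<integral>y. norm (\<psi> y) \<partial>lborel"
    let ?a = "(2 * pi) powr (- real CARD('n) / 2)"
    have h: "c * exp (- r) > 0" using c by simp
    obtain C L where C: "C > 0" "L \<ge> 1" and
      OI: "\<And>l x N \<xi>. \<lbrakk>l \<ge> L; norm x \<le> B * l powr t; real N \<le> l\<rbrakk> \<Longrightarrow>
       \<bar>\<xi> $ i - partial i ?\<phi> x\<bar> ^ N * norm (oscillatory_integral ?\<phi> \<psi> x \<xi>) \<le> C * ((c * exp (- r)) * l powr s) ^ N"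
      using oscillatory_integral_bound[OF \<phi> s \<psi> h B, of i thesis] by blast
    obtain D where D: "D > 0" "\<And>x T. \<lbrakk>norm x \<le> B; T \<ge> 1\<rbrakk> \<Longrightarrow>
      \<bar>partial i ?\<phi> (T *\<^sub>R x) - T ^ Suc k * partial i \<phi>m x\<bar> \<le> D * T ^ k"
      using partial_asymptotics[OF \<phi>m p hom B, of i thesis] by blast
    \<comment> \<open>Beyond \<open>L'\<close> the error of the leading frequency is at most \<open>c * T ^ (k + 1)\<close>.\<close>
    define L' where "L' = max L ((D / c) powr (1 / t))"
    have bound: "exp (r * l) * norm (STFT \<psi> (distr_of (\<lambda>x. exp (\<i> * of_real (?\<phi> x))))
               ((l powr t) *\<^sub>R x) ((l powr s) *\<^sub>R \<xi>)) \<le> ?a * max (exp (r * L') * ?I) (C * exp r)"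
      if l: "l > 0" and z: "(x, \<xi>) \<in> U" for l x \<xi>
    proof -
      let ?O = "norm (oscillatory_integral ?\<phi> \<psi> ((l powr t) *\<^sub>R x) ((l powr s) *\<^sub>R \<xi>))"
      have "exp (r * l) * ?O \<le> max (exp (r * L') * ?I) (C * exp r)"
      proof (cases "l < L'")
        case True
        have "exp (r * l) * ?O \<le> exp (r * L') * ?I"
          using True r by (intro mult_mono norm_oscillatory_integral_le) auto
        then show ?thesis by simp
      next
        case False
        then have lL: "l \<ge> L" "l \<ge> (D / c) powr (1 / t)" "l \<ge> 1"
          using C(2) by (auto simp: L'_def)
        define T where "T = l powr t"
        have T1: "T \<ge> 1" using lL t by (simp add: T_def ge_one_powr_ge_zero)
        have TD: "D \<le> c * T"
        proof -
          have "D / c = ((D / c) powr (1 / t)) powr t" using D c t by (simp add: powr_powr)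
          also have "\<dots> \<le> T" unfolding T_def using lL t by (intro powr_mono2) auto
          finally show ?thesis using c by (simp add: pos_divide_le_eq mult.commute)
        qed
        have Ts: "l powr s = T ^ Suc k"
          unfolding T_def s(1) powr_powr[symmetric] using lL by (intro powr_realpow) simp
        have xB: "norm x \<le> B"
          using z norm_fst_le[of x \<xi>] by (auto simp: U_def)
        have "c * T ^ Suc k \<le> \<bar>(l powr s *\<^sub>R \<xi>) $ i - partial i ?\<phi> (T *\<^sub>R x)\<bar>"
        proof -
          have "2 * c * T ^ Suc k \<le> \<bar>\<xi> $ i - partial i \<phi>m x\<bar> * T ^ Suc k"
            using z T1 by (intro mult_right_mono) (auto simp: U_def)
          also have "\<dots> = \<bar>T ^ Suc k * \<xi> $ i - T ^ Suc k * partial i \<phi>m x\<bar>"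
            using T1 by (simp add: abs_mult flip: right_diff_distrib del: power_Suc)
          finally have "2 * c * T ^ Suc k \<le> \<bar>T ^ Suc k * \<xi> $ i - T ^ Suc k * partial i \<phi>m x\<bar>" .
          moreover have "D * T ^ k \<le> c * T ^ Suc k"
            using mult_right_mono[OF TD, of "T ^ k"] T1 by (simp add: mult.assoc)
          moreover note D(2)[OF xB T1]
          ultimately show ?thesis unfolding Ts by simp
        qed
        then have "(c * T ^ Suc k) ^ nat \<lfloor>l\<rfloor> * ?O \<le> \<bar>(l powr s *\<^sub>R \<xi>) $ i - partial i ?\<phi> (T *\<^sub>R x)\<bar> ^ nat \<lfloor>l\<rfloor> * ?O"
          using c T1 by (intro mult_right_mono power_mono) auto
        also have "\<dots> \<le> C * ((c * exp (- r)) * l powr s) ^ nat \<lfloor>l\<rfloor>"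
          unfolding T_def
        proof (rule OI[OF lL(1)])
          show "norm (l powr t *\<^sub>R x) \<le> B * l powr t" using mult_right_mono[OF xB, of "l powr t"] by (simp add: mult.commute)
          show "real (nat \<lfloor>l\<rfloor>) \<le> l" using lL by simp
        qed
        also have "\<dots> = (c * T ^ Suc k) ^ nat \<lfloor>l\<rfloor> * (C * exp (- r) ^ nat \<lfloor>l\<rfloor>)"
          unfolding Ts by (simp only: power_mult_distrib mult_ac)
        finally have "?O \<le> C * exp (- r) ^ nat \<lfloor>l\<rfloor>"
          using c T1 by (subst (asm) mult_le_cancel_left_pos) auto
        also have "exp (- r) ^ nat \<lfloor>l\<rfloor> = exp (- (r * real (nat \<lfloor>l\<rfloor>)))"
          by (simp add: exp_of_nat_mult[symmetric] mult.commute)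
        also have "\<dots> \<le> exp (- (r * (l - 1)))"
        proof -
          have "l - 1 \<le> real (nat \<lfloor>l\<rfloor>)" using lL by linarith
          then show ?thesis using r by simp
        qed
        finally have "exp (r * l) * ?O \<le> exp (r * l) * (C * exp (- (r * (l - 1))))"
          using C(1) by simp
        also have "\<dots> = C * exp r"
          by (simp add: exp_add[symmetric] algebra_simps exp_diff exp_minus field_simps)
        finally show ?thesis by simp
      qed
      then have "?a * (exp (r * l) * ?O) \<le> ?a * max (exp (r * L') * ?I) (C * exp r)"
        by (intro mult_left_mono) auto
      moreover have "norm (STFT \<psi> (distr_of (\<lambda>x. exp (\<i> * of_real (?\<phi> x))))
               ((l powr t) *\<^sub>R x) ((l powr s) *\<^sub>R \<xi>)) = ?a * ?O"
        by (rule norm_STFT_eq[OF poly_degree_le_continuous[OF \<phi>] GS_Sigma_continuous[OF \<psi>]])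
      ultimately show ?thesis by (simp only: mult.left_commute)
    qed
    show ?thesis
      by (rule bdd_aboveI[of _ "?a * max (exp (r * L') * ?I) (C * exp r)"]) (use bound in auto)
  qed
  ultimately show ?thesis by blast
qed

text \<open>The localised chirp has modulus \<open>|\<psi>|\<close> for every \<open>\<lambda>\<close>, so the \<open>L\<^sup>1\<close> norm of its Fourier transform
  cannot tend to \<open>0\<close>. But frequencies at distance at least \<open>\<epsilon> \<lambda>\<^sup>s\<close> from \<open>\<nabla>\<phi> (\<lambda>\<^sup>t x0)\<close> contribute
  exponentially little by \<open>oscillatory_integral_bound\<close>, and if the transform decays exponentially on
  \<open>U\<close>, then so do the remaining frequencies.\<close>

lemma STFT_no_decay:
  fixes \<phi>m p :: "real ^ 'n::finite \<Rightarrow> real" and \<psi> :: "real ^ 'n \<Rightarrow> complex"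
  assumes \<phi>m: "poly_degree_le (Suc (Suc k)) \<phi>m" and p: "poly_degree_le (Suc k) p"
    and hom: "\<And>r x. \<phi>m (r *\<^sub>R x) = r ^ Suc (Suc k) * \<phi>m x"
    and s: "s = t * real (Suc k)" "s > 1" and t: "t > 0"
    and \<psi>: "\<psi> \<in> GS_Sigma t s"
    and U: "open U" "(x0, grad \<phi>m x0) \<in> U"
    and bdd: "bdd_above ((\<lambda>(l, x, \<xi>).
             exp (1 * l) * norm (STFT \<psi> (distr_of (\<lambda>x. exp (\<i> * of_real (\<phi>m x + p x))))
               ((l powr t) *\<^sub>R x) ((l powr s) *\<^sub>R \<xi>))) ` ({0<..} \<times> U))"
  shows "\<psi> = (\<lambda>_. 0)"
proof -
  let ?\<phi> = "\<lambda>x. \<phi>m x + p x"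
  let ?d = "real CARD('n)"
  let ?a = "(2 * pi) powr (- real CARD('n) / 2)"
  let ?J = "\<integral>y. inverse (weight (y :: real ^ 'n)) \<partial>lborel"
  have d: "?d > 0" by simp
  have \<phi>: "poly_degree_le (Suc (Suc k)) ?\<phi>"
    by (intro poly_degree_le.add \<phi>m poly_degree_le_mono[OF p]) simp
  have cont\<psi>: "continuous_on UNIV \<psi>" by (rule GS_Sigma_continuous[OF \<psi>])
  obtain \<epsilon>0 where \<epsilon>0: "\<epsilon>0 > 0" "ball (x0, grad \<phi>m x0) \<epsilon>0 \<subseteq> U"
    using U by (meson open_contains_ball)
  define \<epsilon> where "\<epsilon> = \<epsilon>0 / (2 * ?d)"
  have \<epsilon>: "\<epsilon> > 0" "?d * (2 * \<epsilon>) = \<epsilon>0" using \<epsilon>0 d by (auto simp: \<epsilon>_def)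
  obtain M0 where M0: "\<And>l \<xi>. \<lbrakk>l > 0; (x0, \<xi>) \<in> U\<rbrakk> \<Longrightarrow> exp l * norm (STFT \<psi> (distr_of (\<lambda>x. exp (\<i> * of_real (?\<phi> x))))
               ((l powr t) *\<^sub>R x0) ((l powr s) *\<^sub>R \<xi>)) \<le> M0"
    using bdd unfolding bdd_above_def by fastforce
  define M where "M = max 0 (M0 / ?a)"
  have near: "norm (oscillatory_integral ?\<phi> \<psi> ((l powr t) *\<^sub>R x0) ((l powr s) *\<^sub>R \<xi>)) \<le> M * exp (- l)"
    if "l > 0" "dist \<xi> (grad \<phi>m x0) < \<epsilon>0" for l \<xi>
  proof -
    let ?O = "norm (oscillatory_integral ?\<phi> \<psi> ((l powr t) *\<^sub>R x0) ((l powr s) *\<^sub>R \<xi>))"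
    have "(x0, \<xi>) \<in> U"
      using that(2) by (intro subsetD[OF \<epsilon>0(2)]) (simp add: dist_Pair_Pair dist_commute)
    from M0[OF that(1) this] have "exp l * (?a * ?O) \<le> M0"
      by (subst (asm) norm_STFT_eq[OF poly_degree_le_continuous[OF \<phi>] cont\<psi>])
    then have "exp l * ?O \<le> M0 / ?a" by (simp add: pos_le_divide_eq mult_ac)
    also have "\<dots> \<le> M" by (simp add: M_def)
    finally show ?thesis by (simp add: exp_minus field_simps)
  qed
  have he: "\<epsilon> * exp (- 1) > 0" using \<epsilon> by simp
  define osc_bound where "osc_bound i C L \<longleftrightarrow> (\<forall>l x N \<xi>. l \<ge> L \<longrightarrow> norm x \<le> norm x0 * l powr t \<longrightarrow> real N \<le> l \<longrightarrow>
       \<bar>\<xi> $ i - partial i ?\<phi> x\<bar> ^ N * norm (oscillatory_integral ?\<phi> \<psi> x \<xi>) \<le> C * ((\<epsilon> * exp (- 1)) * l powr s) ^ N)"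
    for i C L
  have "\<exists>C L. C > 0 \<and> L \<ge> 1 \<and> osc_bound i C L" for i
    by (rule oscillatory_integral_bound[OF \<phi> s \<psi> he norm_ge_zero[of x0], of i])
       (unfold osc_bound_def, blast)
  then obtain C L where C: "\<And>i. C i > 0" "\<And>i. L i \<ge> 1" and CL: "\<And>i. osc_bound i (C i) (L i)"
    by metis
  have OI: "\<bar>\<xi> $ i - partial i ?\<phi> x\<bar> ^ N * norm (oscillatory_integral ?\<phi> \<psi> x \<xi>) \<le> C i * ((\<epsilon> * exp (- 1)) * l powr s) ^ N"
    if "l \<ge> L i" "norm x \<le> norm x0 * l powr t" "real N \<le> l" for i l x N \<xi>
    using CL[of i] that unfolding osc_bound_def by simp
  define asym where "asym i D \<longleftrightarrow> (\<forall>x T. norm x \<le> norm x0 \<longrightarrow> T \<ge> 1 \<longrightarrow>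
      \<bar>partial i ?\<phi> (T *\<^sub>R x) - T ^ Suc k * partial i \<phi>m x\<bar> \<le> D * T ^ k)" for i D
  have "\<exists>D>0. asym i D" for i
    by (rule partial_asymptotics[OF \<phi>m p hom norm_ge_zero[of x0], of i]) (unfold asym_def, blast)
  then obtain D where D0: "\<And>i. D i > 0" and aD: "\<And>i. asym i (D i)"
    by metis
  have D: "D i > 0" "\<lbrakk>norm x \<le> norm x0; T \<ge> 1\<rbrakk> \<Longrightarrow>
      \<bar>partial i ?\<phi> (T *\<^sub>R x) - T ^ Suc k * partial i \<phi>m x\<bar> \<le> D i * T ^ k" for i x T
    using D0 aD[of i] unfolding asym_def by blast+
  define L' where "L' = (\<Sum>i\<in>UNIV. L i) + (\<Sum>i\<in>UNIV. D i / \<epsilon>) powr (1 / t) + 2 * ?d"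
  define C' where "C' = (\<Sum>i\<in>UNIV. C i)"
  have CC: "C i \<le> C'" for i
    unfolding C'_def using C(1) by (intro member_le_sum) (auto intro: less_imp_le)
  have C'0: "C' \<ge> 0"
    unfolding C'_def using C(1) by (intro sum_nonneg) (auto intro: less_imp_le)
  \<comment> \<open>A common bound for the transform times the weight centred at \<open>\<nabla>\<phi> (\<lambda>\<^sup>t x0)\<close>, for all frequencies.\<close>
  define \<kappa> where "\<kappa> l = (M + C' * exp 1) * exp (- l) * (1 + (\<epsilon> * l powr s)\<^sup>2) ^ CARD('n)" for l
  have key: "norm (oscillatory_integral ?\<phi> \<psi> ((l powr t) *\<^sub>R x0) \<xi>)
      * weight (\<xi> - grad ?\<phi> ((l powr t) *\<^sub>R x0)) \<le> \<kappa> l" if l: "l \<ge> L'" for l \<xi>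
  proof -
    have Li: "L i \<le> (\<Sum>i\<in>UNIV. L i)" for i
      using C(2) by (intro member_le_sum) (auto intro: order_trans[of 0 1])
    have L0: "(\<Sum>i\<in>UNIV. L i) \<ge> 1" using Li[of undefined] C(2)[of undefined] by linarith
    have Dpow: "(\<Sum>i\<in>UNIV. D i / \<epsilon>) powr (1 / t) \<ge> 0" by simp
    have l1: "l \<ge> 1" and lLi: "l \<ge> L i" and lD: "l \<ge> (\<Sum>i\<in>UNIV. D i / \<epsilon>) powr (1 / t)" and ld: "l \<ge> 2 * ?d + 1" for i
      using l L0 Li[of i] Dpow d unfolding L'_def by linarith+
    define T where "T = l powr t"
    have T1: "T \<ge> 1" using l1 t by (simp add: T_def ge_one_powr_ge_zero)
    have Ts: "l powr s = T ^ Suc k"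
      unfolding T_def s(1) powr_powr[symmetric] using l1 by (intro powr_realpow) simp
    have s0: "l powr s > 0" using l1 by simp
    have DT: "D i \<le> \<epsilon> * T" for i
    proof -
      have S: "D i / \<epsilon> \<le> (\<Sum>i\<in>UNIV. D i / \<epsilon>)"
        using D(1) \<epsilon>(1) by (intro member_le_sum) (auto intro: less_imp_le)
      have "0 \<le> D i / \<epsilon>" using D(1)[of i] \<epsilon>(1) by simp
      with S have S0: "(\<Sum>i\<in>UNIV. D i / \<epsilon>) \<ge> 0" by linarith
      have "(\<Sum>i\<in>UNIV. D i / \<epsilon>) = ((\<Sum>i\<in>UNIV. D i / \<epsilon>) powr (1 / t)) powr t"
        using t S0 by (simp add: powr_powr)
      also have "\<dots> \<le> T" unfolding T_def using lD t by (intro powr_mono2) auto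
      finally have "D i / \<epsilon> \<le> T" using S by linarith
      then show ?thesis using \<epsilon>(1) by (simp add: pos_divide_le_eq mult.commute)
    qed
    define b where "b = \<epsilon> * l powr s"
    have b: "b > 0" using \<epsilon>(1) s0 by (simp add: b_def)
    define \<eta> where "\<eta> = \<xi> - grad ?\<phi> (T *\<^sub>R x0)"
    have \<eta>i: "\<eta> $ i = \<xi> $ i - partial i ?\<phi> (T *\<^sub>R x0)" for i by (simp add: \<eta>_def grad_def)
    let ?O = "norm (oscillatory_integral ?\<phi> \<psi> (T *\<^sub>R x0) \<xi>)"
    have "Max (range (\<lambda>i. \<bar>\<eta> $ i\<bar>)) \<in> range (\<lambda>i. \<bar>\<eta> $ i\<bar>)" by (rule Max_in) auto
    then obtain j where j: "\<bar>\<eta> $ j\<bar> = Max (range (\<lambda>i. \<bar>\<eta> $ i\<bar>))" by force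
    have jmax: "\<bar>\<eta> $ i\<bar> \<le> \<bar>\<eta> $ j\<bar>" for i unfolding j by (intro Max_ge) auto
    define a where "a = \<bar>\<eta> $ j\<bar>"
    have wa: "weight \<eta> \<le> (1 + r\<^sup>2) ^ CARD('n)" if "a \<le> r" for r
    proof -
      have "weight \<eta> \<le> (\<Prod>i\<in>(UNIV :: 'n set). 1 + r\<^sup>2)"
        unfolding weight_def
      proof (rule prod_mono, safe)
        fix i
        have "\<bar>\<eta> $ i\<bar> \<le> \<bar>r\<bar>" using jmax[of i] that by (simp add: a_def)
        then show "1 + (\<eta> $ i)\<^sup>2 \<le> 1 + r\<^sup>2" by (simp add: abs_le_square_iff)
      qed (auto intro: add_nonneg_nonneg)
      then show ?thesis by simp
    qed
    have "?O * weight \<eta> \<le> (M + C' * exp 1) * exp (- l) * (1 + b\<^sup>2) ^ CARD('n)"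
    proof (cases "a < b")
      case True
      \<comment> \<open>The rescaled frequency, all of whose components turn out to be close to those of \<open>grad \<phi>m x0\<close>.\<close>
      define \<zeta> where "\<zeta> = (1 / l powr s) *\<^sub>R \<xi>"
      have "dist \<zeta> (grad \<phi>m x0) < \<epsilon>0"
      proof -
        have comp: "\<bar>(\<zeta> - grad \<phi>m x0) $ i\<bar> < 2 * \<epsilon>" for i
        proof -
          have "\<bar>\<xi> $ i - T ^ Suc k * partial i \<phi>m x0\<bar> \<le> \<bar>\<eta> $ i\<bar> + D i * T ^ k"
            using D(2)[OF order_refl T1, of i] unfolding \<eta>i by linarith
          also have "D i * T ^ k \<le> b"
            using mult_right_mono[OF DT[of i], of "T ^ k"] T1 by (simp add: b_def Ts mult.assoc)
          also have "\<bar>\<eta> $ i\<bar> < b" using jmax[of i] True by (simp add: a_def)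
          finally have "\<bar>\<xi> $ i - l powr s * partial i \<phi>m x0\<bar> < 2 * \<epsilon> * l powr s"
            by (simp add: Ts b_def mult_ac)
          moreover have "\<xi> $ i - l powr s * partial i \<phi>m x0 = l powr s * (\<zeta> - grad \<phi>m x0) $ i"
            using s0 by (simp add: \<zeta>_def grad_def field_simps)
          ultimately have "l powr s * \<bar>(\<zeta> - grad \<phi>m x0) $ i\<bar> < l powr s * (2 * \<epsilon>)"
            using s0 by (simp add: abs_mult mult.commute)
          then show ?thesis using s0 by (simp only: mult_less_cancel_left_pos)
        qed
        have "dist \<zeta> (grad \<phi>m x0) \<le> (\<Sum>i\<in>UNIV. \<bar>(\<zeta> - grad \<phi>m x0) $ i\<bar>)"
          unfolding dist_norm by (rule norm_le_l1_cart)
        also have "\<dots> < (\<Sum>i\<in>(UNIV :: 'n set). 2 * \<epsilon>)"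
          by (intro sum_strict_mono comp) auto
        also have "\<dots> = \<epsilon>0" using \<epsilon>(2) by simp
        finally show ?thesis .
      qed
      from near[OF _ this, of l] have "?O \<le> M * exp (- l)"
        using l1 s0 by (simp add: \<zeta>_def T_def)
      also have "\<dots> \<le> (M + C' * exp 1) * exp (- l)"
        using C'0 by (intro mult_right_mono) auto
      finally have "?O \<le> (M + C' * exp 1) * exp (- l)" .
      then show ?thesis
        using True by (intro mult_mono wa) (auto intro: less_imp_le weight_pos order_trans[OF norm_ge_zero])
    next
      case False
      then have ab: "a \<ge> b" "a > 0" using b by auto
      define N where "N = nat \<lfloor>l\<rfloor>"
      have N: "real N \<le> l" "l - 1 \<le> real N" using l1 unfolding N_def by linarith+
      have N2: "N \<ge> 2 * CARD('n)"
      proof -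
        have "real (2 * CARD('n)) \<le> real N" using N(2) ld by simp
        then show ?thesis by (simp only: of_nat_le_iff)
      qed
      have "a ^ N * ?O \<le> C j * ((\<epsilon> * exp (- 1)) * l powr s) ^ N"
        unfolding a_def \<eta>i
        by (rule OI[OF lLi _ N(1)]) (simp add: T_def mult.commute)
      also have "\<dots> = C j * exp (- real N) * b ^ N"
      proof -
        have "exp (- 1 :: real) ^ N = exp (- real N)"
          by (simp add: exp_of_nat_mult[symmetric])
        then show ?thesis unfolding b_def power_mult_distrib by (simp add: mult_ac)
      qed
      finally have O: "?O \<le> C j * exp (- real N) * (b / a) ^ N"
        using ab by (simp add: power_divide pos_le_divide_eq mult.commute)
      \<comment> \<open>The \<open>N\<close>-fold decay beyond \<open>b\<close> suppresses the weight, which grows like \<open>a\<close> to the power \<open>2 d \<le> N\<close>.\<close>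
      have ba: "(b / a) ^ N * (1 + a\<^sup>2) ^ CARD('n) \<le> (1 + b\<^sup>2) ^ CARD('n)"
      proof -
        have "(b / a) ^ N \<le> (b / a) ^ (2 * CARD('n))"
          using ab b N2 by (intro power_decreasing) auto
        then have "(b / a) ^ N * (1 + a\<^sup>2) ^ CARD('n) \<le> ((b / a)\<^sup>2) ^ CARD('n) * (1 + a\<^sup>2) ^ CARD('n)"
          by (intro mult_right_mono) (auto simp: power_mult)
        also have "\<dots> = ((b / a)\<^sup>2 * (1 + a\<^sup>2)) ^ CARD('n)" by (rule power_mult_distrib[symmetric])
        also have "\<dots> \<le> (1 + b\<^sup>2) ^ CARD('n)"
        proof (intro power_mono)
          have "(b / a)\<^sup>2 \<le> 1" using ab b by (intro power_le_one) auto
          moreover have "(b / a)\<^sup>2 * (1 + a\<^sup>2) = (b / a)\<^sup>2 + b\<^sup>2"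
            using ab by (simp add: power_divide field_simps)
          ultimately show "(b / a)\<^sup>2 * (1 + a\<^sup>2) \<le> 1 + b\<^sup>2" by simp
        qed (auto intro: add_nonneg_nonneg mult_nonneg_nonneg)
        finally show ?thesis .
      qed
      have "?O * weight \<eta> \<le> (C j * exp (- real N) * (b / a) ^ N) * (1 + a\<^sup>2) ^ CARD('n)"
        using O wa[OF order_refl] C(1)[of j] ab b weight_pos[of \<eta>]
        by (intro mult_mono) (auto intro!: mult_nonneg_nonneg less_imp_le[of 0 "C j"] less_imp_le[OF weight_pos])
      also have "\<dots> = (C j * exp (- real N)) * ((b / a) ^ N * (1 + a\<^sup>2) ^ CARD('n))" by simp
      also have "\<dots> \<le> (C j * exp (- real N)) * (1 + b\<^sup>2) ^ CARD('n)"
        using ba C(1)[of j] by (intro mult_left_mono) auto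
      also have "\<dots> \<le> ((M + C' * exp 1) * exp (- l)) * (1 + b\<^sup>2) ^ CARD('n)"
      proof (intro mult_right_mono)
        have "exp (- real N) \<le> exp 1 * exp (- l)"
          unfolding exp_add[symmetric] using N(2) by simp
        then have "C j * exp (- real N) \<le> C' * (exp 1 * exp (- l))"
          using CC[of j] C(1)[of j] by (intro mult_mono) auto
        also have "\<dots> \<le> (M + C' * exp 1) * exp (- l)"
          by (simp add: M_def distrib_right)
        finally show "C j * exp (- real N) \<le> (M + C' * exp 1) * exp (- l)" .
      qed auto
      finally show ?thesis .
    qed
    then show ?thesis by (simp add: \<kappa>_def b_def \<eta>_def T_def)
  qed
  obtain W where W: "\<And>y. norm (\<psi> y) * weight y \<le> W"
  proof -
    obtain K where K: "\<And>i k n y. norm y ^ k * norm ((partial i ^^ n) \<psi> y) * weight y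
       \<le> K * 1 ^ (k + n) * fact k powr t * fact n powr s"
      using GS_Sigma_weighted_bound[OF \<psi> zero_less_one t] by metis
    have "norm (\<psi> y) * weight y \<le> K" for y
      using K[where k = 0 and n = 0 and y = y] by simp
    then show ?thesis by (rule that)
  qed
  have bound: "norm (\<psi> y) \<le> \<kappa> l * ?J" if l: "l \<ge> L'" for l y
  proof -
    let ?x = "(l powr t) *\<^sub>R x0"
    let ?g = "grad ?\<phi> ?x"
    define F where "F y = exp (\<i> * of_real (?\<phi> (?x + y))) * cnj (\<psi> y)" for y
    have contF: "continuous_on UNIV F"
      unfolding F_def[abs_def] by (intro continuous_intros cont\<psi>
          continuous_on_compose2[OF poly_degree_le_continuous[OF \<phi>]]) auto
    have normF: "norm (F y) = norm (\<psi> y)" for y by (simp add: F_def norm_mult)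
    have iw: "integrable lborel (\<lambda>\<xi>. inverse (weight (- ?g + \<xi>)))"
      by (rule lborel_integral_shift(2)[OF _ integrable_inverse_weight])
         (simp add: weight_def)
    have "norm (F y) \<le> (\<integral>\<xi>. \<kappa> l * inverse (weight (- ?g + \<xi>)) \<partial>lborel)"
    proof (rule norm_le_integral_fourier[OF contF])
      show "integrable lborel F"
        by (rule integrable_of_weight_bound(1)[OF contF, where C = W]) (simp only: normF W)
      show "norm (F y) \<le> W" for y
        using W[of y] weight_ge_1[of y] mult_left_mono[OF weight_ge_1[of y], of "norm (\<psi> y)"]
        unfolding normF by simp
      show "integrable lborel (\<lambda>\<xi>. \<kappa> l * inverse (weight (- ?g + \<xi>)))"
        using iw by (rule integrable_mult_right)
      show "norm (\<integral>y. exp (\<i> * of_real (- (y \<bullet> \<xi>))) * F y \<partial>lborel) \<le> \<kappa> l * inverse (weight (- ?g + \<xi>))" for \<xi>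
      proof -
        have "exp (\<i> * of_real (- (y \<bullet> \<xi>))) * F y = exp (\<i> * of_real (?\<phi> (?x + y) - y \<bullet> \<xi>)) * cnj (\<psi> y)" for y
          unfolding F_def mult.assoc[symmetric] exp_add[symmetric] by (simp add: algebra_simps)
        then have "(\<integral>y. exp (\<i> * of_real (- (y \<bullet> \<xi>))) * F y \<partial>lborel) = oscillatory_integral ?\<phi> \<psi> ?x \<xi>"
          by (simp only: oscillatory_integral_def)
        then show ?thesis
          using key[OF l, of \<xi>] weight_pos[of "- ?g + \<xi>"]
          by (simp add: field_simps)
      qed
    qed
    also have "\<dots> = \<kappa> l * ?J"
    proof -
      have "(\<integral>\<xi>. inverse (weight (- ?g + \<xi>)) \<partial>lborel) = ?J"
        by (rule lborel_integral_shift(1)) (simp add: weight_def)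
      then show ?thesis by simp
    qed
    finally show ?thesis by (simp add: normF)
  qed
  have \<kappa>0: "(\<kappa> \<longlongrightarrow> 0) at_top"
  proof -
    have s0: "s > 0" using s(2) by simp
    \<comment> \<open>One factor \<open>exp (- l / d)\<close> for each of the \<open>d\<close> factors of the weight.\<close>
    have "((\<lambda>l. exp (- l / ?d) * (1 + (\<epsilon> * l powr s)\<^sup>2)) \<longlongrightarrow> 0) at_top"
      using d s0 \<epsilon>(1) by real_asymp
    then have "((\<lambda>l. (M + C' * exp 1) * (exp (- l / ?d) * (1 + (\<epsilon> * l powr s)\<^sup>2)) ^ CARD('n))
        \<longlongrightarrow> (M + C' * exp 1) * 0 ^ CARD('n)) at_top"
      by (intro tendsto_intros)
    moreover have "(M + C' * exp 1) * (exp (- l / ?d) * (1 + (\<epsilon> * l powr s)\<^sup>2)) ^ CARD('n) = \<kappa> l" for l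
      unfolding \<kappa>_def power_mult_distrib[of "exp _"] by (simp add: exp_of_nat_mult[symmetric])
    ultimately show ?thesis by (simp add: power_0_left)
  qed
  show ?thesis
  proof
    fix y
    have "((\<lambda>l. \<kappa> l * ?J) \<longlongrightarrow> 0 * ?J) at_top" by (intro tendsto_mult \<kappa>0 tendsto_const)
    moreover have "eventually (\<lambda>l. norm (\<psi> y) \<le> \<kappa> l * ?J) at_top"
      using eventually_ge_at_top[of L'] by eventually_elim (rule bound)
    ultimately have "norm (\<psi> y) \<le> 0 * ?J"
      by (intro tendsto_lowerbound[of "\<lambda>l. \<kappa> l * ?J"]) auto
    then show "\<psi> y = 0" by simp
  qed
qed

text \<open>A critical point \<open>(0, \<xi>)\<close> would have \<open>\<xi> = \<nabla>\<phi>m 0 = 0\<close> by homogeneity, and the origin is excluded from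
  the wave front set.\<close>

proposition WF_chirp:
  fixes \<phi>m p :: "real ^ 'n::finite \<Rightarrow> real" and \<psi> :: "real ^ 'n \<Rightarrow> complex"
  assumes \<phi>m: "poly_degree_le (Suc (Suc k)) \<phi>m" and p: "poly_degree_le (Suc k) p"
    and hom: "\<And>r x. \<phi>m (r *\<^sub>R x) = r ^ Suc (Suc k) * \<phi>m x"
    and s: "s = t * real (Suc k)" "s > 1" and t: "t > 0"
    and \<psi>: "\<psi> \<in> GS_Sigma t s" "\<psi> \<noteq> (\<lambda>_. 0)"
  shows "WF t s \<psi> (distr_of (\<lambda>x. exp (\<i> * of_real (\<phi>m x + p x)))) = {(x, grad \<phi>m x) | x. x \<noteq> 0}"
proof (intro equalityI subsetI)
  let ?u = "distr_of (\<lambda>x. exp (\<i> * of_real (\<phi>m x + p x)))"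
  fix z assume "z \<in> WF t s \<psi> ?u"
  moreover obtain x \<xi> where z: "z = (x, \<xi>)" by fastforce
  ultimately have z0: "(x, \<xi>) \<noteq> 0" and no: "\<not> (\<exists>U. open U \<and> 0 \<notin> U \<and> (x, \<xi>) \<in> U \<and>
          (\<forall>r>0. bdd_above ((\<lambda>(l, x, \<xi>).
             exp (r * l) * norm (STFT \<psi> ?u ((l powr t) *\<^sub>R x) ((l powr s) *\<^sub>R \<xi>)))
             ` ({0<..} \<times> U))))"
    unfolding WF_def mem_Collect_eq by blast+
  have \<xi>: "\<xi> = grad \<phi>m x"
    using STFT_decay[OF \<phi>m p hom s t \<psi>(1) z0] no by blast
  have "partial i \<phi>m 0 = 0" for i
    using partial_homogeneous[OF hom poly_degree_le_differentiable[OF \<phi>m], of 2 i 0] one_less_power[of "2::real" "Suc k"]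
    by simp
  then have "grad \<phi>m 0 = 0" by (simp add: grad_def vec_eq_iff)
  then have "x \<noteq> 0" using z0 \<xi> by (auto simp: zero_prod_def)
  then show "z \<in> {(x, grad \<phi>m x) | x. x \<noteq> 0}" using z \<xi> by blast
next
  let ?u = "distr_of (\<lambda>x. exp (\<i> * of_real (\<phi>m x + p x)))"
  fix z assume "z \<in> {(x, grad \<phi>m x) | x. x \<noteq> 0}"
  then obtain x where x: "z = (x, grad \<phi>m x)" "x \<noteq> 0" by blast
  have "\<not> (\<exists>U. open U \<and> 0 \<notin> U \<and> z \<in> U \<and>
          (\<forall>r>0. bdd_above ((\<lambda>(l, x, \<xi>).
             exp (r * l) * norm (STFT \<psi> ?u ((l powr t) *\<^sub>R x) ((l powr s) *\<^sub>R \<xi>)))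
             ` ({0<..} \<times> U))))"
    using STFT_no_decay[OF \<phi>m p hom s t \<psi>(1), of _ x] \<psi>(2) zero_less_one unfolding x(1) by blast
  moreover have "z \<noteq> 0" using x by (auto simp: zero_prod_def)
  ultimately show "z \<in> WF t s \<psi> ?u" unfolding WF_def mem_Collect_eq by blast
qed

theorem theorem6p1:
  fixes m :: nat
    and c :: "('n::finite \<Rightarrow> nat) \<Rightarrow> real"
    and \<phi> \<phi>m p :: "real ^ 'n \<Rightarrow> real"
    and u \<psi> :: "real ^ 'n \<Rightarrow> complex"
    and t :: real
  assumes "m \<ge> 2"
    and "p = (\<lambda>x. \<Sum>\<alpha> | mi_abs \<alpha> < m. c \<alpha> * mi_pow x \<alpha>)"
    and "\<phi>m = (\<lambda>x. \<Sum>\<alpha> | mi_abs \<alpha> = m. c \<alpha> * mi_pow x \<alpha>)"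
    and "\<exists>\<alpha>. mi_abs \<alpha> = m \<and> c \<alpha> \<noteq> 0"
    and "\<phi> = (\<lambda>x. \<phi>m x + p x)"
    and "u = (\<lambda>x. exp (\<i> * of_real (\<phi> x)))"
    and "t > 1 / (real m - 1)"
    and "\<psi> \<in> GS_Sigma t (t * (real m - 1))" and "\<psi> \<noteq> (\<lambda>_. 0)"
  shows "WF t (t * (real m - 1)) \<psi> (distr_of u) \<subseteq> {(x, grad \<phi>m x) | x. x \<noteq> 0}
    \<and> (CARD('n) = 1 \<longrightarrow> (\<forall>x. \<phi> (- x) = \<phi> x) \<or> (\<forall>x. \<phi> (- x) = - \<phi> x) \<longrightarrow>
        WF t (t * (real m - 1)) \<psi> (distr_of u) = {(x, grad \<phi>m x) | x. x \<noteq> 0})"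
proof -
  obtain k where m: "m = Suc (Suc k)"
    using assms(1) by (metis add_2_eq_Suc le_Suc_ex)
  have fin: "finite {\<alpha> :: 'n \<Rightarrow> nat. mi_abs \<alpha> < m}" "finite {\<alpha> :: 'n \<Rightarrow> nat. mi_abs \<alpha> = m}"
    by (auto intro: finite_subset[OF _ finite_mi_abs_le[of m]])
  have \<phi>m: "poly_degree_le (Suc (Suc k)) \<phi>m"
    unfolding assms(3) by (intro poly_degree_le_sum poly_degree_le_scale poly_degree_le_mi_pow fin) (simp add: m)
  have p: "poly_degree_le (Suc k) p"
    unfolding assms(2) by (intro poly_degree_le_sum poly_degree_le_scale poly_degree_le_mi_pow fin) (simp add: m)
  have hom: "\<phi>m (r *\<^sub>R x) = r ^ Suc (Suc k) * \<phi>m x" for r x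
    unfolding assms(3) sum_distrib_left by (rule sum.cong) (simp_all add: mi_pow_scaleR m mult_ac)
  have s: "t * (real m - 1) = t * real (Suc k)" by (simp add: m)
  have "1 / real (Suc k) < t" using assms(7) by (simp add: m)
  then have s1: "t * (real m - 1) > 1" and t: "t > 0"
    unfolding s by (simp_all add: pos_divide_less_eq less_trans[of 0 "1 / real (Suc k)"] del: of_nat_Suc)
  have u: "u = (\<lambda>x. exp (\<i> * of_real (\<phi>m x + p x)))" by (simp add: assms(5,6))
  show ?thesis
    unfolding u using WF_chirp[OF \<phi>m p hom s s1 t assms(8,9)] by blast
qed

end
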